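(* Let $N\ge 1$, $0<\theta\le 2$ and $p>1$. For a nonnegative measurable function $\phi$ on $\mathbb{R}^N$ consider the Cauchy problem $$\partial_t u+(-\Delta)^{\theta/2}u=u^p\ \text{ in } \mathbb{R}^N\times(0,T),\qquad u(x,0)=\phi(x)\ \text{ in }\mathbb{R}^N. \qquad (P)$$ Then the following hold. (i) Assume that $r>N/\theta$ and $r\ge 1/(p-1)$. If $\phi\ge 0$ and $\phi^{(p-1)r}\in L^1_{\mathrm{ul},\rho}(\mathbb{R}^N)$, then (P) has a local-in-time (integral) solution. (ii) Let $r:=N/\theta$ and $p>1+\theta/N$. If $\phi\ge0$ and $\phi^{(p-1)r}\in\mathcal{L}^1_{\mathrm{ul},\rho}(\mathbb{R}^N)$, then (P) has a local-in-time (integral) solution. (iii) For any $r\in(0,N/\theta)$ there is $\phi\ge 0$ such that $\phi^{(p-1)r}\in L^1_{\mathrm{ul},\rho}(\mathbb{R}^N)$ and (P) has no local-in-time nonnegative (integral) solution.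
   Context: Uniformly local spaces: for a fixed $\rho>0$, $L^1_{\mathrm{ul},\rho}(\mathbb{R}^N)$ is the set of $u\in L^1_{\mathrm{loc}}(\mathbb{R}^N)$ with $\|u\|_{L^1_{\mathrm{ul},\rho}}=\sup_{y\in\mathbb{R}^N}\int_{B_y(\rho)}|u(x)|\,dx<\infty$, where $B_y(\rho)=\{x:|x-y|<\rho\}$. $\mathcal{L}^1_{\mathrm{ul},\rho}(\mathbb{R}^N)$ is the closure of the space $BUC(\mathbb{R}^N)$ of bounded uniformly continuous functions in $L^1_{\mathrm{ul},\rho}(\mathbb{R}^N)$. Semigroup: $G(x,t)=(2\pi)^{-N}\int_{\mathbb{R}^N}e^{ix\cdot\xi-t|\xi|^\theta}d\xi$ is the fundamental solution of $\partial_tu+(-\Delta)^{\theta/2}u=0$ (a positive function with $\int_{\mathbb{R}^N} G(x,t)dx=1$), and $S(t)[\psi](x)=\int_{\mathbb{R}^N}G(x-y,t)\psi(y)\,dy$; for nonnegative measurable $\psi$ this takes values in $[0,\infty]$. Integral solution: a nonnegative measurable function $u$ on $\mathbb{R}^N\times(0,T)$ is a solution of (P) on $(0,T)$ if $$\infty>u(t)=S(t)\phi+\int_0^tS(t-s)[u(s)^p]\,ds\quad\text{a.e. } x\in\mathbb{R}^N,\ 0<t<T.$$ (P) has a local-in-time solution if such a $u$ exists for some $T>0$. *)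

theory Defs
  imports "HOL-Analysis.Analysis"
begin

text \<open>
  The space \<open>\<real>\<^sup>N\<close> is an arbitrary Euclidean space \<open>'a\<close>, with \<open>N = DIM('a) \<ge> 1\<close>.
  Measurability is Lebesgue measurability throughout.
\<close>

definition ul_norm :: "real \<Rightarrow> ('a::euclidean_space \<Rightarrow> real) \<Rightarrow> ennreal" where
  "ul_norm \<rho> u = (SUP y. \<integral>\<^sup>+x\<in>ball y \<rho>. ennreal \<bar>u x\<bar> \<partial>lebesgue)"

definition L1_loc :: "('a::euclidean_space \<Rightarrow> real) set" where
  "L1_loc = {u. \<forall>K. compact K \<longrightarrow> u absolutely_integrable_on K}"

definition L1_ul :: "real \<Rightarrow> ('a::euclidean_space \<Rightarrow> real) set" where
  "L1_ul \<rho> = {u \<in> L1_loc. ul_norm \<rho> u < \<infinity>}"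

definition BUC :: "('a::euclidean_space \<Rightarrow> real) set" where
  "BUC = {v. bounded (range v) \<and> uniformly_continuous_on UNIV v}"

text \<open>The closure of \<open>BUC\<close> in \<open>L1_ul \<rho>\<close> with respect to \<open>ul_norm \<rho>\<close>.\<close>

definition L1_ul_BUC :: "real \<Rightarrow> ('a::euclidean_space \<Rightarrow> real) set" where
  "L1_ul_BUC \<rho> = {u \<in> L1_ul \<rho>. \<forall>\<epsilon>>0. \<exists>v\<in>BUC. ul_norm \<rho> (\<lambda>x. u x - v x) < ennreal \<epsilon>}"

text \<open>
  The Fourier integral is real, as the integrand at \<open>- \<xi>\<close> is the complex conjugate of that
  at \<open>\<xi>\<close>; \<open>Re\<close> only changes the type. It converges absolutely for \<open>t > 0\<close>, the only
  values of \<open>t\<close> used below.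
\<close>

definition fundamental_solution :: "real \<Rightarrow> 'a::euclidean_space \<Rightarrow> real \<Rightarrow> real" where
  "fundamental_solution \<theta> x t =
     Re ((\<integral>\<xi>. exp (\<i> * complex_of_real (x \<bullet> \<xi>) - complex_of_real (t * norm \<xi> powr \<theta>))
            \<partial>lebesgue)
         / complex_of_real ((2 * pi) ^ DIM('a)))"

text \<open>
  The coercion \<open>ennreal\<close> would truncate negative values, but the kernel is positive for
  \<open>0 < \<theta> \<le> 2\<close> and \<open>t > 0\<close>.
\<close>

definition heat_semigroup ::
  "real \<Rightarrow> real \<Rightarrow> ('a::euclidean_space \<Rightarrow> ennreal) \<Rightarrow> 'a \<Rightarrow> ennreal" where
  "heat_semigroup \<theta> t \<psi> x =
     (\<integral>\<^sup>+y. ennreal (fundamental_solution \<theta> (x - y) t) * \<psi> y \<partial>lebesgue)"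

text \<open>
  The integral equation is an equation in \<open>[0, \<infinity>]\<close>, required for every \<open>t \<in> (0, T)\<close> at almost
  every \<open>x\<close>. As \<open>u\<close> is real-valued, it forces the right-hand side to be finite there.
\<close>

definition integral_solution ::
  "real \<Rightarrow> real \<Rightarrow> ('a::euclidean_space \<Rightarrow> real) \<Rightarrow> real \<Rightarrow> ('a \<Rightarrow> real \<Rightarrow> real) \<Rightarrow> bool" where
  "integral_solution \<theta> p \<phi> T u \<longleftrightarrow>
     (\<lambda>(x, t). u x t) \<in> borel_measurable (lebesgue_on (UNIV \<times> {0<..<T})) \<and>
     (\<forall>x. \<forall>t\<in>{0<..<T}. 0 \<le> u x t) \<and>
     (\<forall>t\<in>{0<..<T}. AE x in lebesgue.
        ennreal (u x t) =
          heat_semigroup \<theta> t (\<lambda>y. ennreal (\<phi> y)) x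
          + (\<integral>\<^sup>+s\<in>{0<..<t}. heat_semigroup \<theta> (t - s) (\<lambda>y. ennreal (u y s powr p)) x \<partial>lebesgue))"

definition has_local_solution ::
  "real \<Rightarrow> real \<Rightarrow> ('a::euclidean_space \<Rightarrow> real) \<Rightarrow> bool" where
  "has_local_solution \<theta> p \<phi> \<longleftrightarrow> (\<exists>T>0. \<exists>u. integral_solution \<theta> p \<phi> T u)"

definition nonneg_measurable :: "('a::euclidean_space \<Rightarrow> real) \<Rightarrow> bool" where
  "nonneg_measurable \<phi> \<longleftrightarrow> \<phi> \<in> borel_measurable lebesgue \<and> (\<forall>x. 0 \<le> \<phi> x)"

end

theory Submission
  imports Defs "HOL-Probability.Probability"
begin

text \<open>
  Write \<open>N\<close> for the dimension, \<open>G\<close> for the fundamental solution and \<open>S\<close> for the semigroup.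

  Everything about \<open>G\<close> rests on the fact that it is nonnegative and radially decreasing. For
  \<open>\<theta> \<le> 2\<close> the symbol \<open>exp (- t |\<xi>|\<^sup>\<theta>)\<close> is a limit of positive combinations of Gaussians in \<open>\<xi>\<close>,
  because \<open>1 - (1 - x) powr (\<theta>/2)\<close> has nonnegative Taylor coefficients (\<open>damped_radial_stable\<close>), and
  the Fourier transform of a Gaussian is a Gaussian. Positivity makes Fourier inversion elementary
  (\<open>fourier_cos_inversion\<close>) and yields that \<open>G\<close> has mass \<open>1\<close> and that \<open>S\<close> is a semigroup. Monotonicity
  in \<open>|x|\<close> yields the smoothing estimate \<open>S(t)g \<le> C t\<^bsup>-N/\<theta>\<^esup> \<parallel>g\<parallel>\<close> for the uniformly local norm and
  \<open>0 < t < 1\<close> (\<open>heat_semigroup_le_ul_norm_power\<close>).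

  A supersolution of the integral equation forces a solution by monotone iteration
  (\<open>has_local_solution_if_supersolution\<close>). With \<open>w(t) = (S(t)[\<phi>\<^sup>\<beta>])\<^bsup>1/\<beta>\<^esup>\<close> and suitable \<open>\<beta>\<close> the function
  \<open>2 w\<close> is a supersolution for small times: \<open>S(t)\<phi> \<le> w(t)\<close> by Jensen's inequality, and the nonlinear term
  is controlled by the decay of the supremum of \<open>w(s)\<close>, which comes from the smoothing estimate. For
  \<open>r > N/\<theta>\<close> the resulting time integral converges and is small for short times. For \<open>r = N/\<theta>\<close> the estimate
  is scale invariant, so smallness has to come from the datum: approximation by bounded functions shows
  that \<open>t\<^bsup>N/\<theta>\<^esup> S(t)[\<phi>\<^bsup>(p-1)r\<^esup>]\<close> tends uniformly to \<open>0\<close>.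

  Conversely, inserting the bound \<open>u(t) \<ge> S(t)\<phi>\<close> into the equation again and again shows that a solution
  can exist only if \<open>t\<^bsup>1/(p-1)\<^esup> S(t)\<phi>\<close> stays below a constant depending on \<open>p\<close> only
  (\<open>heat_semigroup_lt_threshold\<close>). For \<open>\<phi>(x) = |x|\<^bsup>-a\<^esup>\<close> with \<open>a > \<theta>/(p-1)\<close> this fails near the origin, and if
  \<open>r < N/\<theta>\<close> then \<open>a\<close> can be chosen so that in addition \<open>a (p-1) r < N\<close>, which puts \<open>\<phi>\<^bsup>(p-1)r\<^esup>\<close> into the
  uniformly local space.
\<close>

section \<open>Affine changes of variables\<close>

lemma nn_integral_lborel_affine:
  fixes f :: "'a::euclidean_space \<Rightarrow> ennreal"
  assumes [measurable]: "f \<in> borel_measurable borel" and c: "c \<noteq> 0"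
  shows "(\<integral>\<^sup>+x. f x \<partial>lborel) = ennreal (\<bar>c\<bar> ^ DIM('a)) * (\<integral>\<^sup>+x. f (a + c *\<^sub>R x) \<partial>lborel)"
  by (subst lborel_affine[OF c, of a])
     (simp add: nn_integral_density nn_integral_distr nn_integral_cmult)

lemma integrable_lborel_affine:
  fixes f :: "'a::euclidean_space \<Rightarrow> real"
  assumes f: "integrable lborel f" and c: "c \<noteq> 0"
  shows "integrable lborel (\<lambda>x. f (a + c *\<^sub>R x))"
proof -
  have [measurable]: "f \<in> borel_measurable borel" using f by auto
  have "integrable (density (distr lborel borel (\<lambda>x. a + c *\<^sub>R x)) (\<lambda>_. \<bar>c\<bar>^DIM('a))) f"
    using f lborel_affine[OF c, of a] by simp
  then have "integrable (distr lborel borel (\<lambda>x. a + c *\<^sub>R x)) f"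
    using c by (subst (asm) integrable_density) auto
  then show ?thesis by (subst (asm) integrable_distr_eq) auto
qed

lemma integral_lborel_affine:
  fixes f :: "'a::euclidean_space \<Rightarrow> real"
  assumes [measurable]: "f \<in> borel_measurable borel" and c: "c \<noteq> 0"
  shows "(\<integral>x. f x \<partial>lborel) = \<bar>c\<bar> ^ DIM('a) * (\<integral>x. f (a + c *\<^sub>R x) \<partial>lborel)"
  by (subst lborel_affine[OF c, of a]) (simp add: integral_density integral_distr)

section \<open>The Fourier transform of a Gaussian\<close>

lemma norm_sq_euclidean: "(norm (x::'a::euclidean_space))\<^sup>2 = (\<Sum>b\<in>Basis. (x \<bullet> b)\<^sup>2)"
  by (subst norm_eq_sqrt_inner, subst euclidean_inner) (simp add: sum_nonneg power2_eq_square)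

lemma std_gaussian_integral: "(\<integral>\<^sup>+(x::real). exp (- x\<^sup>2 / 2) \<partial>lborel) = sqrt (2 * pi)"
proof -
  have "(\<integral>\<^sup>+(x::real). exp (- x\<^sup>2 / 2) \<partial>lborel) = (\<integral>\<^sup>+(x::real). ennreal (sqrt (2 * pi)) * std_normal_density x \<partial>lborel)"
    by (intro nn_integral_cong) (simp add: std_normal_density_def ennreal_mult'[symmetric] normal_density_nonneg)
  also have "\<dots> = ennreal (sqrt (2 * pi)) * (\<integral>\<^sup>+(x::real). std_normal_density x \<partial>lborel)"
    by (intro nn_integral_cmult) auto
  also have "(\<integral>\<^sup>+(x::real). std_normal_density x \<partial>lborel) = ennreal 1"
    by (subst nn_integral_eq_integral) (auto simp: normal_density_nonneg)
  finally show ?thesis by simp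
qed

lemma integrable_std_gaussian: "integrable lborel (\<lambda>x::'a::euclidean_space. exp (- (norm x)\<^sup>2 / 2))"
proof (rule integrableI_bounded)
  have eq: "exp (- (norm x)\<^sup>2 / 2) = (\<Prod>b\<in>Basis. exp (- (x \<bullet> b)\<^sup>2 / 2))" for x :: 'a
    by (simp add: norm_sq_euclidean exp_sum[symmetric] sum_negf sum_divide_distrib)
  have "(\<integral>\<^sup>+(x::'a). norm (exp (- (norm x)\<^sup>2 / 2)) \<partial>lborel) =
      (\<integral>\<^sup>+(x::'a). (\<Prod>b\<in>Basis. ennreal (exp (- (x \<bullet> b)\<^sup>2 / 2))) \<partial>lborel)"
    unfolding eq by (simp add: prod_ennreal prod_nonneg)
  also have "\<dots> = (\<Prod>b\<in>(Basis::'a set). ennreal (sqrt (2 * pi)))"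
    by (subst nn_integral_lborel_prod) (auto simp: std_gaussian_integral[simplified])
  also have "\<dots> < \<infinity>" by (simp add: ennreal_power)
  finally show "(\<integral>\<^sup>+(x::'a). norm (exp (- (norm x)\<^sup>2 / 2)) \<partial>lborel) < \<infinity>" .
qed auto

lemma fourier_std_gaussian_real:
  fixes t :: real
  shows "integrable lborel (\<lambda>x. iexp (t * x) * complex_of_real (exp (- x\<^sup>2 / 2)))" (is ?A)
    and "(\<integral>x. iexp (t * x) * complex_of_real (exp (- x\<^sup>2 / 2)) \<partial>lborel) =
      complex_of_real (sqrt (2 * pi) * exp (- t\<^sup>2 / 2))" (is ?B)
proof -
  show ?A
    by (rule Bochner_Integration.integrable_bound[OF integrable_std_gaussian[where 'a=real]])
       (auto simp: norm_mult)
  have "complex_of_real (exp (- t\<^sup>2 / 2)) = char std_normal_distribution t"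
    by (simp add: char_std_normal_distribution)
  also have "\<dots> = (\<integral>x. std_normal_density x *\<^sub>R iexp (t * x) \<partial>lborel)"
    by (simp add: char_def integral_density normal_density_nonneg)
  also have "\<dots> = (\<integral>x. complex_of_real (1 / sqrt (2 * pi)) * (iexp (t * x) * complex_of_real (exp (- x\<^sup>2 / 2))) \<partial>lborel)"
    by (intro Bochner_Integration.integral_cong) (auto simp: std_normal_density_def scaleR_conv_of_real)
  also have "\<dots> = complex_of_real (1 / sqrt (2 * pi)) * (\<integral>x. iexp (t * x) * complex_of_real (exp (- x\<^sup>2 / 2)) \<partial>lborel)"
    by (rule integral_mult_right_zero)
  finally show ?B
    by (simp add: field_simps)
qed

text \<open>
  Both the Gaussian and the character factor over the coordinates, and Lebesgue measure is a
  product measure, so the transform is the product of the one-dimensional characteristic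
  functions of the standard normal distribution. The complex exponential is used because, unlike
  the cosine, it is multiplicative; taking real parts at the end gives the cosine transform.
\<close>

lemma fourier_std_gaussian:
  fixes x :: "'a::euclidean_space"
  shows "(\<integral>\<xi>. cos (x \<bullet> \<xi>) * exp (- (norm \<xi>)\<^sup>2 / 2) \<partial>lborel) =
    sqrt (2 * pi) ^ DIM('a) * exp (- (norm x)\<^sup>2 / 2)"
proof -
  let ?F = "\<lambda>(b::'a) (\<xi>::real). iexp ((x \<bullet> b) * \<xi>) * complex_of_real (exp (- \<xi>\<^sup>2 / 2))"
  interpret P: product_sigma_finite "\<lambda>_::'a. lborel :: real measure" ..
  have prod: "(\<Prod>b\<in>Basis. ?F b (\<xi> \<bullet> b)) = iexp (x \<bullet> \<xi>) * complex_of_real (exp (- (norm \<xi>)\<^sup>2 / 2))" for \<xi> :: 'a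
  proof -
    have "(\<Prod>b\<in>Basis. ?F b (\<xi> \<bullet> b)) =
      exp (\<Sum>b\<in>Basis. \<i> * complex_of_real ((x \<bullet> b) * (\<xi> \<bullet> b))) * complex_of_real (exp (\<Sum>b\<in>Basis. - (\<xi> \<bullet> b)\<^sup>2 / 2))"
      by (simp add: prod.distrib exp_sum)
    also have "(\<Sum>b\<in>Basis. \<i> * complex_of_real ((x \<bullet> b) * (\<xi> \<bullet> b))) = \<i> * complex_of_real (x \<bullet> \<xi>)"
      by (subst euclidean_inner[of x \<xi>]) (simp add: sum_distrib_left)
    also have "(\<Sum>b\<in>Basis. - (\<xi> \<bullet> b)\<^sup>2 / 2) = - (norm \<xi>)\<^sup>2 / 2"
      by (simp add: norm_sq_euclidean sum_negf sum_divide_distrib)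
    finally show ?thesis .
  qed
  have "(\<integral>\<xi>. iexp (x \<bullet> \<xi>) * complex_of_real (exp (- (norm \<xi>)\<^sup>2 / 2)) \<partial>lborel) =
      (\<integral>\<xi>. (\<Prod>b\<in>Basis. ?F b (\<xi> \<bullet> b)) \<partial>(lborel :: 'a measure))"
    by (simp only: prod)
  also have "\<dots> = (\<integral>f. (\<Prod>b\<in>Basis. ?F b ((\<Sum>j\<in>Basis. f j *\<^sub>R j) \<bullet> b)) \<partial>(\<Pi>\<^sub>M b\<in>(Basis::'a set). lborel))"
    by (subst lborel_eq) (subst integral_distr, auto)
  also have "\<dots> = (\<integral>f. (\<Prod>b\<in>Basis. ?F b (f b)) \<partial>(\<Pi>\<^sub>M b\<in>(Basis::'a set). lborel))"
    by (intro Bochner_Integration.integral_cong refl prod.cong)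
       (simp_all add: inner_sum_left inner_Basis if_distrib sum.delta cong: if_cong)
  also have "\<dots> = (\<Prod>b\<in>(Basis::'a set). \<integral>\<xi>. ?F b \<xi> \<partial>lborel)"
    by (rule P.product_integral_prod[OF finite_Basis fourier_std_gaussian_real(1)])
  also have "\<dots> = (\<Prod>b\<in>(Basis::'a set). complex_of_real (sqrt (2 * pi) * exp (- (x \<bullet> b)\<^sup>2 / 2)))"
    by (simp only: fourier_std_gaussian_real(2))
  also have "\<dots> = complex_of_real (sqrt (2 * pi) ^ DIM('a) * exp (- (norm x)\<^sup>2 / 2))"
    by (simp only: of_real_prod[symmetric] prod.distrib exp_sum[symmetric] norm_sq_euclidean
        prod_constant finite_Basis) (simp add: sum_negf sum_divide_distrib)
  finally have *: "(\<integral>\<xi>. iexp (x \<bullet> \<xi>) * complex_of_real (exp (- (norm \<xi>)\<^sup>2 / 2)) \<partial>lborel) =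
      complex_of_real (sqrt (2 * pi) ^ DIM('a) * exp (- (norm x)\<^sup>2 / 2))" .
  have "integrable lborel (\<lambda>\<xi>. iexp (x \<bullet> \<xi>) * complex_of_real (exp (- (norm \<xi>)\<^sup>2 / 2)))"
    by (rule Bochner_Integration.integrable_bound[OF integrable_std_gaussian[where 'a='a]])
       (auto simp: norm_mult)
  from integral_Re[OF this] show ?thesis
    unfolding * by (simp add: Re_exp)
qed

lemma integrable_gaussian:
  assumes "0 < s"
  shows "integrable lborel (\<lambda>x::'a::euclidean_space. exp (- s * (norm x)\<^sup>2))"
  using integrable_lborel_affine[OF integrable_std_gaussian, of "sqrt (2 * s)" "0::'a"] assms
  by (simp add: power_mult_distrib)

lemma fourier_gaussian:
  fixes x :: "'a::euclidean_space"
  assumes s: "0 < s"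
  shows "(\<integral>\<xi>. cos (x \<bullet> \<xi>) * exp (- s * (norm \<xi>)\<^sup>2) \<partial>lborel) =
    sqrt (pi / s) ^ DIM('a) * exp (- (norm x)\<^sup>2 / (4 * s))"
proof -
  let ?c = "sqrt (2 * s)"
  have c: "0 < ?c" using s by simp
  have "sqrt (2 * pi) ^ DIM('a) * exp (- (norm (x /\<^sub>R ?c))\<^sup>2 / 2) =
      (\<integral>\<xi>. cos ((x /\<^sub>R ?c) \<bullet> \<xi>) * exp (- (norm \<xi>)\<^sup>2 / 2) \<partial>lborel)"
    by (rule fourier_std_gaussian[symmetric])
  also have "\<dots> = \<bar>?c\<bar> ^ DIM('a) * (\<integral>\<xi>. cos ((x /\<^sub>R ?c) \<bullet> (0 + ?c *\<^sub>R \<xi>)) * exp (- (norm (0 + ?c *\<^sub>R \<xi>))\<^sup>2 / 2) \<partial>lborel)"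
    using c by (intro integral_lborel_affine) auto
  also have "\<dots> = ?c ^ DIM('a) * (\<integral>\<xi>. cos (x \<bullet> \<xi>) * exp (- s * (norm \<xi>)\<^sup>2) \<partial>lborel)"
  proof -
    have cancel: "?c * (inverse ?c * r) = r" for r using c by simp
    show ?thesis
      using s by (simp add: cancel power_mult_distrib del: real_sqrt_mult)
  qed
  finally have "(\<integral>\<xi>. cos (x \<bullet> \<xi>) * exp (- s * (norm \<xi>)\<^sup>2) \<partial>lborel) =
      (sqrt (2 * pi) / ?c) ^ DIM('a) * exp (- (norm (x /\<^sub>R ?c))\<^sup>2 / 2)"
    using c by (simp add: power_divide field_simps)
  also have "sqrt (2 * pi) / ?c = sqrt (pi / s)"
    using s by (simp add: real_sqrt_divide[symmetric])
  also have "- (norm (x /\<^sub>R ?c))\<^sup>2 / 2 = - (norm x)\<^sup>2 / (4 * s)"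
    using s by (simp add: power_mult_distrib power_inverse field_simps)
  finally show ?thesis .
qed

section \<open>Radially decreasing Fourier transforms\<close>

definition nonneg_radial_decr :: "('a::euclidean_space \<Rightarrow> real) \<Rightarrow> bool" where
  "nonneg_radial_decr f \<longleftrightarrow> (\<forall>x. 0 \<le> f x) \<and> (\<forall>x y. norm x \<le> norm y \<longrightarrow> f y \<le> f x)"

definition fourier_cos :: "('a::euclidean_space \<Rightarrow> real) \<Rightarrow> 'a \<Rightarrow> real" where
  "fourier_cos f x = (\<integral>\<xi>. cos (x \<bullet> \<xi>) * f \<xi> \<partial>lborel)"

text \<open>
  The Gaussian factor makes every bounded \<open>F\<close> integrable, so that the class of functions with
  this property is closed under bounded pointwise limits, by dominated convergence. Approximants
  of \<open>exp (- t |\<xi>|\<^sup>\<theta>)\<close> that do not decay at infinity can therefore be used.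
\<close>

definition damped_radial :: "('a::euclidean_space \<Rightarrow> real) \<Rightarrow> bool" where
  "damped_radial F \<longleftrightarrow> F \<in> borel_measurable borel \<and>
     (\<forall>\<delta>>0. nonneg_radial_decr (fourier_cos (\<lambda>\<xi>. F \<xi> * exp (- \<delta> * (norm \<xi>)\<^sup>2))))"

lemma integrable_cos_mult:
  fixes f :: "'a::euclidean_space \<Rightarrow> real"
  assumes "integrable lborel f"
  shows "integrable lborel (\<lambda>\<xi>. cos (x \<bullet> \<xi>) * f \<xi>)"
proof (rule Bochner_Integration.integrable_bound[OF assms])
  have [measurable]: "f \<in> borel_measurable borel" using assms by auto
  show "(\<lambda>\<xi>. cos (x \<bullet> \<xi>) * f \<xi>) \<in> borel_measurable lborel" by simp
  show "AE \<xi> in lborel. norm (cos (x \<bullet> \<xi>) * f \<xi>) \<le> norm (f \<xi>)"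
    by (auto simp: abs_mult intro!: mult_left_le_one_le)
qed

lemma nonneg_radial_decr_LIMSEQ:
  assumes "\<And>n. nonneg_radial_decr (f n)" and "\<And>x. (\<lambda>n. f n x) \<longlonglongrightarrow> g x"
  shows "nonneg_radial_decr g"
  unfolding nonneg_radial_decr_def
proof (intro conjI allI impI)
  show "0 \<le> g x" for x
    using assms(1) by (intro LIMSEQ_le_const[OF assms(2)]) (auto simp: nonneg_radial_decr_def)
  show "g y \<le> g x" if "norm x \<le> norm y" for x y
    using assms(1) that by (intro LIMSEQ_le[OF assms(2) assms(2)]) (auto simp: nonneg_radial_decr_def)
qed

lemma fourier_cos_LIMSEQ:
  fixes f :: "nat \<Rightarrow> 'a::euclidean_space \<Rightarrow> real"
  assumes [measurable]: "\<And>n. f n \<in> borel_measurable borel" "g \<in> borel_measurable borel"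
    and int: "integrable lborel w"
    and bnd: "\<And>n. AE \<xi> in lborel. \<bar>f n \<xi>\<bar> \<le> w \<xi>"
    and lim: "AE \<xi> in lborel. (\<lambda>n. f n \<xi>) \<longlonglongrightarrow> g \<xi>"
  shows "(\<lambda>n. fourier_cos (f n) x) \<longlonglongrightarrow> fourier_cos g x"
  unfolding fourier_cos_def
proof (rule integral_dominated_convergence[OF _ _ int])
  show "AE \<xi> in lborel. (\<lambda>n. cos (x \<bullet> \<xi>) * f n \<xi>) \<longlonglongrightarrow> cos (x \<bullet> \<xi>) * g \<xi>"
    using lim by eventually_elim (intro tendsto_intros)
  show "AE \<xi> in lborel. norm (cos (x \<bullet> \<xi>) * f n \<xi>) \<le> w \<xi>" for n
    using bnd[of n]
  proof eventually_elim
    case (elim \<xi>)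
    have "\<bar>cos (x \<bullet> \<xi>)\<bar> * \<bar>f n \<xi>\<bar> \<le> 1 * \<bar>f n \<xi>\<bar>" by (intro mult_right_mono) auto
    with elim show ?case by (simp add: abs_mult)
  qed
qed auto

lemma AE_lborel_nonzero: "AE \<xi>::'a::euclidean_space in lborel. \<xi> \<noteq> 0"
  by (rule AE_lborel_singleton)

lemma damped_radial_LIMSEQ:
  fixes F :: "nat \<Rightarrow> 'a::euclidean_space \<Rightarrow> real"
  assumes F: "\<And>n. damped_radial (F n)" and [measurable]: "G \<in> borel_measurable borel"
    and bnd: "\<And>n \<xi>. \<xi> \<noteq> 0 \<Longrightarrow> \<bar>F n \<xi>\<bar> \<le> B"
    and lim: "\<And>\<xi>. \<xi> \<noteq> 0 \<Longrightarrow> (\<lambda>n. F n \<xi>) \<longlonglongrightarrow> G \<xi>"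
  shows "damped_radial G"
  unfolding damped_radial_def
proof (intro conjI allI impI)
  fix \<delta> :: real assume \<delta>: "0 < \<delta>"
  have [measurable]: "F n \<in> borel_measurable borel" for n using F by (simp add: damped_radial_def)
  show "nonneg_radial_decr (fourier_cos (\<lambda>\<xi>. G \<xi> * exp (- \<delta> * (norm \<xi>)\<^sup>2)))"
  proof (rule nonneg_radial_decr_LIMSEQ)
    show "nonneg_radial_decr (fourier_cos (\<lambda>\<xi>. F n \<xi> * exp (- \<delta> * (norm \<xi>)\<^sup>2)))" for n
      using F \<delta> by (simp add: damped_radial_def)
    show "(\<lambda>n. fourier_cos (\<lambda>\<xi>. F n \<xi> * exp (- \<delta> * (norm \<xi>)\<^sup>2)) x) \<longlonglongrightarrow>
        fourier_cos (\<lambda>\<xi>. G \<xi> * exp (- \<delta> * (norm \<xi>)\<^sup>2)) x" for x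
    proof (rule fourier_cos_LIMSEQ)
      show "integrable lborel (\<lambda>\<xi>::'a. B * exp (- \<delta> * (norm \<xi>)\<^sup>2))"
        using integrable_gaussian[OF \<delta>] by (rule integrable_mult_right)
      show "AE \<xi> in lborel. \<bar>F n \<xi> * exp (- \<delta> * (norm \<xi>)\<^sup>2)\<bar> \<le> B * exp (- \<delta> * (norm \<xi>)\<^sup>2)" for n
        using AE_lborel_nonzero by eventually_elim (simp add: abs_mult bnd)
      show "AE \<xi> in lborel. (\<lambda>n. F n \<xi> * exp (- \<delta> * (norm \<xi>)\<^sup>2)) \<longlonglongrightarrow> G \<xi> * exp (- \<delta> * (norm \<xi>)\<^sup>2)"
        using AE_lborel_nonzero by eventually_elim (intro tendsto_intros lim)
    qed auto
  qed
qed fact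

text \<open>
  For integrable \<open>F\<close> the damping can be removed: let \<open>\<delta>\<close> tend to \<open>0\<close>, with \<open>|F|\<close> as the
  dominating function.
\<close>

lemma damped_radial_imp_nonneg_radial_decr:
  fixes F :: "'a::euclidean_space \<Rightarrow> real"
  assumes F: "damped_radial F" and int: "integrable lborel F"
  shows "nonneg_radial_decr (fourier_cos F)"
proof (rule nonneg_radial_decr_LIMSEQ)
  have [measurable]: "F \<in> borel_measurable borel" using F by (simp add: damped_radial_def)
  show "nonneg_radial_decr (fourier_cos (\<lambda>\<xi>. F \<xi> * exp (- inverse (real (Suc n)) * (norm \<xi>)\<^sup>2)))" for n
    using F by (simp add: damped_radial_def)
  show "(\<lambda>n. fourier_cos (\<lambda>\<xi>. F \<xi> * exp (- inverse (real (Suc n)) * (norm \<xi>)\<^sup>2)) x) \<longlonglongrightarrow> fourier_cos F x" for x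
  proof (rule fourier_cos_LIMSEQ)
    show "integrable lborel (\<lambda>\<xi>. \<bar>F \<xi>\<bar>)" using int by simp
    show "AE \<xi> in lborel. \<bar>F \<xi> * exp (- inverse (real (Suc n)) * (norm \<xi>)\<^sup>2)\<bar> \<le> \<bar>F \<xi>\<bar>" for n
      by (auto simp: abs_mult intro!: mult_right_le_one_le)
    show "AE \<xi> in lborel. (\<lambda>n. F \<xi> * exp (- inverse (real (Suc n)) * (norm \<xi>)\<^sup>2)) \<longlonglongrightarrow> F \<xi>"
    proof (rule AE_I2)
      fix \<xi> :: 'a
      have "(\<lambda>n. F \<xi> * exp (- inverse (real (Suc n)) * (norm \<xi>)\<^sup>2)) \<longlonglongrightarrow> F \<xi> * exp (- 0 * (norm \<xi>)\<^sup>2)"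
        by (intro tendsto_intros LIMSEQ_inverse_real_of_nat)
      then show "(\<lambda>n. F \<xi> * exp (- inverse (real (Suc n)) * (norm \<xi>)\<^sup>2)) \<longlonglongrightarrow> F \<xi>" by simp
    qed
  qed auto
qed

text \<open>
  Evaluated at \<open>l = |\<xi>|\<^sup>2\<close>, the members are the positive combinations of Gaussians of arbitrary
  width, including the infinite width \<open>s = 0\<close>. The point of the cone is that it is closed under
  products, which the class of functions with a nonnegative transform is only by a convolution
  argument.
\<close>

inductive_set exp_cone :: "(real \<Rightarrow> real) set" where
  exp: "0 \<le> a \<Longrightarrow> 0 \<le> s \<Longrightarrow> (\<lambda>l. a * exp (- s * l)) \<in> exp_cone"
| add: "f \<in> exp_cone \<Longrightarrow> g \<in> exp_cone \<Longrightarrow> (\<lambda>l. f l + g l) \<in> exp_cone"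

lemma exp_cone_const: "0 \<le> a \<Longrightarrow> (\<lambda>_. a) \<in> exp_cone"
  using exp_cone.exp[of a 0] by simp

lemma exp_cone_mult_exp: "f \<in> exp_cone \<Longrightarrow> 0 \<le> a \<Longrightarrow> 0 \<le> s \<Longrightarrow> (\<lambda>l. a * exp (- s * l) * f l) \<in> exp_cone"
proof (induction rule: exp_cone.induct)
  case (exp b r)
  then have "(\<lambda>l. (a * b) * exp (- (s + r) * l)) \<in> exp_cone" by (intro exp_cone.exp) auto
  also have "(\<lambda>l. (a * b) * exp (- (s + r) * l)) = (\<lambda>l. a * exp (- s * l) * (b * exp (- r * l)))"
    by (auto simp: exp_add[symmetric] algebra_simps)
  finally show ?case .
next
  case (add f g)
  then show ?case by (simp add: distrib_left exp_cone.add)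
qed

lemma exp_cone_mult: "f \<in> exp_cone \<Longrightarrow> g \<in> exp_cone \<Longrightarrow> (\<lambda>l. f l * g l) \<in> exp_cone"
  by (induction rule: exp_cone.induct) (auto simp: distrib_right exp_cone.add intro: exp_cone_mult_exp[unfolded mult_minus_left])

lemma exp_cone_power: "f \<in> exp_cone \<Longrightarrow> (\<lambda>l. f l ^ n) \<in> exp_cone"
  by (induction n) (auto intro: exp_cone_const exp_cone_mult)

lemma exp_cone_sum: "finite I \<Longrightarrow> (\<And>i. i \<in> I \<Longrightarrow> f i \<in> exp_cone) \<Longrightarrow> (\<lambda>l. \<Sum>i\<in>I. f i l) \<in> exp_cone"
  by (induction I rule: finite_induct) (auto intro: exp_cone_const exp_cone.add)

text \<open>
  The transform of each damped Gaussian is again a Gaussian, which is positive and radially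
  decreasing, and both properties survive positive combinations.
\<close>

lemma exp_cone_damped_radial:
  assumes "f \<in> exp_cone"
  shows "damped_radial (\<lambda>\<xi>::'a::euclidean_space. f ((norm \<xi>)\<^sup>2))"
proof -
  have "(\<lambda>\<xi>::'a. f ((norm \<xi>)\<^sup>2)) \<in> borel_measurable borel \<and>
     (\<forall>\<delta>>0. integrable lborel (\<lambda>\<xi>::'a. f ((norm \<xi>)\<^sup>2) * exp (- \<delta> * (norm \<xi>)\<^sup>2)) \<and>
       nonneg_radial_decr (fourier_cos (\<lambda>\<xi>::'a. f ((norm \<xi>)\<^sup>2) * exp (- \<delta> * (norm \<xi>)\<^sup>2))))"
    using assms
  proof (induction rule: exp_cone.induct)
    case (exp a s)
    show ?case
    proof (intro conjI allI impI)
      fix \<delta> :: real assume "0 < \<delta>"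
      then have sd: "0 < s + \<delta>" using exp by simp
      have eq: "a * exp (- s * (norm \<xi>)\<^sup>2) * exp (- \<delta> * (norm \<xi>)\<^sup>2) = a * exp (- (s + \<delta>) * (norm \<xi>)\<^sup>2)" for \<xi> :: 'a
        by (auto simp: exp_add[symmetric] algebra_simps)
      show "integrable lborel (\<lambda>\<xi>::'a. a * exp (- s * (norm \<xi>)\<^sup>2) * exp (- \<delta> * (norm \<xi>)\<^sup>2))"
        unfolding eq using integrable_gaussian[OF sd] by (rule integrable_mult_right)
      have "fourier_cos (\<lambda>\<xi>::'a. a * exp (- (s + \<delta>) * (norm \<xi>)\<^sup>2)) =
          (\<lambda>x. a * (sqrt (pi / (s + \<delta>)) ^ DIM('a) * exp (- (norm x)\<^sup>2 / (4 * (s + \<delta>)))))"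
        unfolding fourier_cos_def fourier_gaussian[OF sd, symmetric]
        by (subst integral_mult_right_zero[symmetric]) (simp add: mult_ac)
      then show "nonneg_radial_decr (fourier_cos (\<lambda>\<xi>::'a. a * exp (- s * (norm \<xi>)\<^sup>2) * exp (- \<delta> * (norm \<xi>)\<^sup>2)))"
        unfolding eq using exp sd
        by (auto simp: nonneg_radial_decr_def intro!: mult_left_mono divide_right_mono power_mono)
    qed auto
  next
    case (add f g)
    show ?case
    proof (intro conjI allI impI)
      fix \<delta> :: real assume "0 < \<delta>"
      with add have f: "integrable lborel (\<lambda>\<xi>::'a. f ((norm \<xi>)\<^sup>2) * exp (- \<delta> * (norm \<xi>)\<^sup>2))"
          "nonneg_radial_decr (fourier_cos (\<lambda>\<xi>::'a. f ((norm \<xi>)\<^sup>2) * exp (- \<delta> * (norm \<xi>)\<^sup>2)))"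
        and g: "integrable lborel (\<lambda>\<xi>::'a. g ((norm \<xi>)\<^sup>2) * exp (- \<delta> * (norm \<xi>)\<^sup>2))"
          "nonneg_radial_decr (fourier_cos (\<lambda>\<xi>::'a. g ((norm \<xi>)\<^sup>2) * exp (- \<delta> * (norm \<xi>)\<^sup>2)))"
        by blast+
      show "integrable lborel (\<lambda>\<xi>::'a. (f ((norm \<xi>)\<^sup>2) + g ((norm \<xi>)\<^sup>2)) * exp (- \<delta> * (norm \<xi>)\<^sup>2))"
        unfolding distrib_right using f(1) g(1) by (rule Bochner_Integration.integrable_add)
      have "fourier_cos (\<lambda>\<xi>::'a. (f ((norm \<xi>)\<^sup>2) + g ((norm \<xi>)\<^sup>2)) * exp (- \<delta> * (norm \<xi>)\<^sup>2)) =
        (\<lambda>x. fourier_cos (\<lambda>\<xi>. f ((norm \<xi>)\<^sup>2) * exp (- \<delta> * (norm \<xi>)\<^sup>2)) x +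
             fourier_cos (\<lambda>\<xi>. g ((norm \<xi>)\<^sup>2) * exp (- \<delta> * (norm \<xi>)\<^sup>2)) x)"
        unfolding fourier_cos_def distrib_right distrib_left
        using integrable_cos_mult[OF f(1)] integrable_cos_mult[OF g(1)]
        by (intro ext Bochner_Integration.integral_add)
      then show "nonneg_radial_decr (fourier_cos (\<lambda>\<xi>::'a. (f ((norm \<xi>)\<^sup>2) + g ((norm \<xi>)\<^sup>2)) * exp (- \<delta> * (norm \<xi>)\<^sup>2)))"
        using f(2) g(2) by (auto simp: nonneg_radial_decr_def intro!: add_mono)
    qed (use add in auto)
  qed
  then show ?thesis by (simp add: damped_radial_def)
qed

text \<open>
  For \<open>0 < a \<le> 1\<close> the first coefficient is \<open>- a\<close>, and passing from one to the next multiplies by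
  \<open>(n - a) / (n + 1) \<ge> 0\<close> for \<open>n \<ge> 1\<close>. This is where the restriction \<open>\<theta> \<le> 2\<close> enters, with
  \<open>a = \<theta> / 2\<close>.
\<close>

lemma gbinomial_alternating_nonpos:
  fixes a :: real
  assumes "0 < a" "a \<le> 1"
  shows "(a gchoose Suc n) * (- 1) ^ Suc n \<le> 0"
proof (induction n)
  case 0
  then show ?case using assms by simp
next
  case (Suc n)
  have "(a gchoose Suc (Suc n)) = (a gchoose Suc n) * (a - real (Suc n)) / real (Suc (Suc n))"
    using gbinomial_absorption[of "Suc n" a] gbinomial_mult_1[of a "Suc n"]
    by (simp add: field_simps)
  from arg_cong[OF this, of "\<lambda>g. g * (- 1) ^ Suc (Suc n)"]
  have "(a gchoose Suc (Suc n)) * (- 1) ^ Suc (Suc n) =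
      ((a gchoose Suc n) * (- 1) ^ Suc n) * ((real (Suc n) - a) / real (Suc (Suc n)))"
    by (rule trans) (simp add: field_simps)
  also have "\<dots> \<le> 0"
    using assms by (intro mult_nonpos_nonneg[OF Suc]) auto
  finally show ?case .
qed

text \<open>
  The binomial series says that \<open>1 - (1 - x) powr a\<close> is a power series in \<open>x\<close> with nonnegative
  coefficients, and its value at most \<open>1\<close> bounds all partial sums.
\<close>

lemma one_minus_powr_series:
  fixes a x :: real
  assumes a: "0 < a" "a \<le> 1" and x: "0 \<le> x" "x < 1"
  defines "c n \<equiv> - ((a gchoose Suc n) * (- 1) ^ Suc n)"
  shows "(\<lambda>n. c n * x ^ Suc n) sums (1 - (1 - x) powr a)"
    and "(\<Sum>n<K. c n * x ^ Suc n) \<le> 1" and "0 \<le> c n"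
proof -
  have "(\<lambda>n. (a gchoose n) * (- x) ^ n) sums (1 + - x) powr a"
    by (rule gen_binomial_real) (use x in auto)
  then have "(\<lambda>n. (a gchoose Suc n) * (- x) ^ Suc n) sums ((1 - x) powr a - 1)"
    by (subst sums_Suc_iff) simp
  then have "(\<lambda>n. - ((a gchoose Suc n) * (- x) ^ Suc n)) sums - ((1 - x) powr a - 1)"
    by (rule sums_minus)
  moreover have "- ((a gchoose Suc n) * (- x) ^ Suc n) = c n * x ^ Suc n" for n
    unfolding c_def by (subst power_minus[of x]) simp
  ultimately have "(\<lambda>n. c n * x ^ Suc n) sums - ((1 - x) powr a - 1)" by (simp only:)
  then show s: "(\<lambda>n. c n * x ^ Suc n) sums (1 - (1 - x) powr a)" by (simp del: power_Suc)
  show c: "0 \<le> c n" for n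
    using gbinomial_alternating_nonpos[OF a, of n] by (simp add: c_def)
  have "(\<Sum>n<K. c n * x ^ Suc n) \<le> (\<Sum>n. c n * x ^ Suc n)"
    using s c x by (intro sum_le_suminf) (auto simp: sums_iff simp del: power_Suc)
  also have "\<dots> \<le> 1" using s by (simp add: sums_iff)
  finally show "(\<Sum>n<K. c n * x ^ Suc n) \<le> 1" .
qed

text \<open>
  Write \<open>x = exp (- s |\<xi>|\<^sup>2)\<close>. Since \<open>- \<tau> (1 - x) powr a = - \<tau> + \<tau> (1 - (1 - x) powr a)\<close>, the
  function is \<open>exp (- \<tau>)\<close> times the exponential of a power series in \<open>x\<close> with nonnegative
  coefficients. Truncating first the exponential series and then the inner power series gives
  members of \<open>exp_cone\<close>, all bounded by \<open>1\<close>.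
\<close>

lemma damped_radial_exp_one_minus:
  fixes a s \<tau> :: real
  assumes a: "0 < a" "a \<le> 1" and s: "0 < s" and \<tau>: "0 \<le> \<tau>"
  shows "damped_radial (\<lambda>\<xi>::'a::euclidean_space. exp (- \<tau> * (1 - exp (- s * (norm \<xi>)\<^sup>2)) powr a))"
proof -
  define c where "c n = - ((a gchoose Suc n) * (- 1) ^ Suc n)" for n
  define P where "P K l = (\<Sum>n<K. c n * exp (- s * l) ^ Suc n)" for K :: nat and l :: real
  have x: "0 \<le> exp (- s * (norm \<xi>)\<^sup>2)" "exp (- s * (norm \<xi>)\<^sup>2) < 1" if "\<xi> \<noteq> 0" for \<xi> :: 'a
    using s that by auto
  have c: "0 \<le> c n" for n
    using one_minus_powr_series(3)[OF a, of 0] by (simp add: c_def)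
  have P: "P K \<in> exp_cone" for K
    unfolding P_def
  proof (rule exp_cone_sum)
    fix n
    have "(\<lambda>l. c n * exp (- (real (Suc n) * s) * l)) \<in> exp_cone"
      using c s by (intro exp_cone.exp) auto
    then show "(\<lambda>l. c n * exp (- s * l) ^ Suc n) \<in> exp_cone"
      by (simp add: exp_of_nat_mult[symmetric] mult_ac del: power_Suc of_nat_Suc)
  qed auto
  have P_nn: "0 \<le> P K l" for K l
    unfolding P_def using c by (intro sum_nonneg mult_nonneg_nonneg) auto
  have P_le: "P K ((norm \<xi>)\<^sup>2) \<le> 1" if "\<xi> \<noteq> 0" for \<xi> :: 'a and K
    unfolding P_def c_def by (rule one_minus_powr_series(2)[OF a x[OF that]])
  have P_lim: "(\<lambda>K. P K ((norm \<xi>)\<^sup>2)) \<longlonglongrightarrow> 1 - (1 - exp (- s * (norm \<xi>)\<^sup>2)) powr a" if "\<xi> \<noteq> 0" for \<xi> :: 'a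
    using one_minus_powr_series(1)[OF a x[OF that]] unfolding P_def c_def sums_def .
  have expP: "damped_radial (\<lambda>\<xi>::'a. exp (- \<tau>) * exp (\<tau> * P K ((norm \<xi>)\<^sup>2)))" for K
  proof (rule damped_radial_LIMSEQ)
    show "damped_radial (\<lambda>\<xi>::'a. \<Sum>m<M. (exp (- \<tau>) * \<tau> ^ m / fact m) * P K ((norm \<xi>)\<^sup>2) ^ m)" for M
      using \<tau> by (intro exp_cone_damped_radial[of "\<lambda>l. \<Sum>m<M. (exp (- \<tau>) * \<tau> ^ m / fact m) * P K l ^ m"]
          exp_cone_sum exp_cone_mult exp_cone_const exp_cone_power P) auto
    show "(\<lambda>\<xi>::'a. exp (- \<tau>) * exp (\<tau> * P K ((norm \<xi>)\<^sup>2))) \<in> borel_measurable borel"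
      unfolding P_def by measurable
    fix \<xi> :: 'a assume \<xi>: "\<xi> \<noteq> 0"
    let ?y = "\<tau> * P K ((norm \<xi>)\<^sup>2)"
    have eq: "(\<Sum>m<M. (exp (- \<tau>) * \<tau> ^ m / fact m) * P K ((norm \<xi>)\<^sup>2) ^ m) =
        exp (- \<tau>) * (\<Sum>m<M. ?y ^ m /\<^sub>R fact m)" for M
      by (simp add: sum_distrib_left power_mult_distrib field_simps)
    have sums: "(\<lambda>m. ?y ^ m /\<^sub>R fact m) sums exp ?y" by (rule exp_converges)
    then show "(\<lambda>M. \<Sum>m<M. (exp (- \<tau>) * \<tau> ^ m / fact m) * P K ((norm \<xi>)\<^sup>2) ^ m) \<longlonglongrightarrow> exp (- \<tau>) * exp ?y"
      unfolding eq sums_def by (intro tendsto_intros)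
    fix M
    have y: "0 \<le> ?y" using \<tau> P_nn by simp
    have nn: "0 \<le> (\<Sum>m<M. ?y ^ m /\<^sub>R fact m)" using y by (intro sum_nonneg) auto
    have "(\<Sum>m<M. ?y ^ m /\<^sub>R fact m) \<le> (\<Sum>m. ?y ^ m /\<^sub>R fact m)"
      using sums y by (intro sum_le_suminf) (auto simp: sums_iff)
    also have "\<dots> = exp ?y" using sums by (simp add: sums_iff)
    also have "\<dots> \<le> exp \<tau>" using P_le[OF \<xi>, of K] \<tau> by (simp add: mult_left_le)
    finally have "exp (- \<tau>) * (\<Sum>m<M. ?y ^ m /\<^sub>R fact m) \<le> exp (- \<tau>) * exp \<tau>"
      by (intro mult_left_mono) auto
    then show "\<bar>\<Sum>m<M. (exp (- \<tau>) * \<tau> ^ m / fact m) * P K ((norm \<xi>)\<^sup>2) ^ m\<bar> \<le> 1"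
      unfolding eq using nn by (simp add: exp_minus)
  qed
  show ?thesis
  proof (rule damped_radial_LIMSEQ[OF expP])
    show "(\<lambda>\<xi>::'a. exp (- \<tau> * (1 - exp (- s * (norm \<xi>)\<^sup>2)) powr a)) \<in> borel_measurable borel"
      by measurable
    fix \<xi> :: 'a assume \<xi>: "\<xi> \<noteq> 0"
    show "\<bar>exp (- \<tau>) * exp (\<tau> * P K ((norm \<xi>)\<^sup>2))\<bar> \<le> 1" for K
      using P_le[OF \<xi>, of K] \<tau> by (simp add: exp_add[symmetric] mult_left_le)
    have "(\<lambda>K. exp (- \<tau>) * exp (\<tau> * P K ((norm \<xi>)\<^sup>2))) \<longlonglongrightarrow>
        exp (- \<tau>) * exp (\<tau> * (1 - (1 - exp (- s * (norm \<xi>)\<^sup>2)) powr a))"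
      by (intro tendsto_intros P_lim \<xi>)
    then show "(\<lambda>K. exp (- \<tau>) * exp (\<tau> * P K ((norm \<xi>)\<^sup>2))) \<longlonglongrightarrow>
        exp (- \<tau> * (1 - exp (- s * (norm \<xi>)\<^sup>2)) powr a)"
      by (simp add: exp_add[symmetric] algebra_simps)
  qed
qed

lemma difference_quotient_exp_LIMSEQ:
  fixes l :: real
  shows "(\<lambda>n. real (Suc n) * (1 - exp (- inverse (real (Suc n)) * l))) \<longlonglongrightarrow> l"
proof -
  have "((\<lambda>h. exp (- h * l)) has_real_derivative - l) (at 0)"
    by (auto intro!: derivative_eq_intros)
  then have "(\<lambda>h. (exp (- (0 + h) * l) - exp (- 0 * l)) / h) \<midarrow>0\<rightarrow> - l"
    unfolding DERIV_def .
  then have "(\<lambda>n. (exp (- (0 + inverse (real (Suc n))) * l) - exp (- 0 * l)) / inverse (real (Suc n))) \<longlonglongrightarrow> - l"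
    by (rule filterlim_compose) (auto simp: filterlim_at simp del: of_nat_Suc intro!: LIMSEQ_inverse_real_of_nat)
  from tendsto_minus[OF this] show ?thesis
    by (simp add: divide_inverse algebra_simps del: of_nat_Suc)
qed

text \<open>
  Choose \<open>a = \<theta> / 2\<close>, \<open>s = 1 / n\<close> and \<open>\<tau> = t n powr a\<close> in the previous approximation. Because
  \<open>n (1 - exp (- l / n))\<close> tends to \<open>l\<close>, the exponent tends to \<open>- t (|\<xi>|\<^sup>2) powr a\<close>, which is
  \<open>- t |\<xi>|\<^sup>\<theta>\<close>. This is a discrete form of subordination: the stable symbol is a mixture of
  Gaussians.
\<close>

lemma damped_radial_stable:
  fixes \<theta> t :: real
  assumes \<theta>: "0 < \<theta>" "\<theta> \<le> 2" and t: "0 < t"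
  shows "damped_radial (\<lambda>\<xi>::'a::euclidean_space. exp (- t * norm \<xi> powr \<theta>))"
proof -
  define a where "a = \<theta> / 2"
  have a: "0 < a" "a \<le> 1" using \<theta> by (auto simp: a_def)
  let ?e = "\<lambda>n \<xi>. 1 - exp (- inverse (real (Suc n)) * (norm (\<xi>::'a))\<^sup>2)"
  show ?thesis
  proof (rule damped_radial_LIMSEQ)
    show "damped_radial (\<lambda>\<xi>. exp (- (t * real (Suc n) powr a) * ?e n \<xi> powr a))" for n
      using t by (intro damped_radial_exp_one_minus a) auto
    fix \<xi> :: 'a assume \<xi>: "\<xi> \<noteq> 0"
    show "\<bar>exp (- (t * real (Suc n) powr a) * ?e n \<xi> powr a)\<bar> \<le> 1" for n
      using t by simp
    have eq: "- (t * real (Suc n) powr a) * ?e n \<xi> powr a = - t * (real (Suc n) * ?e n \<xi>) powr a" for n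
      by (subst powr_mult) auto
    have "(\<lambda>n. (real (Suc n) * ?e n \<xi>) powr a) \<longlonglongrightarrow> ((norm \<xi>)\<^sup>2) powr a"
      using \<xi> by (intro tendsto_powr difference_quotient_exp_LIMSEQ tendsto_const) auto
    also have "((norm \<xi>)\<^sup>2) powr a = norm \<xi> powr \<theta>"
      using \<xi> by (simp add: a_def powr_powr flip: powr_numeral)
    finally show "(\<lambda>n. exp (- (t * real (Suc n) powr a) * ?e n \<xi> powr a)) \<longlonglongrightarrow> exp (- t * norm \<xi> powr \<theta>)"
      unfolding eq by (intro tendsto_exp tendsto_mult tendsto_const)
  qed measurable
qed

section \<open>Integrability from a covering by balls\<close>

lemma emeasure_ball_eq_unit_ball:
  assumes "0 < r"
  shows "emeasure lborel (ball (a::'a::euclidean_space) r) =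
    ennreal (r ^ DIM('a)) * emeasure lborel (ball (0::'a) 1)"
proof -
  have "emeasure lborel (ball a r) = ennreal (measure lborel (ball a r))" for a :: 'a and r
    using emeasure_lborel_ball_finite[of a r] by (intro emeasure_eq_ennreal_measure) auto
  then show ?thesis
    using content_ball_conv_unit_ball[of r a] assms by (simp add: ennreal_mult)
qed

lemma le_suminf_ennreal: "f n \<le> (\<Sum>n. f n :: ennreal)"
  using sum_le_suminf[of f "{n}"] by simp

text \<open>
  A discrete layer-cake principle, used for the integrability of \<open>exp (- t |\<xi>|\<^sup>\<theta>)\<close> at infinity and
  of \<open>|x| powr (- b)\<close> at the origin.
\<close>

lemma nn_integral_finite_if_ball_sum:
  fixes f :: "'a::euclidean_space \<Rightarrow> ennreal"
  assumes f: "\<And>x. x \<noteq> 0 \<Longrightarrow> f x \<le> (\<Sum>n. ennreal (a n) * indicator (ball 0 (R n)) x)"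
    and a: "\<And>n. 0 \<le> a n" and R: "\<And>n. 0 < R n"
    and sum: "summable (\<lambda>n. a n * R n ^ DIM('a))"
  shows "(\<integral>\<^sup>+x. f x \<partial>lborel) < \<infinity>"
proof -
  let ?V = "emeasure lborel (ball (0::'a) 1)"
  have "AE x in lborel. f x \<le> (\<Sum>n. ennreal (a n) * indicator (ball 0 (R n)) x)"
    using AE_lborel_nonzero by eventually_elim (rule f)
  then have "(\<integral>\<^sup>+x. f x \<partial>lborel) \<le> (\<integral>\<^sup>+x. (\<Sum>n. ennreal (a n) * indicator (ball (0::'a) (R n)) x) \<partial>lborel)"
    by (rule nn_integral_mono_AE)
  also have "\<dots> = (\<Sum>n. \<integral>\<^sup>+x. ennreal (a n) * indicator (ball (0::'a) (R n)) x \<partial>lborel)"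
    by (rule nn_integral_suminf) (auto intro!: borel_measurable_times_ennreal borel_measurable_indicator)
  also have "\<dots> = (\<Sum>n. ennreal (a n * R n ^ DIM('a)) * ?V)"
  proof (rule suminf_cong)
    fix n
    have "(\<integral>\<^sup>+x. ennreal (a n) * indicator (ball (0::'a) (R n)) x \<partial>lborel) =
        ennreal (a n) * emeasure lborel (ball (0::'a) (R n))"
      by (rule nn_integral_cmult_indicator) simp
    also have "\<dots> = ennreal (a n) * (ennreal (R n ^ DIM('a)) * ?V)"
      by (subst emeasure_ball_eq_unit_ball[OF R]) (rule refl)
    also have "\<dots> = ennreal (a n * R n ^ DIM('a)) * ?V"
      using a[of n] R[of n] by (subst ennreal_mult) (auto simp: mult.assoc)
    finally show "(\<integral>\<^sup>+x. ennreal (a n) * indicator (ball (0::'a) (R n)) x \<partial>lborel) =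
        ennreal (a n * R n ^ DIM('a)) * ?V" .
  qed
  also have "\<dots> = (\<Sum>n. ennreal (a n * R n ^ DIM('a))) * ?V"
    by (rule ennreal_suminf_multc)
  also have "(\<Sum>n. ennreal (a n * R n ^ DIM('a))) = ennreal (\<Sum>n. a n * R n ^ DIM('a))"
    using a R sum by (intro suminf_ennreal2) (auto simp: less_imp_le)
  also have "\<dots> * ?V < \<infinity>"
    using emeasure_lborel_ball_finite[of "0::'a" 1] by (simp add: ennreal_mult_less_top)
  finally show ?thesis .
qed

lemma power_le_fact_mult_exp:
  fixes y :: real
  assumes "0 \<le> y"
  shows "y ^ k \<le> fact k * exp y"
proof -
  have "y ^ k /\<^sub>R fact k \<le> (\<Sum>k. y ^ k /\<^sub>R fact k)"
    using sum_le_suminf[of "\<lambda>k. y ^ k /\<^sub>R fact k" "{k}"] exp_converges[of y] assms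
    by (simp add: sums_iff)
  also have "\<dots> = exp y" using exp_converges[of y] by (simp add: sums_iff)
  finally show ?thesis by (simp add: field_simps)
qed

lemma summable_exp_powr:
  assumes t: "0 < (t::real)"
  shows "summable (\<lambda>n. exp (- t * real n) * (real n + 1) powr c)"
proof (rule summable_comparison_test')
  define m where "m = nat \<lceil>c\<rceil>"
  define C where "C = fact (m + 2) / t ^ (m + 2) * exp t"
  have "summable (\<lambda>n. inverse ((real (Suc n))\<^sup>2))"
    using inverse_power_summable[of 2, where 'a=real] by (subst summable_Suc_iff) simp
  then show "summable (\<lambda>n. C * inverse ((real (Suc n))\<^sup>2))" by (rule summable_mult)
  fix n :: nat
  let ?y = "real n + 1"
  have "?y powr c \<le> ?y powr real m"
    unfolding m_def by (intro powr_mono) linarith+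
  also have "\<dots> = ?y ^ m" by (simp add: powr_realpow)
  finally have "exp (- t * real n) * ?y powr c \<le> exp (- t * real n) * ?y ^ m" by simp
  also have "\<dots> = exp (- t * real n) * (t * ?y) ^ (m + 2) / t ^ (m + 2) * inverse (?y\<^sup>2)"
  proof -
    have "y ^ m = (t * y) ^ (m + 2) / t ^ (m + 2) * inverse (y\<^sup>2)" if "0 < y" for y :: real
      using t that by (simp add: power_mult_distrib power2_eq_square divide_simps)
    from this[of ?y] show ?thesis by simp
  qed
  also have "\<dots> \<le> exp (- t * real n) * (fact (m + 2) * exp (t * ?y)) / t ^ (m + 2) * inverse (?y\<^sup>2)"
    using t by (intro mult_right_mono divide_right_mono mult_left_mono power_le_fact_mult_exp) auto
  also have "\<dots> = (exp (- t * real n) * exp (t * ?y)) * fact (m + 2) / t ^ (m + 2) * inverse (?y\<^sup>2)"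
    by (simp only: mult_ac)
  also have "exp (- t * real n) * exp (t * ?y) = exp t"
    by (simp add: exp_add[symmetric] algebra_simps)
  also have "exp t * fact (m + 2) / t ^ (m + 2) * inverse (?y\<^sup>2) = C * inverse (?y\<^sup>2)"
    by (simp add: C_def)
  finally show "norm (exp (- t * real n) * ?y powr c) \<le> C * inverse ((real (Suc n))\<^sup>2)"
    by (simp add: add.commute)
qed

lemma integrable_stable_symbol:
  fixes \<theta> t :: real
  assumes \<theta>: "0 < \<theta>" and t: "0 < t"
  shows "integrable lborel (\<lambda>\<xi>::'a::euclidean_space. exp (- t * norm \<xi> powr \<theta>))"
proof (rule integrableI_bounded)
  show "(\<integral>\<^sup>+(\<xi>::'a). norm (exp (- t * norm \<xi> powr \<theta>)) \<partial>lborel) < \<infinity>"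
  proof (rule nn_integral_finite_if_ball_sum)
    fix \<xi> :: 'a
    \<comment> \<open>The layer containing \<open>\<xi>\<close>: \<open>|\<xi>|\<^sup>\<theta>\<close> lies in \<open>[n, n + 1)\<close>.\<close>
    define n where "n = nat \<lfloor>norm \<xi> powr \<theta>\<rfloor>"
    have n: "real n \<le> norm \<xi> powr \<theta>" "norm \<xi> powr \<theta> < real n + 1"
      unfolding n_def by (auto simp: of_nat_nat)
    have "norm \<xi> = (norm \<xi> powr \<theta>) powr (1 / \<theta>)" using \<theta> by (simp add: powr_powr)
    also have "\<dots> < (real n + 1) powr (1 / \<theta>)"
      using n \<theta> by (intro powr_less_mono2) auto
    finally have "\<xi> \<in> ball 0 ((real n + 1) powr (1 / \<theta>))" by simp
    moreover have "exp (- t * norm \<xi> powr \<theta>) \<le> exp (- t * real n)" using n t by simp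
    ultimately have "ennreal (norm (exp (- t * norm \<xi> powr \<theta>))) \<le>
        ennreal (exp (- t * real n)) * indicator (ball 0 ((real n + 1) powr (1 / \<theta>))) \<xi>"
      by (simp add: ennreal_leI)
    also have "\<dots> \<le> (\<Sum>n. ennreal (exp (- t * real n)) * indicator (ball 0 ((real n + 1) powr (1 / \<theta>))) \<xi>)"
      by (rule le_suminf_ennreal)
    finally show "ennreal (norm (exp (- t * norm \<xi> powr \<theta>))) \<le>
        (\<Sum>n. ennreal (exp (- t * real n)) * indicator (ball 0 ((real n + 1) powr (1 / \<theta>))) \<xi>)" .
  next
    have "((real n + 1) powr (1 / \<theta>)) ^ DIM('a) = (real n + 1) powr (DIM('a) / \<theta>)" for n
      by (simp add: powr_powr flip: powr_realpow)
    then show "summable (\<lambda>n. exp (- t * real n) * ((real n + 1) powr (1 / \<theta>)) ^ DIM('a))"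
      using summable_exp_powr[OF t, of "DIM('a) / \<theta>"] \<theta> by simp
  qed (auto simp: add_pos_nonneg)
qed measurable

section \<open>Fourier inversion for nonnegative transforms\<close>

lemma integrable_pair_lborel_bound:
  fixes f :: "'a::euclidean_space \<Rightarrow> real" and g :: "'b::euclidean_space \<Rightarrow> real"
  assumes f: "integrable lborel f" and g: "integrable lborel g"
    and [measurable]: "h \<in> borel_measurable (lborel \<Otimes>\<^sub>M lborel)"
    and bnd: "\<And>x y. \<bar>h (x, y)\<bar> \<le> \<bar>f x\<bar> * \<bar>g y\<bar>"
  shows "integrable (lborel \<Otimes>\<^sub>M lborel) (h :: _ \<Rightarrow> real)"
proof -
  have [measurable]: "f \<in> borel_measurable borel" "g \<in> borel_measurable borel" using f g by auto
  have "integrable (lborel \<Otimes>\<^sub>M lborel) (\<lambda>(x, y). \<bar>f x\<bar> * \<bar>g y\<bar>)"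
  proof (rule lborel_pair.Fubini_integrable)
    show "integrable lborel (\<lambda>x. \<integral>y. norm (case (x, y) of (x, y) \<Rightarrow> \<bar>f x\<bar> * \<bar>g y\<bar>) \<partial>lborel)"
      using f by (simp add: abs_mult)
    show "AE x in lborel. integrable lborel (\<lambda>y. case (x, y) of (x, y) \<Rightarrow> \<bar>f x\<bar> * \<bar>g y\<bar>)"
      using g by simp
  qed measurable
  then show ?thesis
    by (rule Bochner_Integration.integrable_bound) (auto simp: bnd abs_mult)
qed

lemma borel_measurable_fourier_cos [measurable]:
  assumes [measurable]: "f \<in> borel_measurable borel"
  shows "fourier_cos f \<in> borel_measurable (borel :: 'a::euclidean_space measure)"
proof -
  have "(\<lambda>x. \<integral>\<xi>. cos (x \<bullet> \<xi>) * f \<xi> \<partial>lborel) \<in> borel_measurable (borel :: 'a measure)"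
    by measurable
  then show ?thesis unfolding fourier_cos_def[abs_def] .
qed

lemma abs_fourier_cos_le:
  assumes "integrable lborel f"
  shows "\<bar>fourier_cos f x\<bar> \<le> (\<integral>\<xi>. \<bar>f \<xi>\<bar> \<partial>lborel)"
proof -
  have "\<bar>fourier_cos f x\<bar> \<le> (\<integral>\<xi>. \<bar>cos (x \<bullet> \<xi>) * f \<xi>\<bar> \<partial>lborel)"
    unfolding fourier_cos_def
    using integral_norm_bound[of lborel "\<lambda>\<xi>. cos (x \<bullet> \<xi>) * f \<xi>"] by simp
  also have "\<dots> \<le> (\<integral>\<xi>. \<bar>f \<xi>\<bar> \<partial>lborel)"
    using assms integrable_cos_mult[OF assms, of x]
    by (intro integral_mono integrable_abs) (auto simp: abs_mult intro!: mult_left_le_one_le)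
  finally show ?thesis .
qed

lemma integrable_cos_gaussian:
  assumes "0 < s"
  shows "integrable lborel (\<lambda>x::'a::euclidean_space. cos (z \<bullet> x) * exp (- s * (norm x)\<^sup>2))"
  by (rule integrable_cos_mult[OF integrable_gaussian[OF assms]])

text \<open>
  By Fubini the Gaussian weight in \<open>x\<close> turns the double transform of \<open>f\<close> into the convolution of
  \<open>f\<close> with a Gaussian of width \<open>sqrt \<epsilon>\<close>. The product of the two cosines is split by the addition
  formula into the frequencies \<open>\<xi> + \<eta>\<close> and \<open>\<xi> - \<eta>\<close>, which contribute equally as \<open>f\<close> is even.
  After rescaling around \<open>\<eta>\<close> the parameter \<open>\<epsilon>\<close> appears only in the argument of \<open>f\<close>.
\<close>

lemma fourier_cos_gaussian_damped:
  fixes f :: "'a::euclidean_space \<Rightarrow> real"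
  assumes f: "integrable lborel f" and sym: "\<And>\<xi>. f (- \<xi>) = f \<xi>" and \<epsilon>: "0 < \<epsilon>"
  shows "integrable lborel (\<lambda>x. cos (\<eta> \<bullet> x) * exp (- \<epsilon> * (norm x)\<^sup>2) * fourier_cos f x)"
    and "(\<integral>x. cos (\<eta> \<bullet> x) * exp (- \<epsilon> * (norm x)\<^sup>2) * fourier_cos f x \<partial>lborel) =
      (2 * sqrt pi) ^ DIM('a) * (\<integral>z. f (\<eta> + (2 * sqrt \<epsilon>) *\<^sub>R z) * exp (- (norm z)\<^sup>2) \<partial>lborel)"
proof -
  have [measurable]: "f \<in> borel_measurable borel" using f by auto
  note gauss = integrable_gaussian[OF \<epsilon>, where 'a='a]
  define I where "I = (\<integral>\<xi>. \<bar>f \<xi>\<bar> \<partial>lborel)"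
  have "integrable lborel (\<lambda>x::'a. I * exp (- \<epsilon> * (norm x)\<^sup>2))"
    using gauss by (rule integrable_mult_right)
  then show "integrable lborel (\<lambda>x. cos (\<eta> \<bullet> x) * exp (- \<epsilon> * (norm x)\<^sup>2) * fourier_cos f x)"
  proof (rule Bochner_Integration.integrable_bound)
    have "\<bar>cos (\<eta> \<bullet> x)\<bar> * exp (- \<epsilon> * (norm x)\<^sup>2) * \<bar>fourier_cos f x\<bar> \<le> 1 * exp (- \<epsilon> * (norm x)\<^sup>2) * I" for x
      unfolding I_def by (intro mult_mono abs_fourier_cos_le f) auto
    moreover have "0 \<le> I" by (simp add: I_def)
    ultimately show "AE x in lborel. norm (cos (\<eta> \<bullet> x) * exp (- \<epsilon> * (norm x)\<^sup>2) * fourier_cos f x)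
        \<le> norm (I * exp (- \<epsilon> * (norm x)\<^sup>2))"
      by (simp add: abs_mult mult_ac)
  qed measurable
  define g where "g z = sqrt (pi / \<epsilon>) ^ DIM('a) * exp (- (norm z)\<^sup>2 / (4 * \<epsilon>))" for z :: 'a
  have g_le: "\<bar>g z\<bar> \<le> sqrt (pi / \<epsilon>) ^ DIM('a)" for z
    unfolding g_def using \<epsilon> by (auto simp: abs_mult intro!: mult_right_le_one_le)
  have [measurable]: "g \<in> borel_measurable borel" unfolding g_def by measurable
  have int_fg: "integrable lborel (\<lambda>\<xi>. f \<xi> * g (\<xi> + b))" for b
  proof (rule Bochner_Integration.integrable_bound)
    show "integrable lborel (\<lambda>\<xi>. sqrt (pi / \<epsilon>) ^ DIM('a) * f \<xi>)" using f by simp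
    show "AE \<xi> in lborel. norm (f \<xi> * g (\<xi> + b)) \<le> norm (sqrt (pi / \<epsilon>) ^ DIM('a) * f \<xi>)"
      using g_le mult_left_mono[OF g_le abs_ge_zero] \<epsilon> by (auto simp: abs_mult mult_ac)
  qed measurable
  have prod: "(\<integral>x. cos (\<eta> \<bullet> x) * exp (- \<epsilon> * (norm x)\<^sup>2) * (cos (x \<bullet> \<xi>) * f \<xi>) \<partial>lborel) =
      (f \<xi> * g (\<xi> + \<eta>) + f \<xi> * g (\<xi> + - \<eta>)) / 2" for \<xi>
  proof -
    have "cos (\<eta> \<bullet> x) * exp (- \<epsilon> * (norm x)\<^sup>2) * (cos (x \<bullet> \<xi>) * f \<xi>) =
        (f \<xi> / 2) * (cos ((\<xi> + \<eta>) \<bullet> x) * exp (- \<epsilon> * (norm x)\<^sup>2) + cos ((\<xi> + - \<eta>) \<bullet> x) * exp (- \<epsilon> * (norm x)\<^sup>2))" for x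
      by (simp add: inner_add_left inner_diff_left cos_add cos_diff inner_commute[of \<xi>] algebra_simps)
    then show ?thesis
      by (simp only: integral_mult_right_zero Bochner_Integration.integral_add[OF integrable_cos_gaussian[OF \<epsilon>] integrable_cos_gaussian[OF \<epsilon>]]
          fourier_gaussian[OF \<epsilon>] g_def) (simp add: algebra_simps)
  qed
  have "(\<integral>x. cos (\<eta> \<bullet> x) * exp (- \<epsilon> * (norm x)\<^sup>2) * fourier_cos f x \<partial>lborel) =
      (\<integral>x. \<integral>\<xi>. cos (\<eta> \<bullet> x) * exp (- \<epsilon> * (norm x)\<^sup>2) * (cos (x \<bullet> \<xi>) * f \<xi>) \<partial>lborel \<partial>lborel)"
    by (simp add: fourier_cos_def)
  also have "\<dots> = (\<integral>\<xi>. \<integral>x. cos (\<eta> \<bullet> x) * exp (- \<epsilon> * (norm x)\<^sup>2) * (cos (x \<bullet> \<xi>) * f \<xi>) \<partial>lborel \<partial>lborel)"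
  proof (rule lborel_pair.Fubini_integral[symmetric], rule integrable_pair_lborel_bound[OF gauss f])
    fix x \<xi> :: 'a
    have "(\<bar>cos (\<eta> \<bullet> x)\<bar> * exp (- \<epsilon> * (norm x)\<^sup>2)) * (\<bar>cos (x \<bullet> \<xi>)\<bar> * \<bar>f \<xi>\<bar>) \<le>
        (1 * exp (- \<epsilon> * (norm x)\<^sup>2)) * (1 * \<bar>f \<xi>\<bar>)"
      by (intro mult_mono) auto
    then show "\<bar>case (x, \<xi>) of (x, \<xi>) \<Rightarrow> cos (\<eta> \<bullet> x) * exp (- \<epsilon> * (norm x)\<^sup>2) * (cos (x \<bullet> \<xi>) * f \<xi>)\<bar>
        \<le> \<bar>exp (- \<epsilon> * (norm x)\<^sup>2)\<bar> * \<bar>f \<xi>\<bar>"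
      by (simp add: abs_mult)
  qed measurable
  also have "\<dots> = (\<integral>\<xi>. (f \<xi> * g (\<xi> + \<eta>) + f \<xi> * g (\<xi> + - \<eta>)) / 2 \<partial>lborel)"
    by (simp only: prod)
  also have "\<dots> = ((\<integral>\<xi>. f \<xi> * g (\<xi> + \<eta>) \<partial>lborel) + (\<integral>\<xi>. f \<xi> * g (\<xi> + - \<eta>) \<partial>lborel)) / 2"
    by (simp only: integral_divide_zero Bochner_Integration.integral_add[OF int_fg int_fg])
  also have "(\<integral>\<xi>. f \<xi> * g (\<xi> + \<eta>) \<partial>lborel) = (\<integral>\<xi>. f \<xi> * g (\<xi> + - \<eta>) \<partial>lborel)"
  proof -
    have g_sym: "g (\<eta> - \<xi>) = g (\<xi> - \<eta>)" for \<xi> by (simp add: g_def norm_minus_commute)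
    show ?thesis
      by (subst integral_lborel_affine[where c="-1" and a=0]) (auto simp: sym g_sym)
  qed
  also have "(\<integral>\<xi>. f \<xi> * g (\<xi> + - \<eta>) \<partial>lborel) =
      (2 * sqrt \<epsilon>) ^ DIM('a) * (\<integral>z. f (\<eta> + (2 * sqrt \<epsilon>) *\<^sub>R z) * g ((2 * sqrt \<epsilon>) *\<^sub>R z) \<partial>lborel)"
    using \<epsilon> by (subst integral_lborel_affine[where c="2 * sqrt \<epsilon>" and a=\<eta>]) auto
  also have "(\<lambda>z. f (\<eta> + (2 * sqrt \<epsilon>) *\<^sub>R z) * g ((2 * sqrt \<epsilon>) *\<^sub>R z)) =
     (\<lambda>z. sqrt (pi / \<epsilon>) ^ DIM('a) * (f (\<eta> + (2 * sqrt \<epsilon>) *\<^sub>R z) * exp (- (norm z)\<^sup>2)))"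
    using \<epsilon> by (auto simp: g_def power_mult_distrib)
  also have "(2 * sqrt \<epsilon>) ^ DIM('a) * (\<integral>z. sqrt (pi / \<epsilon>) ^ DIM('a) * (f (\<eta> + (2 * sqrt \<epsilon>) *\<^sub>R z) * exp (- (norm z)\<^sup>2)) \<partial>lborel) =
     ((2 * sqrt \<epsilon>) * sqrt (pi / \<epsilon>)) ^ DIM('a) * (\<integral>z. f (\<eta> + (2 * sqrt \<epsilon>) *\<^sub>R z) * exp (- (norm z)\<^sup>2) \<partial>lborel)"
    by (simp add: power_mult_distrib)
  also have "(2 * sqrt \<epsilon>) * sqrt (pi / \<epsilon>) = 2 * sqrt pi"
    using \<epsilon> by (simp add: real_sqrt_divide)
  finally show "(\<integral>x. cos (\<eta> \<bullet> x) * exp (- \<epsilon> * (norm x)\<^sup>2) * fourier_cos f x \<partial>lborel) =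
      (2 * sqrt pi) ^ DIM('a) * (\<integral>z. f (\<eta> + (2 * sqrt \<epsilon>) *\<^sub>R z) * exp (- (norm z)\<^sup>2) \<partial>lborel)"
    by simp
qed

text \<open>
  Remove the Gaussian weight by letting \<open>\<epsilon>\<close> tend to \<open>0\<close>. The right-hand side of the damped identity
  converges by continuity of \<open>f\<close>. For \<open>\<eta> = 0\<close> the weights increase to \<open>1\<close> and the transform is
  nonnegative, so monotone convergence gives its integrability; it then serves as the dominating
  function for general \<open>\<eta>\<close>.
\<close>

lemma fourier_cos_inversion:
  fixes f :: "'a::euclidean_space \<Rightarrow> real"
  assumes f: "integrable lborel f" and sym: "\<And>\<xi>. f (- \<xi>) = f \<xi>"
    and bnd: "\<And>\<xi>. \<bar>f \<xi>\<bar> \<le> B" and cont: "continuous_on UNIV f"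
    and nonneg: "\<And>x. 0 \<le> fourier_cos f x"
  shows "integrable lborel (fourier_cos f)"
    and "fourier_cos (fourier_cos f) \<eta> = (2 * pi) ^ DIM('a) * f \<eta>"
proof -
  have [measurable]: "f \<in> borel_measurable borel" using f by auto
  define e where "e n = inverse (real (Suc n))" for n
  have e: "0 < e n" for n by (simp add: e_def)
  have e_lim: "e \<longlonglongrightarrow> 0" unfolding e_def by (rule LIMSEQ_inverse_real_of_nat)
  define J where "J n \<eta> x = cos (\<eta> \<bullet> x) * exp (- e n * (norm x)\<^sup>2) * fourier_cos f x" for n and \<eta> x :: 'a
  have J_int: "integrable lborel (J n \<eta>)" for n \<eta>
    unfolding J_def by (rule fourier_cos_gaussian_damped(1)[OF f sym e])
  have [measurable]: "J n \<eta> \<in> borel_measurable borel" for n \<eta> using J_int by auto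
  have J_lim: "(\<lambda>n. J n \<eta> x) \<longlonglongrightarrow> cos (\<eta> \<bullet> x) * fourier_cos f x" for \<eta> x
  proof -
    have "(\<lambda>n. J n \<eta> x) \<longlonglongrightarrow> cos (\<eta> \<bullet> x) * exp (- 0 * (norm x)\<^sup>2) * fourier_cos f x"
      unfolding J_def by (intro tendsto_intros e_lim)
    then show ?thesis by simp
  qed
  have gauss: "(\<integral>(z::'a). exp (- (norm z)\<^sup>2) \<partial>lborel) = sqrt pi ^ DIM('a)"
    using fourier_gaussian[of 1 "0::'a"] by simp
  have J_int_lim: "(\<lambda>n. \<integral>x. J n \<eta> x \<partial>lborel) \<longlonglongrightarrow> (2 * pi) ^ DIM('a) * f \<eta>" for \<eta>
  proof -
    have "(\<lambda>n. \<integral>z. f (\<eta> + (2 * sqrt (e n)) *\<^sub>R z) * exp (- (norm z)\<^sup>2) \<partial>lborel) \<longlonglongrightarrow>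
        (\<integral>(z::'a). f \<eta> * exp (- (norm z)\<^sup>2) \<partial>lborel)"
    proof (rule integral_dominated_convergence)
      show "integrable lborel (\<lambda>z::'a. B * exp (- (norm z)\<^sup>2))"
        using integrable_gaussian[of 1, where 'a='a] by (intro integrable_mult_right) simp
      show "AE z in lborel. norm (f (\<eta> + (2 * sqrt (e n)) *\<^sub>R z) * exp (- (norm z)\<^sup>2)) \<le> B * exp (- (norm z)\<^sup>2)" for n
        by (auto simp: abs_mult bnd)
      show "AE z in lborel. (\<lambda>n. f (\<eta> + (2 * sqrt (e n)) *\<^sub>R z) * exp (- (norm z)\<^sup>2)) \<longlonglongrightarrow> f \<eta> * exp (- (norm z)\<^sup>2)"
      proof (rule AE_I2)
        fix z :: 'a
        have "(\<lambda>n. \<eta> + (2 * sqrt (e n)) *\<^sub>R z) \<longlonglongrightarrow> \<eta> + (2 * sqrt 0) *\<^sub>R z"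
          by (intro tendsto_intros e_lim)
        then have "(\<lambda>n. f (\<eta> + (2 * sqrt (e n)) *\<^sub>R z)) \<longlonglongrightarrow> f \<eta>"
          using cont by (intro continuous_on_tendsto_compose[OF cont]) auto
        then show "(\<lambda>n. f (\<eta> + (2 * sqrt (e n)) *\<^sub>R z) * exp (- (norm z)\<^sup>2)) \<longlonglongrightarrow> f \<eta> * exp (- (norm z)\<^sup>2)"
          by (intro tendsto_intros)
      qed
    qed measurable
    then have "(\<lambda>n. \<integral>x. J n \<eta> x \<partial>lborel) \<longlonglongrightarrow> (2 * sqrt pi) ^ DIM('a) * (f \<eta> * sqrt pi ^ DIM('a))"
      unfolding J_def fourier_cos_gaussian_damped(2)[OF f sym e]
      by (intro tendsto_mult tendsto_const) (simp add: gauss)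
    also have "(2 * sqrt pi) ^ DIM('a) * (f \<eta> * sqrt pi ^ DIM('a)) = (2 * sqrt pi * sqrt pi) ^ DIM('a) * f \<eta>"
      by (simp add: power_mult_distrib mult_ac)
    also have "2 * sqrt pi * sqrt pi = 2 * pi" by simp
    finally show ?thesis .
  qed
  show int: "integrable lborel (fourier_cos f)"
  proof (rule integrable_monotone_convergence[OF J_int _ _ J_int_lim])
    show "AE x in lborel. mono (\<lambda>n. J n 0 x)"
    proof (rule AE_I2, rule monoI)
      fix x :: 'a and m n :: nat assume "m \<le> n"
      then have "e n \<le> e m" by (simp add: e_def)
      then show "J m 0 x \<le> J n 0 x"
        unfolding J_def using nonneg by (intro mult_right_mono mult_left_mono) (auto intro: mult_right_mono)
    qed
    show "AE x in lborel. (\<lambda>n. J n 0 x) \<longlonglongrightarrow> fourier_cos f x"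
      using J_lim[of 0] by simp
  qed measurable
  have "(\<lambda>n. \<integral>x. J n \<eta> x \<partial>lborel) \<longlonglongrightarrow> (\<integral>x. cos (\<eta> \<bullet> x) * fourier_cos f x \<partial>lborel)"
  proof (rule integral_dominated_convergence[OF _ _ int])
    show "AE x in lborel. (\<lambda>n. J n \<eta> x) \<longlonglongrightarrow> cos (\<eta> \<bullet> x) * fourier_cos f x"
      using J_lim by simp
    show "AE x in lborel. norm (J n \<eta> x) \<le> fourier_cos f x" for n
    proof (rule AE_I2)
      fix x :: 'a
      have "\<bar>cos (\<eta> \<bullet> x)\<bar> * exp (- e n * (norm x)\<^sup>2) * fourier_cos f x \<le> 1 * 1 * fourier_cos f x"
        using nonneg e[of n] by (intro mult_mono) auto
      then show "norm (J n \<eta> x) \<le> fourier_cos f x"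
        using nonneg by (simp add: J_def abs_mult)
    qed
  qed measurable
  from LIMSEQ_unique[OF this J_int_lim]
  show "fourier_cos (fourier_cos f) \<eta> = (2 * pi) ^ DIM('a) * f \<eta>"
    by (simp add: fourier_cos_def[of "fourier_cos f"])
qed

section \<open>The fundamental solution\<close>

lemma fundamental_solution_lborel:
  "fundamental_solution \<theta> (x::'a::euclidean_space) t =
     Re ((\<integral>\<xi>. exp (\<i> * complex_of_real (x \<bullet> \<xi>) - complex_of_real (t * norm \<xi> powr \<theta>)) \<partial>lborel)
         / complex_of_real ((2 * pi) ^ DIM('a)))"
  unfolding fundamental_solution_def by (subst integral_completion) auto

lemma borel_measurable_fundamental_solution [measurable]:
  assumes [measurable]: "f \<in> borel_measurable M" "g \<in> borel_measurable M"
  shows "(\<lambda>w. fundamental_solution \<theta> (f w :: 'a::euclidean_space) (g w)) \<in> borel_measurable M"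
  unfolding fundamental_solution_lborel by measurable

context
  fixes \<theta> :: real
  assumes \<theta>: "0 < \<theta>"
begin

lemma fundamental_solution_fourier_cos:
  assumes t: "0 < t"
  shows "fundamental_solution \<theta> (x::'a::euclidean_space) t =
    fourier_cos (\<lambda>\<xi>. exp (- t * norm \<xi> powr \<theta>)) x / (2 * pi) ^ DIM('a)"
proof -
  let ?F = "\<lambda>\<xi>. exp (\<i> * complex_of_real (x \<bullet> \<xi>) - complex_of_real (t * norm \<xi> powr \<theta>))"
  have Re_F: "Re (?F \<xi>) = cos (x \<bullet> \<xi>) * exp (- t * norm \<xi> powr \<theta>)" for \<xi>
    by (simp add: Re_exp)
  have "integrable lborel ?F"
    by (rule Bochner_Integration.integrable_bound[OF integrable_stable_symbol[OF \<theta> t, where 'a='a]]) auto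
  from integral_Re[OF this]
  have "Re (\<integral>\<xi>. ?F \<xi> \<partial>lborel) = fourier_cos (\<lambda>\<xi>. exp (- t * norm \<xi> powr \<theta>)) x"
    by (simp only: Re_F fourier_cos_def)
  then show ?thesis
    unfolding fundamental_solution_lborel by (simp only: Re_divide_of_real)
qed

text \<open>
  Substitute \<open>\<xi> = t powr (- 1 / \<theta>) \<zeta>\<close> in the Fourier integral.
\<close>

lemma fundamental_solution_scaling:
  assumes t: "0 < t"
  shows "fundamental_solution \<theta> (x::'a::euclidean_space) t =
    (t powr (- 1 / \<theta>)) ^ DIM('a) * fundamental_solution \<theta> (t powr (- 1 / \<theta>) *\<^sub>R x) 1"
proof -
  let ?c = "t powr (- 1 / \<theta>)"
  have c: "t * (norm (?c *\<^sub>R \<xi>)) powr \<theta> = norm \<xi> powr \<theta>" for \<xi> :: 'a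
    using t \<theta> by (simp add: powr_mult powr_divide powr_powr powr_minus_divide)
  have "fourier_cos (\<lambda>\<xi>. exp (- t * norm \<xi> powr \<theta>)) x =
     \<bar>?c\<bar> ^ DIM('a) * (\<integral>\<xi>. cos (x \<bullet> (0 + ?c *\<^sub>R \<xi>)) * exp (- t * norm (0 + ?c *\<^sub>R \<xi>) powr \<theta>) \<partial>lborel)"
    unfolding fourier_cos_def using t by (intro integral_lborel_affine) auto
  also have "\<dots> = ?c ^ DIM('a) * fourier_cos (\<lambda>\<xi>. exp (- 1 * norm \<xi> powr \<theta>)) (?c *\<^sub>R x)"
    using c by (simp add: fourier_cos_def)
  finally show ?thesis
    using fundamental_solution_fourier_cos[OF t, of x] fundamental_solution_fourier_cos[of 1 "?c *\<^sub>R x"] by simp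
qed

lemma fundamental_solution_uminus:
  assumes "0 < t"
  shows "fundamental_solution \<theta> (- x) t = fundamental_solution \<theta> x t"
  by (simp add: fundamental_solution_fourier_cos[OF assms] fourier_cos_def)

end

context
  fixes \<theta> :: real
  assumes \<theta>: "0 < \<theta>" "\<theta> \<le> 2"
begin

lemma nonneg_radial_decr_fundamental_solution:
  assumes t: "0 < t"
  shows "nonneg_radial_decr (\<lambda>x::'a::euclidean_space. fundamental_solution \<theta> x t)"
  using damped_radial_imp_nonneg_radial_decr[OF damped_radial_stable[OF \<theta> t]
      integrable_stable_symbol[OF \<theta>(1) t], where 'a='a]
  by (auto simp: fundamental_solution_fourier_cos[OF \<theta>(1) t] nonneg_radial_decr_def divide_right_mono)

lemma fundamental_solution_nonneg: "0 < t \<Longrightarrow> 0 \<le> fundamental_solution \<theta> (x::'a::euclidean_space) t"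
  using nonneg_radial_decr_fundamental_solution[of t, where 'a='a] by (auto simp: nonneg_radial_decr_def)

lemma fundamental_solution_mono:
  "0 < t \<Longrightarrow> norm x \<le> norm (y::'a) \<Longrightarrow> fundamental_solution \<theta> y t \<le> fundamental_solution \<theta> (x::'a::euclidean_space) t"
  using nonneg_radial_decr_fundamental_solution[of t, where 'a='a] by (auto simp: nonneg_radial_decr_def)

lemma fourier_cos_fundamental_solution:
  assumes t: "0 < t"
  shows "integrable lborel (\<lambda>x::'a::euclidean_space. fundamental_solution \<theta> x t)"
    and "fourier_cos (\<lambda>x. fundamental_solution \<theta> x t) \<eta> = exp (- t * norm (\<eta>::'a) powr \<theta>)"
proof -
  let ?f = "\<lambda>\<xi>::'a. exp (- t * norm \<xi> powr \<theta>)"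
  have cont: "continuous_on UNIV ?f"
    using \<theta> by (intro continuous_intros continuous_on_powr') auto
  have nn: "0 \<le> fourier_cos ?f x" for x
    using damped_radial_imp_nonneg_radial_decr[OF damped_radial_stable[OF \<theta> t]
      integrable_stable_symbol[OF \<theta>(1) t], where 'a='a] by (auto simp: nonneg_radial_decr_def)
  have bnd: "\<bar>?f \<xi>\<bar> \<le> 1" for \<xi> using t by simp
  note inv = fourier_cos_inversion[OF integrable_stable_symbol[OF \<theta>(1) t] _ bnd cont nn]
  have "integrable lborel (fourier_cos ?f)" by (rule inv) simp
  then show "integrable lborel (\<lambda>x::'a. fundamental_solution \<theta> x t)"
    by (simp add: fundamental_solution_fourier_cos[OF \<theta>(1) t])
  have eq: "fourier_cos (fourier_cos ?f) \<eta> = (2 * pi) ^ DIM('a) * ?f \<eta>" by (rule inv) simp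
  have "fourier_cos (\<lambda>x. fundamental_solution \<theta> x t) \<eta> = fourier_cos (fourier_cos ?f) \<eta> / (2 * pi) ^ DIM('a)"
    by (simp add: fundamental_solution_fourier_cos[OF \<theta>(1) t] fourier_cos_def[of _ \<eta>])
  then show "fourier_cos (\<lambda>x. fundamental_solution \<theta> x t) \<eta> = ?f \<eta>"
    unfolding eq by simp
qed

lemma nn_integral_fundamental_solution:
  assumes t: "0 < t"
  shows "(\<integral>\<^sup>+(x::'a::euclidean_space). ennreal (fundamental_solution \<theta> x t) \<partial>lborel) = 1"
  using fourier_cos_fundamental_solution(2)[OF t, of "0::'a"] \<theta>
  by (subst nn_integral_eq_integral)
     (auto simp: fourier_cos_fundamental_solution(1)[OF t] fundamental_solution_nonneg[OF t] fourier_cos_def)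

text \<open>
  Write the first factor as a Fourier integral and integrate over \<open>y\<close> first. Fourier inversion turns
  the \<open>y\<close>-integral into \<open>cos (x \<bullet> \<xi>) exp (- s |\<xi>|\<^sup>\<theta>)\<close>; the sine part vanishes because the
  fundamental solution is even. The exponentials then multiply.
\<close>

lemma fundamental_solution_convolution:
  fixes x :: "'a::euclidean_space"
  assumes t: "0 < t" and s: "0 < s"
  shows "(\<integral>\<^sup>+y. ennreal (fundamental_solution \<theta> (x - y) t) * ennreal (fundamental_solution \<theta> y s) \<partial>lborel) =
    ennreal (fundamental_solution \<theta> x (t + s))"
proof -
  let ?K = "\<lambda>t x::'a. fundamental_solution \<theta> x t"
  let ?e = "\<lambda>t \<xi>::'a. exp (- t * norm \<xi> powr \<theta>)"
  let ?c = "(2 * pi) ^ DIM('a)"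
  note Ks = fourier_cos_fundamental_solution(1)[OF s, where 'a='a]
  note Kt = fourier_cos_fundamental_solution(1)[OF t, where 'a='a]
  note et = integrable_stable_symbol[OF \<theta>(1) t, where 'a='a]
  have K0: "\<bar>?K t z\<bar> \<le> ?K t 0" for z
    using fundamental_solution_mono[OF t, of 0 z] fundamental_solution_nonneg[OF t, of z] by simp
  have int: "integrable lborel (\<lambda>y. ?K t (x - y) * ?K s y)"
  proof (rule Bochner_Integration.integrable_bound)
    show "integrable lborel (\<lambda>y. ?K t 0 * ?K s y)" using Ks by simp
    show "AE y in lborel. norm (?K t (x - y) * ?K s y) \<le> norm (?K t 0 * ?K s y)"
      using K0 fundamental_solution_nonneg[OF t, of "0::'a"] by (auto simp: abs_mult intro!: mult_right_mono)
  qed measurable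
  have sin_int: "integrable lborel (\<lambda>y. sin (y \<bullet> \<xi>) * ?K s y)" for \<xi>
    by (rule Bochner_Integration.integrable_bound[OF Ks]) (auto simp: abs_mult intro!: mult_left_le_one_le)
  have sin_0: "(\<integral>y. sin (y \<bullet> \<xi>) * ?K s y \<partial>lborel) = 0" for \<xi>
  proof -
    have "(\<integral>y. sin (y \<bullet> \<xi>) * ?K s y \<partial>lborel) = - (\<integral>y. sin (y \<bullet> \<xi>) * ?K s y \<partial>lborel)"
      by (subst integral_lborel_affine[where c="-1" and a=0]) (auto simp: fundamental_solution_uminus[OF \<theta>(1) s])
    then show ?thesis by simp
  qed
  have shift: "(\<integral>y. cos ((x - y) \<bullet> \<xi>) * ?e t \<xi> * ?K s y \<partial>lborel) = cos (x \<bullet> \<xi>) * ?e (t + s) \<xi>" for \<xi>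
  proof -
    have "cos ((x - y) \<bullet> \<xi>) * ?e t \<xi> * ?K s y =
       (cos (x \<bullet> \<xi>) * ?e t \<xi>) * (cos (\<xi> \<bullet> y) * ?K s y) + (sin (x \<bullet> \<xi>) * ?e t \<xi>) * (sin (y \<bullet> \<xi>) * ?K s y)" for y
      by (simp add: inner_diff_left cos_diff algebra_simps inner_commute[of \<xi>])
    then have "(\<integral>y. cos ((x - y) \<bullet> \<xi>) * ?e t \<xi> * ?K s y \<partial>lborel) =
       (cos (x \<bullet> \<xi>) * ?e t \<xi>) * (\<integral>y. cos (\<xi> \<bullet> y) * ?K s y \<partial>lborel) + (sin (x \<bullet> \<xi>) * ?e t \<xi>) * (\<integral>y. sin (y \<bullet> \<xi>) * ?K s y \<partial>lborel)"
      using integrable_cos_mult[OF Ks, of \<xi>] sin_int by simp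
    also have "\<dots> = cos (x \<bullet> \<xi>) * (?e t \<xi> * ?e s \<xi>)"
      using fourier_cos_fundamental_solution(2)[OF s, of \<xi>] by (simp add: sin_0 fourier_cos_def)
    also have "?e t \<xi> * ?e s \<xi> = ?e (t + s) \<xi>"
      by (simp add: exp_add[symmetric] algebra_simps)
    finally show ?thesis .
  qed
  have "(\<integral>y. ?K t (x - y) * ?K s y \<partial>lborel) =
     (\<integral>y. (\<integral>\<xi>. cos ((x - y) \<bullet> \<xi>) * ?e t \<xi> * ?K s y \<partial>lborel) / ?c \<partial>lborel)"
    by (intro Bochner_Integration.integral_cong refl)
       (simp add: fundamental_solution_fourier_cos[OF \<theta>(1) t] fourier_cos_def)
  also have "\<dots> = (\<integral>y. \<integral>\<xi>. cos ((x - y) \<bullet> \<xi>) * ?e t \<xi> * ?K s y \<partial>lborel \<partial>lborel) / ?c"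
    by (rule integral_divide_zero)
  also have "(\<integral>y. \<integral>\<xi>. cos ((x - y) \<bullet> \<xi>) * ?e t \<xi> * ?K s y \<partial>lborel \<partial>lborel) =
      (\<integral>\<xi>. \<integral>y. cos ((x - y) \<bullet> \<xi>) * ?e t \<xi> * ?K s y \<partial>lborel \<partial>lborel)"
  proof (rule lborel_pair.Fubini_integral[symmetric], rule integrable_pair_lborel_bound[OF Ks et])
    fix y \<xi> :: 'a
    have "(\<bar>cos ((x - y) \<bullet> \<xi>)\<bar> * ?e t \<xi>) * \<bar>?K s y\<bar> \<le> (1 * ?e t \<xi>) * \<bar>?K s y\<bar>"
      by (intro mult_right_mono) auto
    then show "\<bar>case (y, \<xi>) of (y, \<xi>) \<Rightarrow> cos ((x - y) \<bullet> \<xi>) * ?e t \<xi> * ?K s y\<bar> \<le> \<bar>?K s y\<bar> * \<bar>?e t \<xi>\<bar>"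
      by (simp add: abs_mult mult_ac)
  qed measurable
  also have "\<dots> / ?c = ?K (t + s) x"
    unfolding shift using t s
    by (simp add: fundamental_solution_fourier_cos[OF \<theta>(1)] fourier_cos_def)
  finally have eq: "(\<integral>y. ?K t (x - y) * ?K s y \<partial>lborel) = ?K (t + s) x" .
  have "(\<integral>\<^sup>+y. ennreal (?K t (x - y)) * ennreal (?K s y) \<partial>lborel) = (\<integral>\<^sup>+y. ennreal (?K t (x - y) * ?K s y) \<partial>lborel)"
    by (simp add: ennreal_mult fundamental_solution_nonneg t s)
  also have "\<dots> = ennreal (?K (t + s) x)"
    by (subst nn_integral_eq_integral[OF int]) (auto simp: fundamental_solution_nonneg t s eq)
  finally show ?thesis .
qed

end

section \<open>The heat semigroup\<close>

lemma heat_semigroup_lborel: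
  "heat_semigroup \<theta> t \<psi> x = (\<integral>\<^sup>+y. ennreal (fundamental_solution \<theta> (x - y) t) * \<psi> y \<partial>lborel)"
  unfolding heat_semigroup_def by (rule nn_integral_completion)

lemma borel_measurable_heat_semigroup [measurable]:
  assumes [measurable]: "f \<in> borel_measurable M" "g \<in> borel_measurable M"
    "case_prod \<psi> \<in> borel_measurable (M \<Otimes>\<^sub>M lborel)"
  shows "(\<lambda>w. heat_semigroup \<theta> (g w) (\<psi> w) (f w :: 'a::euclidean_space)) \<in> borel_measurable M"
  unfolding heat_semigroup_lborel by measurable

lemma heat_semigroup_mono_AE:
  assumes "AE y in lborel. \<psi> y \<le> \<psi>' y"
  shows "heat_semigroup \<theta> t \<psi> x \<le> heat_semigroup \<theta> t \<psi>' x"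
  unfolding heat_semigroup_lborel
  by (rule nn_integral_mono_AE) (use assms in \<open>eventually_elim, auto intro: mult_left_mono\<close>)

lemma heat_semigroup_mono:
  "(\<And>y. \<psi> y \<le> \<psi>' y) \<Longrightarrow> heat_semigroup \<theta> t \<psi> x \<le> heat_semigroup \<theta> t \<psi>' x"
  by (rule heat_semigroup_mono_AE) auto

lemma heat_semigroup_cong_AE:
  assumes "AE y in lborel. \<psi> y = \<psi>' y"
  shows "heat_semigroup \<theta> t \<psi> x = heat_semigroup \<theta> t \<psi>' x"
  using assms by (intro antisym heat_semigroup_mono_AE) (auto elim: eventually_mono)

lemma heat_semigroup_cmult:
  assumes [measurable]: "\<psi> \<in> borel_measurable borel"
  shows "heat_semigroup \<theta> t (\<lambda>y. c * \<psi> y) x = c * heat_semigroup \<theta> t \<psi> x"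
  unfolding heat_semigroup_lborel by (subst nn_integral_cmult[symmetric]) (auto simp: mult_ac)

lemma heat_semigroup_add:
  assumes [measurable]: "\<psi> \<in> borel_measurable borel" "\<psi>' \<in> borel_measurable borel"
  shows "heat_semigroup \<theta> t (\<lambda>y. \<psi> y + \<psi>' y) x = heat_semigroup \<theta> t \<psi> x + heat_semigroup \<theta> t \<psi>' x"
  unfolding heat_semigroup_lborel by (subst nn_integral_add[symmetric]) (auto simp: distrib_left)

lemma heat_semigroup_SUP:
  fixes \<psi> :: "nat \<Rightarrow> 'a::euclidean_space \<Rightarrow> ennreal"
  assumes [measurable]: "\<And>n. \<psi> n \<in> borel_measurable borel" and inc: "\<And>n y. \<psi> n y \<le> \<psi> (Suc n) y"
  shows "heat_semigroup \<theta> t (\<lambda>y. SUP n. \<psi> n y) x = (SUP n. heat_semigroup \<theta> t (\<psi> n) x)"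
  unfolding heat_semigroup_lborel SUP_mult_left_ennreal
  by (intro nn_integral_monotone_convergence_SUP)
     (auto intro!: incseq_SucI le_funI mult_left_mono inc)

text \<open>
  The tangent of \<open>y powr q\<close> at \<open>z\<close> lies below the graph; this is Young's inequality.
\<close>

lemma powr_tangent_le:
  fixes y z q :: real
  assumes "0 \<le> y" "0 \<le> z" "1 \<le> q"
  shows "q * z powr (q - 1) * y \<le> y powr q + (q - 1) * z powr q"
proof (cases "q = 1")
  case True
  then show ?thesis using assms by (cases "z = 0") auto
next
  case False
  then have q: "1 < q" using assms by simp
  have "y * z powr (q - 1) \<le> y powr q / q + (z powr (q - 1)) powr (q / (q - 1)) / (q / (q - 1))"
    using q assms by (intro Youngs_inequality) (auto simp: field_simps)
  also have "(z powr (q - 1)) powr (q / (q - 1)) = z powr q"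
    using q by (simp add: powr_powr)
  finally show ?thesis using q by (simp add: field_simps)
qed

context
  fixes \<theta> :: real
  assumes \<theta>: "0 < \<theta>" "\<theta> \<le> 2"
begin

lemma nn_integral_fundamental_solution_diff:
  assumes t: "0 < t"
  shows "(\<integral>\<^sup>+(y::'a::euclidean_space). ennreal (fundamental_solution \<theta> (x - y) t) \<partial>lborel) = 1"
  by (subst nn_integral_lborel_affine[where c="-1" and a=x])
     (auto simp: nn_integral_fundamental_solution[OF \<theta> t])

lemma heat_semigroup_const:
  assumes t: "0 < t"
  shows "heat_semigroup \<theta> t (\<lambda>_. c) x = c"
  unfolding heat_semigroup_lborel
  by (subst nn_integral_multc) (auto simp: nn_integral_fundamental_solution_diff[OF t])

lemma heat_semigroup_compose:
  fixes x :: "'a::euclidean_space"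
  assumes t: "0 < t" and s: "0 < s" and [measurable]: "\<psi> \<in> borel_measurable borel"
  shows "heat_semigroup \<theta> t (heat_semigroup \<theta> s \<psi>) x = heat_semigroup \<theta> (t + s) \<psi> x"
proof -
  let ?K = "\<lambda>t x::'a. ennreal (fundamental_solution \<theta> x t)"
  have conv: "(\<integral>\<^sup>+y. ?K t (x - y) * ?K s (y - z) \<partial>lborel) = ?K (t + s) (x - z)" for z
    by (subst nn_integral_lborel_affine[where c=1 and a=z])
       (auto simp: fundamental_solution_convolution[OF \<theta> t s, symmetric] diff_diff_eq)
  have "heat_semigroup \<theta> t (heat_semigroup \<theta> s \<psi>) x =
      (\<integral>\<^sup>+y. \<integral>\<^sup>+z. ?K t (x - y) * ?K s (y - z) * \<psi> z \<partial>lborel \<partial>lborel)"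
    unfolding heat_semigroup_lborel by (subst nn_integral_cmult[symmetric]) (auto simp: mult_ac)
  also have "\<dots> = (\<integral>\<^sup>+z. \<integral>\<^sup>+y. ?K t (x - y) * ?K s (y - z) * \<psi> z \<partial>lborel \<partial>lborel)"
    by (rule lborel_pair.Fubini'[symmetric]) measurable
  also have "\<dots> = (\<integral>\<^sup>+z. (\<integral>\<^sup>+y. ?K t (x - y) * ?K s (y - z) \<partial>lborel) * \<psi> z \<partial>lborel)"
    by (subst nn_integral_multc) auto
  also have "\<dots> = (\<integral>\<^sup>+z. ?K (t + s) (x - z) * \<psi> z \<partial>lborel)"
    by (simp only: conv)
  finally show ?thesis unfolding heat_semigroup_lborel[of \<theta> "t + s"] .
qed

text \<open>
  Jensen's inequality for the probability density \<open>fundamental_solution \<theta> (x - y) t\<close>. Integrating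
  the tangent inequality at the fixed point \<open>z\<close>, which is only a lower bound for the mean, makes the
  argument work in \<open>[0, \<infinity>]\<close>: the mean may be infinite.
\<close>

lemma heat_semigroup_Jensen:
  fixes f :: "'a::euclidean_space \<Rightarrow> real"
  assumes t: "0 < t" and [measurable]: "f \<in> borel_measurable borel" and f: "\<And>y. 0 \<le> f y"
    and z: "0 \<le> z" and q: "1 \<le> q"
    and le: "ennreal z \<le> heat_semigroup \<theta> t (\<lambda>y. ennreal (f y)) x"
  shows "ennreal (z powr q) \<le> heat_semigroup \<theta> t (\<lambda>y. ennreal (f y powr q)) x"
proof -
  let ?H = "heat_semigroup \<theta> t"
  have "ennreal (z powr q) + ennreal ((q - 1) * z powr q) = ennreal (q * z powr (q - 1)) * ennreal z"
    using q z by (cases "z = 0") (auto simp: ennreal_plus[symmetric] ennreal_mult[symmetric] powr_diff field_simps simp del: ennreal_plus)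
  also have "\<dots> \<le> ennreal (q * z powr (q - 1)) * ?H (\<lambda>y. ennreal (f y)) x"
    by (intro mult_left_mono le) auto
  also have "\<dots> = ?H (\<lambda>y. ennreal (q * z powr (q - 1)) * ennreal (f y)) x"
    by (rule heat_semigroup_cmult[symmetric]) measurable
  also have "\<dots> \<le> ?H (\<lambda>y. ennreal (f y powr q) + ennreal ((q - 1) * z powr q)) x"
    using q f z by (intro heat_semigroup_mono)
      (auto simp: ennreal_plus[symmetric] ennreal_mult[symmetric] powr_tangent_le intro!: ennreal_leI simp del: ennreal_plus)
  also have "\<dots> = ?H (\<lambda>y. ennreal (f y powr q)) x + ennreal ((q - 1) * z powr q)"
    by (subst heat_semigroup_add) (auto simp: heat_semigroup_const[OF t])
  finally show ?thesis
    by (simp add: ennreal_add_left_cancel_le add.commute)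
qed

lemma heat_semigroup_le_powr_inverse:
  fixes f :: "'a::euclidean_space \<Rightarrow> real"
  assumes t: "0 < t" and [measurable]: "f \<in> borel_measurable borel" and f: "\<And>y. 0 \<le> f y"
    and z: "0 \<le> z" and q: "1 \<le> q"
    and le: "heat_semigroup \<theta> t (\<lambda>y. ennreal (f y powr q)) x \<le> ennreal z"
  shows "heat_semigroup \<theta> t (\<lambda>y. ennreal (f y)) x \<le> ennreal (z powr (1 / q))"
proof (rule ccontr)
  assume "\<not> ?thesis"
  then have "ennreal (z powr (1 / q)) < heat_semigroup \<theta> t (\<lambda>y. ennreal (f y)) x" by simp
  then obtain c where c: "ennreal (z powr (1 / q)) < c" "c < heat_semigroup \<theta> t (\<lambda>y. ennreal (f y)) x"
    using dense by blast
  then obtain w where w: "ennreal (z powr (1 / q)) < ennreal w"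
      "ennreal w < heat_semigroup \<theta> t (\<lambda>y. ennreal (f y)) x" "0 \<le> w"
    by (cases c) auto
  from w(2,3) have "ennreal (w powr q) \<le> heat_semigroup \<theta> t (\<lambda>y. ennreal (f y powr q)) x"
    by (intro heat_semigroup_Jensen t f q) auto
  also note le
  finally have "w powr q \<le> z" using z by simp
  then have "(w powr q) powr (1 / q) \<le> z powr (1 / q)" using q by (intro powr_mono2) auto
  then show False using w q by (simp add: powr_powr ennreal_less_iff)
qed

text \<open>
  The smoothing estimate in uniformly local spaces. If \<open>|x - y| \<ge> \<rho>\<close>, then \<open>ball y \<rho>\<close> contains a
  ball of radius \<open>\<rho> / 2\<close> all of whose points are at least as close to \<open>x\<close> as \<open>y\<close> is. As the kernel is
  radially decreasing, its value at \<open>x - y\<close> is at most its mean over that ball. Exchanging the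
  integrals then bounds the far part by \<open>ul_norm \<rho> g\<close> times the total mass of the kernel, divided by
  the volume of the small ball. If \<open>|x - y| < \<rho>\<close>, the kernel is bounded by its value at the origin.
\<close>

lemma heat_semigroup_le_ul_norm:
  fixes g :: "'a::euclidean_space \<Rightarrow> real"
  assumes t: "0 < t" and \<rho>: "0 < \<rho>" and g: "g \<in> borel_measurable lebesgue"
  shows "heat_semigroup \<theta> t (\<lambda>y. ennreal \<bar>g y\<bar>) x \<le>
    (inverse (emeasure lborel (ball (0::'a) (\<rho> / 2))) + ennreal (fundamental_solution \<theta> (0::'a) t)) * ul_norm \<rho> g"
proof -
  let ?K = "\<lambda>x::'a. ennreal (fundamental_solution \<theta> x t)"
  define V where "V = emeasure lborel (ball (0::'a) (\<rho> / 2))"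
  have V: "emeasure lborel (ball a (\<rho> / 2)) = V" for a :: 'a
    unfolding V_def using \<rho> by (simp add: emeasure_ball_eq_unit_ball[of "\<rho> / 2"])
  have V0: "V \<noteq> 0" "V \<noteq> \<infinity>"
  proof -
    show "V \<noteq> \<infinity>" using emeasure_lborel_ball_finite[of "0::'a" "\<rho> / 2"] by (simp add: V_def)
    have "0 < measure lborel (ball (0::'a) (\<rho> / 2))" using content_ball_pos[of "\<rho> / 2" "0::'a"] \<rho> by simp
    then show "V \<noteq> 0" by (auto simp: V_def measure_def)
  qed
  obtain g' where [measurable]: "g' \<in> borel_measurable borel" and ae: "AE x in lborel. g x = g' x"
    using completion_ex_borel_measurable_real[OF g] by auto
  define U where "U = ul_norm \<rho> g"
  have U: "(\<integral>\<^sup>+y. ennreal \<bar>g' y\<bar> * indicator (ball z \<rho>) y \<partial>lborel) \<le> U" for z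
  proof -
    have "(\<integral>\<^sup>+y. ennreal \<bar>g' y\<bar> * indicator (ball z \<rho>) y \<partial>lborel) = (\<integral>\<^sup>+y\<in>ball z \<rho>. ennreal \<bar>g y\<bar> \<partial>lebesgue)"
      unfolding nn_integral_completion by (rule nn_integral_cong_AE) (use ae in eventually_elim, auto)
    also have "\<dots> \<le> U" unfolding U_def ul_norm_def by (rule SUP_upper) simp
    finally show ?thesis .
  qed
  have K: "?K (x - y) \<le> inverse V * (\<integral>\<^sup>+z. ?K (x - z) * indicator (ball y \<rho>) z \<partial>lborel) + ?K 0 * indicator (ball x \<rho>) y" for y
  proof (cases "dist x y < \<rho>")
    case True
    have "?K (x - y) \<le> ?K 0" using fundamental_solution_mono[OF \<theta> t, of 0 "x - y"] by (intro ennreal_leI) auto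
    with True show ?thesis by (simp add: add_increasing)
  next
    case False
    define n where "n = norm (x - y)"
    have n: "\<rho> \<le> n" "0 < n" using False \<rho> by (auto simp: n_def dist_norm)
    \<comment> \<open>Move from \<open>y\<close> towards \<open>x\<close> by \<open>\<rho> / 2\<close>.\<close>
    define c where "c = y + (\<rho> / 2 / n) *\<^sub>R (x - y)"
    have yc: "dist y c = \<rho> / 2" using n \<rho> by (simp add: c_def dist_norm n_def[symmetric])
    have "x - c = (1 - \<rho> / 2 / n) *\<^sub>R (x - y)" by (simp add: c_def algebra_simps)
    then have "norm (x - c) = \<bar>1 - \<rho> / 2 / n\<bar> * n" by (simp only: norm_scaleR n_def)
    also have "\<bar>1 - \<rho> / 2 / n\<bar> = 1 - \<rho> / 2 / n" using n \<rho> by (simp add: field_simps)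
    finally have xc: "norm (x - c) = n - \<rho> / 2" using n by (simp add: left_diff_distrib)
    have "?K (x - y) * V = (\<integral>\<^sup>+z. ?K (x - y) * indicator (ball c (\<rho> / 2)) z \<partial>lborel)"
      by (subst nn_integral_cmult_indicator) (simp_all only: V sets_lborel borel_open open_ball)
    also have "\<dots> \<le> (\<integral>\<^sup>+z. ?K (x - z) * indicator (ball y \<rho>) z \<partial>lborel)"
    proof (rule nn_integral_mono)
      fix z
      show "?K (x - y) * indicator (ball c (\<rho> / 2)) z \<le> ?K (x - z) * indicator (ball y \<rho>) z"
      proof (cases "z \<in> ball c (\<rho> / 2)")
        case True
        then have "dist y z < \<rho>" using yc dist_triangle[of y z c] by simp
        moreover have "norm (x - z) \<le> n"
          using xc True norm_triangle_ineq[of "x - c" "c - z"] by (simp add: dist_norm)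
        ultimately show ?thesis
          using True fundamental_solution_mono[OF \<theta> t, of "x - z" "x - y"] by (simp add: n_def ennreal_leI)
      qed simp
    qed
    finally have "inverse V * (?K (x - y) * V) \<le> inverse V * (\<integral>\<^sup>+z. ?K (x - z) * indicator (ball y \<rho>) z \<partial>lborel)"
      by (intro mult_left_mono) auto
    also have "inverse V * (?K (x - y) * V) = (V * inverse V) * ?K (x - y)" by (simp add: mult_ac)
    also have "V * inverse V = 1" using V0 ennreal_divide_self[of V] by (simp add: divide_ennreal_def top.not_eq_extremum)
    finally show ?thesis by (simp add: add_increasing2)
  qed
  have "heat_semigroup \<theta> t (\<lambda>y. ennreal \<bar>g y\<bar>) x = heat_semigroup \<theta> t (\<lambda>y. ennreal \<bar>g' y\<bar>) x"
    by (rule heat_semigroup_cong_AE) (use ae in eventually_elim, simp)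
  also have "\<dots> = (\<integral>\<^sup>+y. ?K (x - y) * ennreal \<bar>g' y\<bar> \<partial>lborel)"
    unfolding heat_semigroup_lborel ..
  also have "\<dots> \<le> (\<integral>\<^sup>+y. inverse V * (\<integral>\<^sup>+z. ?K (x - z) * indicator (ball y \<rho>) z * ennreal \<bar>g' y\<bar> \<partial>lborel)
      + ?K 0 * (ennreal \<bar>g' y\<bar> * indicator (ball x \<rho>) y) \<partial>lborel)"
  proof (rule nn_integral_mono)
    fix y
    have "?K (x - y) * ennreal \<bar>g' y\<bar> \<le> (inverse V * (\<integral>\<^sup>+z. ?K (x - z) * indicator (ball y \<rho>) z \<partial>lborel) + ?K 0 * indicator (ball x \<rho>) y) * ennreal \<bar>g' y\<bar>"
      by (intro mult_right_mono K) auto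
    also have "\<dots> = inverse V * (\<integral>\<^sup>+z. ?K (x - z) * indicator (ball y \<rho>) z * ennreal \<bar>g' y\<bar> \<partial>lborel)
      + ?K 0 * (ennreal \<bar>g' y\<bar> * indicator (ball x \<rho>) y)"
      by (subst nn_integral_multc) (auto simp: algebra_simps intro!: borel_measurable_times_ennreal borel_measurable_indicator)
    finally show "?K (x - y) * ennreal \<bar>g' y\<bar> \<le> \<dots>" .
  qed
  also have "\<dots> = inverse V * (\<integral>\<^sup>+y. \<integral>\<^sup>+z. ?K (x - z) * indicator (ball y \<rho>) z * ennreal \<bar>g' y\<bar> \<partial>lborel \<partial>lborel)
      + ?K 0 * (\<integral>\<^sup>+y. ennreal \<bar>g' y\<bar> * indicator (ball x \<rho>) y \<partial>lborel)"
    unfolding indicator_def mem_ball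
    by (subst nn_integral_add) (auto simp: nn_integral_cmult)
  also have "(\<integral>\<^sup>+y. \<integral>\<^sup>+z. ?K (x - z) * indicator (ball y \<rho>) z * ennreal \<bar>g' y\<bar> \<partial>lborel \<partial>lborel) =
      (\<integral>\<^sup>+z. \<integral>\<^sup>+y. ?K (x - z) * indicator (ball y \<rho>) z * ennreal \<bar>g' y\<bar> \<partial>lborel \<partial>lborel)"
    unfolding indicator_def mem_ball by (rule lborel_pair.Fubini'[symmetric]) measurable
  also have "\<dots> = (\<integral>\<^sup>+z. ?K (x - z) * (\<integral>\<^sup>+y. ennreal \<bar>g' y\<bar> * indicator (ball z \<rho>) y \<partial>lborel) \<partial>lborel)"
  proof (rule nn_integral_cong)
    fix z
    have "(\<integral>\<^sup>+y. ?K (x - z) * indicator (ball y \<rho>) z * ennreal \<bar>g' y\<bar> \<partial>lborel) =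
        (\<integral>\<^sup>+y. ?K (x - z) * (ennreal \<bar>g' y\<bar> * indicator (ball z \<rho>) y) \<partial>lborel)"
      by (intro nn_integral_cong) (auto simp: indicator_def dist_commute)
    also have "\<dots> = ?K (x - z) * (\<integral>\<^sup>+y. ennreal \<bar>g' y\<bar> * indicator (ball z \<rho>) y \<partial>lborel)"
      by (rule nn_integral_cmult) (auto intro!: borel_measurable_times_ennreal borel_measurable_indicator)
    finally show "(\<integral>\<^sup>+y. ?K (x - z) * indicator (ball y \<rho>) z * ennreal \<bar>g' y\<bar> \<partial>lborel) = \<dots>" .
  qed
  also have "\<dots> \<le> (\<integral>\<^sup>+z. ?K (x - z) * U \<partial>lborel)"
    by (intro nn_integral_mono mult_left_mono U) auto
  also have "\<dots> = U"
    by (subst nn_integral_multc) (auto simp: nn_integral_fundamental_solution_diff[OF t])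
  finally have "heat_semigroup \<theta> t (\<lambda>y. ennreal \<bar>g y\<bar>) x \<le> inverse V * U + ?K 0 * (\<integral>\<^sup>+y. ennreal \<bar>g' y\<bar> * indicator (ball x \<rho>) y \<partial>lborel)"
    by (simp add: add_right_mono mult_left_mono)
  also have "\<dots> \<le> inverse V * U + ?K 0 * U"
    by (intro add_left_mono mult_left_mono U) auto
  finally show ?thesis by (simp add: V_def U_def distrib_right)
qed

end

section \<open>Supersolutions yield solutions\<close>

text \<open>
  The right-hand side of the integral equation. The time integral is taken with respect to Lebesgue
  measure on the Borel sets; a nonnegative integral does not change under completion of the measure,
  whatever the integrand, and this form suits joint measurability.
\<close>

definition duhamel ::
  "real \<Rightarrow> real \<Rightarrow> ('a::euclidean_space \<Rightarrow> real) \<Rightarrow> ('a \<Rightarrow> real \<Rightarrow> real) \<Rightarrow> 'a \<Rightarrow> real \<Rightarrow> ennreal" where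
  "duhamel \<theta> p \<phi> u x t = heat_semigroup \<theta> t (\<lambda>y. ennreal (\<phi> y)) x +
     (\<integral>\<^sup>+s\<in>{0<..<t}. heat_semigroup \<theta> (t - s) (\<lambda>y. ennreal (u y s powr p)) x \<partial>lborel)"

lemma integral_solution_iff_duhamel:
  "integral_solution \<theta> p \<phi> T u \<longleftrightarrow>
     (\<lambda>(x, t). u x t) \<in> borel_measurable (lebesgue_on (UNIV \<times> {0<..<T})) \<and>
     (\<forall>x. \<forall>t\<in>{0<..<T}. 0 \<le> u x t) \<and>
     (\<forall>t\<in>{0<..<T}. AE x in lborel. ennreal (u x t) = duhamel \<theta> p \<phi> u x t)"
  unfolding integral_solution_def duhamel_def nn_integral_completion AE_completion_iff ..

lemma borel_measurable_duhamel:
  fixes \<phi> :: "'a::euclidean_space \<Rightarrow> real"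
  assumes [measurable]: "\<phi> \<in> borel_measurable borel"
    "(\<lambda>(x, t). u x t) \<in> borel_measurable (borel \<Otimes>\<^sub>M borel)"
  shows "(\<lambda>(x, t). duhamel \<theta> p \<phi> u x t) \<in> borel_measurable (borel \<Otimes>\<^sub>M borel)"
  unfolding duhamel_def indicator_def greaterThanLessThan_iff by measurable

lemma duhamel_mono:
  assumes p: "0 \<le> p" and u: "\<And>y s. 0 < s \<Longrightarrow> s < t \<Longrightarrow> 0 \<le> u y s \<and> u y s \<le> v y s"
  shows "duhamel \<theta> p \<phi> u x t \<le> duhamel \<theta> p \<phi> v x t"
  unfolding duhamel_def
proof (intro add_left_mono nn_integral_mono)
  fix s
  show "heat_semigroup \<theta> (t - s) (\<lambda>y. ennreal (u y s powr p)) x * indicator {0<..<t} s \<le>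
      heat_semigroup \<theta> (t - s) (\<lambda>y. ennreal (v y s powr p)) x * indicator {0<..<t} s"
    using u p by (auto simp: indicator_def intro!: heat_semigroup_mono ennreal_leI powr_mono2)
qed

lemma duhamel_SUP:
  fixes u :: "nat \<Rightarrow> 'a::euclidean_space \<Rightarrow> real \<Rightarrow> real"
  assumes [measurable]: "\<And>n. (\<lambda>(x, t). u n x t) \<in> borel_measurable (borel \<Otimes>\<^sub>M borel)" and p: "0 < p"
    and inc: "\<And>n y s. 0 < s \<Longrightarrow> s < t \<Longrightarrow> 0 \<le> u n y s \<and> u n y s \<le> u (Suc n) y s"
    and lim: "\<And>y s. 0 < s \<Longrightarrow> s < t \<Longrightarrow> (\<lambda>n. u n y s) \<longlonglongrightarrow> v y s"
  shows "duhamel \<theta> p \<phi> v x t = (SUP n. duhamel \<theta> p \<phi> (u n) x t)"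
proof -
  let ?H = "\<lambda>u s. heat_semigroup \<theta> (t - s) (\<lambda>y. ennreal (u y s powr p)) x * indicator {0<..<t} s"
  have step: "ennreal (u n y s powr p) \<le> ennreal (u (Suc n) y s powr p)" if "0 < s" "s < t" for n y s
    using inc[OF that] p by (intro ennreal_leI powr_mono2) auto
  have H: "?H v s = (SUP n. ?H (u n) s)" for s
  proof (cases "s \<in> {0<..<t}")
    case True
    have sup: "(SUP n. ennreal (u n y s powr p)) = ennreal (v y s powr p)" for y
    proof (rule SUP_Lim)
      show "incseq (\<lambda>n. ennreal (u n y s powr p))"
        using step True by (intro incseq_SucI) auto
      show "(\<lambda>n. ennreal (u n y s powr p)) \<longlonglongrightarrow> ennreal (v y s powr p)"
        using True p inc by (intro tendsto_ennrealI tendsto_powr2 lim tendsto_const) auto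
    qed
    have "heat_semigroup \<theta> (t - s) (\<lambda>y. SUP n. ennreal (u n y s powr p)) x =
        (SUP n. heat_semigroup \<theta> (t - s) (\<lambda>y. ennreal (u n y s powr p)) x)"
      using True step by (intro heat_semigroup_SUP) auto
    then show ?thesis using True by (simp add: sup)
  qed simp
  have "(\<integral>\<^sup>+s. ?H v s \<partial>lborel) = (SUP n. \<integral>\<^sup>+s. ?H (u n) s \<partial>lborel)"
    unfolding H
  proof (rule nn_integral_monotone_convergence_SUP)
    show "incseq (\<lambda>n. ?H (u n))"
      using step by (intro incseq_SucI le_funI) (auto simp: indicator_def intro!: heat_semigroup_mono)
    show "?H (u n) \<in> borel_measurable lborel" for n by measurable
  qed
  then show ?thesis
    unfolding duhamel_def by (simp add: ennreal_SUP_add_right)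
qed

text \<open>
  Monotone iteration from \<open>0\<close>. The iterates increase and stay below \<open>v\<close>, hence converge to a finite
  limit, and monotone convergence carries the recursion over to the limit. The inequality for \<open>v\<close> is
  required at every point, so the limit solves the equation at every point.
\<close>

lemma has_local_solution_if_supersolution:
  fixes \<phi> :: "'a::euclidean_space \<Rightarrow> real" and v :: "'a \<Rightarrow> real \<Rightarrow> real"
  assumes [measurable]: "\<phi> \<in> borel_measurable borel" and p: "0 < p" and T: "0 < T"
    and v: "\<And>x t. 0 < t \<Longrightarrow> t < T \<Longrightarrow> 0 \<le> v x t \<and> duhamel \<theta> p \<phi> v x t \<le> ennreal (v x t)"
  shows "has_local_solution \<theta> p \<phi>"
proof -
  \<comment> \<open>Real values are obtained by sending an infinite right-hand side to \<open>0\<close>, which can happen only outside \<open>(0, T)\<close>.\<close>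
  define u where "u = rec_nat (\<lambda>x t. 0) (\<lambda>_ u x t. enn2real (duhamel \<theta> p \<phi> u x t))"
  have u_0: "u 0 = (\<lambda>x t. 0)" and u_Suc: "u (Suc n) = (\<lambda>x t. enn2real (duhamel \<theta> p \<phi> (u n) x t))" for n
    by (simp_all add: u_def)
  have [measurable]: "(\<lambda>(x, t). u n x t) \<in> borel_measurable (borel \<Otimes>\<^sub>M borel)" for n
  proof (induction n)
    case (Suc n)
    note [measurable] = borel_measurable_duhamel[OF assms(1) Suc, of \<theta> p]
    show ?case unfolding u_Suc by measurable
  qed (simp add: u_0)
  have nn: "0 \<le> u n x t" for n x t
    by (cases n) (auto simp: u_0 u_Suc)
  have le_v: "u n x t \<le> v x t" if "0 < t" "t < T" for n x t
    using that
  proof (induction n arbitrary: x t)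
    case (Suc n)
    have "duhamel \<theta> p \<phi> (u n) x t \<le> duhamel \<theta> p \<phi> v x t"
      using Suc p nn by (intro duhamel_mono) auto
    also have "\<dots> \<le> ennreal (v x t)" using v Suc by simp
    finally show ?case using v Suc by (simp add: u_Suc enn2real_leI)
  qed (use v in \<open>auto simp: u_0\<close>)
  have u_eq: "ennreal (u (Suc n) x t) = duhamel \<theta> p \<phi> (u n) x t" if "0 < t" "t < T" for n x t
  proof -
    have "duhamel \<theta> p \<phi> (u n) x t \<le> duhamel \<theta> p \<phi> v x t"
      using that p nn le_v by (intro duhamel_mono) auto
    also have "\<dots> \<le> ennreal (v x t)" using v that by simp
    also have "\<dots> < \<infinity>" by simp
    finally show ?thesis by (simp add: u_Suc)
  qed
  have mono: "u n x t \<le> u (Suc n) x t" if "0 < t" "t < T" for n x t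
    using that
  proof (induction n arbitrary: x t)
    case 0
    show ?case using nn by (simp add: u_0)
  next
    case (Suc n)
    have "ennreal (u (Suc n) x t) \<le> ennreal (u (Suc (Suc n)) x t)"
      unfolding u_eq[OF Suc.prems] using Suc p nn by (intro duhamel_mono) auto
    then show ?case using nn by (simp add: ennreal_le_iff)
  qed
  define U where "U x t = (SUP n. ennreal (u n x t))" for x t
  define w where "w x t = enn2real (U x t)" for x t
  have [measurable]: "(\<lambda>(x, t). w x t) \<in> borel_measurable (borel \<Otimes>\<^sub>M borel)"
    unfolding w_def U_def by measurable
  have U_w: "U x t = ennreal (w x t)" if "0 < t" "t < T" for x t
  proof -
    have "U x t \<le> ennreal (v x t)"
      unfolding U_def by (intro SUP_least ennreal_leI le_v that)
    also have "\<dots> < \<infinity>" by simp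
    finally show ?thesis by (simp add: w_def)
  qed
  have lim: "(\<lambda>n. u n x t) \<longlonglongrightarrow> w x t" if "0 < t" "t < T" for x t
  proof -
    have "incseq (\<lambda>n. ennreal (u n x t))"
      using mono[OF that] by (intro incseq_SucI ennreal_leI)
    from LIMSEQ_SUP[OF this] have "(\<lambda>n. ennreal (u n x t)) \<longlonglongrightarrow> ennreal (w x t)"
      unfolding U_def[symmetric] U_w[OF that] .
    then show ?thesis using nn by (subst (asm) tendsto_ennreal_iff) (auto simp: w_def)
  qed
  have eq: "ennreal (w x t) = duhamel \<theta> p \<phi> w x t" if t: "0 < t" "t < T" for x t
  proof -
    have "duhamel \<theta> p \<phi> w x t = (SUP n. duhamel \<theta> p \<phi> (u n) x t)"
      using t p nn mono lim by (intro duhamel_SUP) auto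
    also have "\<dots> = (SUP n. ennreal (u (Suc n) x t))"
      by (simp only: u_eq[OF t])
    also have "\<dots> = ennreal (w x t)"
    proof (rule SUP_Lim)
      show "incseq (\<lambda>n. ennreal (u (Suc n) x t))"
        using mono[OF t] by (intro incseq_SucI ennreal_leI)
      show "(\<lambda>n. ennreal (u (Suc n) x t)) \<longlonglongrightarrow> ennreal (w x t)"
        by (intro tendsto_ennrealI LIMSEQ_Suc lim t)
    qed
    finally show ?thesis ..
  qed
  have "(\<lambda>(x, t). w x t) \<in> borel_measurable lborel"
    by (simp add: borel_prod[symmetric])
  then have "(\<lambda>(x, t). w x t) \<in> borel_measurable (lebesgue_on (UNIV \<times> {0<..<T}))"
    by (intro measurable_restrict_space1 measurable_completion)
  moreover have "0 \<le> w x t" for x t by (simp add: w_def)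
  ultimately have "integral_solution \<theta> p \<phi> T w"
    unfolding integral_solution_iff_duhamel using eq by auto
  then show ?thesis using T by (auto simp: has_local_solution_def)
qed

lemma has_local_solution_cong_AE:
  assumes "AE x in lborel. \<phi> x = \<phi>' x"
  shows "has_local_solution \<theta> p \<phi> \<longleftrightarrow> has_local_solution \<theta> p \<phi>'"
proof -
  have "heat_semigroup \<theta> t (\<lambda>y. ennreal (\<phi> y)) x = heat_semigroup \<theta> t (\<lambda>y. ennreal (\<phi>' y)) x" for t x
    by (rule heat_semigroup_cong_AE) (use assms in eventually_elim, simp)
  then show ?thesis by (simp add: has_local_solution_def integral_solution_def)
qed

section \<open>Two existence criteria\<close>

lemma nn_integral_powr_from_0:
  fixes a t :: real
  assumes a: "- 1 < a" and t: "0 < t"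
  shows "(\<integral>\<^sup>+s\<in>{0<..<t}. ennreal (s powr a) \<partial>lborel) = ennreal (t powr (a + 1) / (a + 1))"
proof -
  have "AE s in lborel. ennreal (s powr a) * indicator {0<..<t} s = ennreal (if s \<in> {0..t} then s powr a else 0)"
    using AE_lborel_singleton[of t] by eventually_elim (auto simp: indicator_def)
  then have "(\<integral>\<^sup>+s\<in>{0<..<t}. ennreal (s powr a) \<partial>lborel) =
      (\<integral>\<^sup>+s. ennreal (if s \<in> {0..t} then s powr a else 0) \<partial>lborel)"
    by (rule nn_integral_cong_AE)
  also have "\<dots> = ennreal (t powr (a + 1) / (a + 1))"
  proof (rule nn_integral_has_integral_lborel)
    show "((\<lambda>s. if s \<in> {0..t} then s powr a else 0) has_integral t powr (a + 1) / (a + 1)) UNIV"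
      using has_integral_powr_from_0[OF a] t by (subst has_integral_restrict_UNIV) auto
  qed auto
  finally show ?thesis .
qed

lemma nn_integral_const_powr_from_0:
  fixes a t c :: real
  assumes a: "- 1 < a" and t: "0 < t" and c: "0 \<le> c"
  shows "(\<integral>\<^sup>+s\<in>{0<..<t}. ennreal (c * s powr a) \<partial>lborel) = ennreal (c * (t powr (a + 1) / (a + 1)))"
proof -
  have "(\<integral>\<^sup>+s\<in>{0<..<t}. ennreal (c * s powr a) \<partial>lborel) =
      (\<integral>\<^sup>+s. ennreal c * (ennreal (s powr a) * indicator {0<..<t} s) \<partial>lborel)"
    using c by (simp add: ennreal_mult mult_ac)
  also have "\<dots> = ennreal c * (\<integral>\<^sup>+s\<in>{0<..<t}. ennreal (s powr a) \<partial>lborel)"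
    by (rule nn_integral_cmult) auto
  finally show ?thesis
    using a c by (simp add: nn_integral_powr_from_0[OF a t] ennreal_mult[symmetric])
qed

lemma integral_le_const_mult:
  assumes le: "\<And>s::real. 0 < s \<Longrightarrow> s < t \<Longrightarrow> F s \<le> ennreal (z * c s)"
    and z: "0 \<le> z" and c: "\<And>s. 0 < s \<Longrightarrow> s < t \<Longrightarrow> 0 \<le> c s" and [measurable]: "c \<in> borel_measurable borel"
  shows "(\<integral>\<^sup>+s\<in>{0<..<t}. F s \<partial>lborel) \<le> ennreal z * (\<integral>\<^sup>+s\<in>{0<..<t}. ennreal (c s) \<partial>lborel)"
proof -
  have "(\<integral>\<^sup>+s\<in>{0<..<t}. F s \<partial>lborel) \<le> (\<integral>\<^sup>+s. ennreal z * (ennreal (c s) * indicator {0<..<t} s) \<partial>lborel)"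
    using le z c by (intro nn_integral_mono) (auto simp: indicator_def ennreal_mult)
  also have "\<dots> = ennreal z * (\<integral>\<^sup>+s\<in>{0<..<t}. ennreal (c s) \<partial>lborel)"
    by (rule nn_integral_cmult) auto
  finally show ?thesis .
qed

text \<open>
  The supersolution for both existence criteria is \<open>2 w\<close>, where \<open>w(t) = (S(t)[\<phi>\<^sup>\<beta>])\<^bsup>1/\<beta>\<^esup>\<close>. By Jensen's
  inequality \<open>S(t)\<phi> \<le> w(t)\<close> and \<open>S(t - s)[w(s)] \<le> w(t)\<close>, whereas \<open>W = w\<^sup>\<beta>\<close> satisfies
  \<open>S(t - s)[W(s)] = W(t)\<close>. The function \<open>M\<close> is a bound for the supremum of \<open>W(s)\<close>.
\<close>

locale heat_power_datum =
  fixes \<theta> p \<beta> T :: real and \<phi> :: "'a::euclidean_space \<Rightarrow> real" and M :: "real \<Rightarrow> real"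
  assumes \<theta>: "0 < \<theta>" "\<theta> \<le> 2" and p: "1 < p" and \<beta>: "1 \<le> \<beta>" and T: "0 < T"
    and \<phi> [measurable]: "\<phi> \<in> borel_measurable borel" and \<phi>_nonneg: "\<And>x. 0 \<le> \<phi> x"
    and M_nonneg: "\<And>s. 0 < s \<Longrightarrow> s < T \<Longrightarrow> 0 \<le> M s"
    and heat_le_M: "\<And>s x. 0 < s \<Longrightarrow> s < T \<Longrightarrow> heat_semigroup \<theta> s (\<lambda>y. ennreal (\<phi> y powr \<beta>)) x \<le> ennreal (M s)"
begin

definition W :: "real \<Rightarrow> 'a \<Rightarrow> real" where
  "W s x = enn2real (heat_semigroup \<theta> s (\<lambda>y. ennreal (\<phi> y powr \<beta>)) x)"

definition w :: "'a \<Rightarrow> real \<Rightarrow> real" where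
  "w x s = W s x powr (1 / \<beta>)"

lemma W_measurable [measurable]: "W s \<in> borel_measurable borel"
  unfolding W_def[abs_def] by measurable

lemma w_measurable [measurable]: "(\<lambda>x. w x s) \<in> borel_measurable borel"
  unfolding w_def by measurable

lemma W_nonneg: "0 \<le> W s x" and w_nonneg: "0 \<le> w x s"
  by (simp_all add: W_def w_def)

lemma w_powr: "w x s powr \<beta> = W s x"
  using \<beta> W_nonneg by (simp add: w_def powr_powr)

lemma W_eq: "0 < s \<Longrightarrow> s < T \<Longrightarrow> ennreal (W s x) = heat_semigroup \<theta> s (\<lambda>y. ennreal (\<phi> y powr \<beta>)) x"
  using heat_le_M[of s x] by (simp add: W_def le_less_trans[OF _ ennreal_less_top])

lemma W_le: "0 < s \<Longrightarrow> s < T \<Longrightarrow> W s x \<le> M s"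
  using heat_le_M[of s x] M_nonneg[of s] by (simp add: W_def enn2real_leI)

lemma heat_W: "0 < s \<Longrightarrow> s < t \<Longrightarrow> t < T \<Longrightarrow> heat_semigroup \<theta> (t - s) (\<lambda>y. ennreal (W s y)) x = ennreal (W t x)"
  using heat_semigroup_compose[OF \<theta>, of "t - s" s "\<lambda>y. ennreal (\<phi> y powr \<beta>)" x]
  by (simp add: W_eq)

lemma heat_w: "0 < s \<Longrightarrow> s < t \<Longrightarrow> t < T \<Longrightarrow> heat_semigroup \<theta> (t - s) (\<lambda>y. ennreal (w y s)) x \<le> ennreal (w x t)"
  unfolding w_def[of x t]
  using heat_W[of s t x] \<beta> w_nonneg W_nonneg
  by (intro heat_semigroup_le_powr_inverse[OF \<theta>]) (auto simp: w_powr)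

text \<open>
  One of the two copies of \<open>w\<close> in the supersolution absorbs \<open>S(t)\<phi>\<close>, the other one the nonlinear term.
\<close>

lemma has_local_solution_if_integral_le:
  assumes int: "\<And>x t. 0 < t \<Longrightarrow> t < T \<Longrightarrow>
    (\<integral>\<^sup>+s\<in>{0<..<t}. heat_semigroup \<theta> (t - s) (\<lambda>y. ennreal ((2 * w y s) powr p)) x \<partial>lborel) \<le> ennreal (w x t)"
  shows "has_local_solution \<theta> p \<phi>"
proof (rule has_local_solution_if_supersolution)
  fix x t assume t: "0 < t" "t < T"
  have "heat_semigroup \<theta> t (\<lambda>y. ennreal (\<phi> y)) x \<le> ennreal (w x t)"
    unfolding w_def using W_eq[OF t, of x] \<beta> \<phi>_nonneg W_nonneg t
    by (intro heat_semigroup_le_powr_inverse[OF \<theta>]) auto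
  then have "duhamel \<theta> p \<phi> (\<lambda>x t. 2 * w x t) x t \<le> ennreal (w x t) + ennreal (w x t)"
    unfolding duhamel_def using int[OF t] by (intro add_mono)
  also have "\<dots> = ennreal (2 * w x t)"
    using w_nonneg by (simp add: ennreal_plus[symmetric] del: ennreal_plus)
  finally show "0 \<le> 2 * w x t \<and> duhamel \<theta> p \<phi> (\<lambda>x t. 2 * w x t) x t \<le> ennreal (2 * w x t)"
    using w_nonneg by simp
qed (use p T in auto)

lemma heat_const_mult_le:
  assumes t: "0 < s" "s < t" "t < T" and c: "0 \<le> c" and [measurable]: "f \<in> borel_measurable borel"
    and le: "\<And>y. (2 * w y s) powr p \<le> c * f y" and f: "\<And>y. 0 \<le> f y"
    and heat: "heat_semigroup \<theta> (t - s) (\<lambda>y. ennreal (f y)) x \<le> ennreal z" and z: "0 \<le> z"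
  shows "heat_semigroup \<theta> (t - s) (\<lambda>y. ennreal ((2 * w y s) powr p)) x \<le> ennreal (z * c)"
proof -
  have "heat_semigroup \<theta> (t - s) (\<lambda>y. ennreal ((2 * w y s) powr p)) x \<le>
      heat_semigroup \<theta> (t - s) (\<lambda>y. ennreal c * ennreal (f y)) x"
    using le c f by (intro heat_semigroup_mono) (auto simp: ennreal_mult[symmetric] intro!: ennreal_leI)
  also have "\<dots> = ennreal c * heat_semigroup \<theta> (t - s) (\<lambda>y. ennreal (f y)) x"
    by (rule heat_semigroup_cmult) measurable
  also have "\<dots> \<le> ennreal c * ennreal z"
    by (intro mult_left_mono heat) auto
  finally show ?thesis using c z by (simp add: ennreal_mult[symmetric] mult.commute)
qed

end

text \<open>
  Split \<open>w\<^sup>p = w\<^bsup>p-1\<^esup> w\<close>, estimate the first factor by its supremum and use \<open>S(t - s)[w(s)] \<le> w(t)\<close>. The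
  nonlinear term is at most \<open>w(t)\<close> times the integral of \<open>s \<mapsto> D s\<^sup>a\<close> with \<open>a = - \<gamma> (p - 1) / \<beta> > - 1\<close>. This
  integral converges, and is small for small \<open>t\<close>.
\<close>

lemma has_local_solution_subcritical:
  fixes \<phi> :: "'a::euclidean_space \<Rightarrow> real"
  assumes \<theta>: "0 < \<theta>" "\<theta> \<le> 2" and p: "1 < p" and \<beta>: "1 \<le> \<beta>" and T: "0 < T"
    and \<phi>: "\<phi> \<in> borel_measurable borel" "\<And>x. 0 \<le> \<phi> x"
    and C: "0 \<le> C" and \<gamma>: "\<gamma> * (p - 1) < \<beta>"
    and heat: "\<And>s x. 0 < s \<Longrightarrow> s < T \<Longrightarrow> heat_semigroup \<theta> s (\<lambda>y. ennreal (\<phi> y powr \<beta>)) x \<le> ennreal (C * s powr (- \<gamma>))"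
  shows "has_local_solution \<theta> p \<phi>"
proof -
  define a where "a = - \<gamma> * ((p - 1) / \<beta>)"
  have a: "- 1 < a" using \<gamma> \<beta> by (simp add: a_def field_simps)
  define D where "D = 2 powr p * C powr ((p - 1) / \<beta>)"
  have D: "0 \<le> D" by (simp add: D_def)
  have "((\<lambda>t. D * (t powr (a + 1) / (a + 1))) \<longlongrightarrow> D * (0 powr (a + 1) / (a + 1))) (at_right 0)"
    using a by (intro tendsto_intros tendsto_powr2) (auto simp: eventually_at_right_less intro: eventually_mono[OF eventually_at_right_less])
  then have "eventually (\<lambda>t. D * (t powr (a + 1) / (a + 1)) < 1) (at_right 0)"
    by (rule order_tendstoD) simp
  with eventually_at_right_less have "eventually (\<lambda>t. 0 < t \<and> D * (t powr (a + 1) / (a + 1)) < 1) (at_right (0::real))"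
    by eventually_elim simp
  then obtain b where b: "0 < b" "\<And>t. 0 < t \<Longrightarrow> t < b \<Longrightarrow> D * (t powr (a + 1) / (a + 1)) < 1"
    unfolding eventually_at_right_field by auto
  interpret heat_power_datum \<theta> p \<beta> "min T b" \<phi> "\<lambda>s. C * s powr (- \<gamma>)"
    using assms b by unfold_locales auto
  show ?thesis
  proof (rule has_local_solution_if_integral_le)
    fix x t assume t: "0 < t" "t < min T b"
    have "(\<integral>\<^sup>+s\<in>{0<..<t}. heat_semigroup \<theta> (t - s) (\<lambda>y. ennreal ((2 * w y s) powr p)) x \<partial>lborel)
       \<le> ennreal (w x t) * (\<integral>\<^sup>+s\<in>{0<..<t}. ennreal (D * s powr a) \<partial>lborel)"
    proof (rule integral_le_const_mult)
      fix s assume s: "0 < s" "s < t"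
      show "heat_semigroup \<theta> (t - s) (\<lambda>y. ennreal ((2 * w y s) powr p)) x \<le> ennreal (w x t * (D * s powr a))"
      proof (rule heat_const_mult_le)
        fix y
        have "w y s powr (p - 1) = W s y powr ((p - 1) / \<beta>)"
          by (simp add: w_def powr_powr)
        also have "\<dots> \<le> (C * s powr (- \<gamma>)) powr ((p - 1) / \<beta>)"
          using s t p \<beta> by (intro powr_mono2 W_le W_nonneg) auto
        also have "\<dots> = C powr ((p - 1) / \<beta>) * s powr a"
          using C by (simp add: powr_mult powr_powr a_def)
        finally have *: "w y s powr (p - 1) \<le> C powr ((p - 1) / \<beta>) * s powr a" .
        have "(2 * w y s) powr p = 2 powr p * (w y s powr (p - 1) * w y s)"
          using w_nonneg[of y s] p by (cases "w y s = 0") (auto simp: powr_mult powr_diff)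
        also have "\<dots> \<le> 2 powr p * (C powr ((p - 1) / \<beta>) * s powr a * w y s)"
          using * w_nonneg by (intro mult_left_mono mult_right_mono) auto
        finally show "(2 * w y s) powr p \<le> D * s powr a * w y s"
          by (simp add: D_def mult_ac)
      qed (use s t D w_nonneg heat_w in auto)
    qed (use D w_nonneg in auto)
    also have "\<dots> = ennreal (w x t) * ennreal (D * (t powr (a + 1) / (a + 1)))"
      using t by (subst nn_integral_const_powr_from_0[OF a _ D]) auto
    also have "\<dots> \<le> ennreal (w x t) * ennreal 1"
      using b(2)[of t] t by (intro mult_left_mono ennreal_leI) auto
    finally show "(\<integral>\<^sup>+s\<in>{0<..<t}. heat_semigroup \<theta> (t - s) (\<lambda>y. ennreal ((2 * w y s) powr p)) x \<partial>lborel) \<le> ennreal (w x t)"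
      by simp
  qed
qed

text \<open>
  At the scale-invariant rate \<open>w(s) \<le> \<epsilon> s\<^bsup>-1/(p-1)\<^esup>\<close> the splitting of the subcritical case leads to the
  divergent integral of \<open>1 / s\<close>. Instead split \<open>w\<^sup>p = w\<^bsup>p-\<beta>\<^esup> W\<close> and use \<open>S(t - s)[W(s)] = W(t)\<close>: as \<open>\<beta> > 1\<close>,
  the integral of \<open>s\<^bsup>-(p-\<beta>)/(p-1)\<^esup>\<close> over \<open>(0, t)\<close> converges, to a multiple of \<open>t\<^bsup>(\<beta>-1)/(p-1)\<^esup>\<close>. This power is
  cancelled by \<open>W(t) = w(t) w(t)\<^bsup>\<beta>-1\<^esup> \<le> w(t) (\<epsilon> t\<^bsup>-1/(p-1)\<^esup>)\<^bsup>\<beta>-1\<^esup>\<close>, and the constant left over is small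
  because \<open>\<epsilon>\<close> is.
\<close>

lemma has_local_solution_critical:
  fixes \<phi> :: "'a::euclidean_space \<Rightarrow> real"
  assumes \<theta>: "0 < \<theta>" "\<theta> \<le> 2" and p: "1 < p" and \<beta>: "1 < \<beta>" "\<beta> \<le> p" and T: "0 < T"
    and \<phi>: "\<phi> \<in> borel_measurable borel" "\<And>x. 0 \<le> \<phi> x"
    and \<epsilon>: "0 \<le> \<epsilon>" "2 powr p * \<epsilon> powr (p - 1) * ((p - 1) / (\<beta> - 1)) \<le> 1"
    and heat: "\<And>s x. 0 < s \<Longrightarrow> s < T \<Longrightarrow>
      heat_semigroup \<theta> s (\<lambda>y. ennreal (\<phi> y powr \<beta>)) x \<le> ennreal ((\<epsilon> * s powr (- 1 / (p - 1))) powr \<beta>)"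
  shows "has_local_solution \<theta> p \<phi>"
proof -
  interpret heat_power_datum \<theta> p \<beta> T \<phi> "\<lambda>s. (\<epsilon> * s powr (- 1 / (p - 1))) powr \<beta>"
    using assms by unfold_locales auto
  note \<beta> = \<open>1 < \<beta>\<close> \<open>\<beta> \<le> p\<close>
  define a where "a = (- 1 / (p - 1)) * (p - \<beta>)"
  have a1: "a + 1 = (\<beta> - 1) / (p - 1)" using p by (simp add: a_def field_simps)
  have a: "- 1 < a"
  proof -
    have "0 < a + 1" unfolding a1 using p \<beta> by simp
    then show ?thesis by simp
  qed
  define D where "D = 2 powr p * \<epsilon> powr (p - \<beta>)"
  have D: "0 \<le> D" by (simp add: D_def)
  have w_le: "w y s \<le> \<epsilon> * s powr (- 1 / (p - 1))" if "0 < s" "s < T" for y s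
  proof -
    have "w y s \<le> ((\<epsilon> * s powr (- 1 / (p - 1))) powr \<beta>) powr (1 / \<beta>)"
      unfolding w_def using that \<beta> by (intro powr_mono2 W_le W_nonneg) auto
    then show ?thesis using \<beta> \<epsilon> by (simp add: powr_powr)
  qed
  show ?thesis
  proof (rule has_local_solution_if_integral_le)
    fix x t assume t: "0 < t" "t < T"
    have "(\<integral>\<^sup>+s\<in>{0<..<t}. heat_semigroup \<theta> (t - s) (\<lambda>y. ennreal ((2 * w y s) powr p)) x \<partial>lborel)
       \<le> ennreal (W t x) * (\<integral>\<^sup>+s\<in>{0<..<t}. ennreal (D * s powr a) \<partial>lborel)"
    proof (rule integral_le_const_mult)
      fix s assume s: "0 < s" "s < t"
      show "heat_semigroup \<theta> (t - s) (\<lambda>y. ennreal ((2 * w y s) powr p)) x \<le> ennreal (W t x * (D * s powr a))"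
      proof (rule heat_const_mult_le)
        fix y
        have "w y s powr (p - \<beta>) \<le> (\<epsilon> * s powr (- 1 / (p - 1))) powr (p - \<beta>)"
          using s t \<beta> w_nonneg by (intro powr_mono2 w_le) auto
        also have "\<dots> = \<epsilon> powr (p - \<beta>) * s powr a"
          using \<epsilon> by (simp add: powr_mult powr_powr a_def)
        finally have *: "w y s powr (p - \<beta>) \<le> \<epsilon> powr (p - \<beta>) * s powr a" .
        have "(2 * w y s) powr p = 2 powr p * (w y s powr (p - \<beta>) * w y s powr \<beta>)"
          using w_nonneg[of y s] by (simp add: powr_mult powr_add[symmetric])
        also have "\<dots> \<le> 2 powr p * (\<epsilon> powr (p - \<beta>) * s powr a * w y s powr \<beta>)"
          using * by (intro mult_left_mono mult_right_mono) auto
        finally show "(2 * w y s) powr p \<le> D * s powr a * W s y"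
          by (simp add: D_def mult_ac w_powr)
      qed (use s t D W_nonneg heat_W in auto)
    qed (use D W_nonneg in auto)
    also have "\<dots> = ennreal (W t x) * ennreal (D * (t powr (a + 1) / (a + 1)))"
      using t by (subst nn_integral_const_powr_from_0[OF a _ D]) auto
    also have "\<dots> = ennreal (W t x * (D * (t powr (a + 1) / (a + 1))))"
      using D a W_nonneg by (intro ennreal_mult[symmetric]) auto
    also have "\<dots> \<le> ennreal (w x t)"
    proof (rule ennreal_leI)
      have "W t x = w x t * w x t powr (\<beta> - 1)"
        unfolding w_powr[symmetric] using w_nonneg[of x t] \<beta> by (cases "w x t = 0") (auto simp: powr_diff)
      also have "\<dots> \<le> w x t * (\<epsilon> * t powr (- 1 / (p - 1))) powr (\<beta> - 1)"
        using t \<beta> w_nonneg by (intro mult_left_mono powr_mono2 w_le) auto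
      also have "(\<epsilon> * t powr (- 1 / (p - 1))) powr (\<beta> - 1) = \<epsilon> powr (\<beta> - 1) * t powr (- (a + 1))"
        using \<epsilon> by (simp add: powr_mult powr_powr a1)
      finally have "W t x * (D * (t powr (a + 1) / (a + 1))) \<le>
          w x t * (\<epsilon> powr (\<beta> - 1) * t powr (- (a + 1))) * (D * (t powr (a + 1) / (a + 1)))"
        using D a by (intro mult_right_mono) auto
      also have "\<dots> = w x t * (2 powr p * (\<epsilon> powr (p - \<beta>) * \<epsilon> powr (\<beta> - 1)) * (t powr (- (a + 1)) * t powr (a + 1)) / (a + 1))"
        by (simp add: D_def mult_ac)
      also have "\<dots> = w x t * (2 powr p * \<epsilon> powr (p - 1) * ((p - 1) / (\<beta> - 1)))"
        using t by (simp add: powr_add[symmetric] a1)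
      also have "\<dots> \<le> w x t * 1"
        using \<epsilon> w_nonneg by (intro mult_left_mono) auto
      finally show "W t x * (D * (t powr (a + 1) / (a + 1))) \<le> w x t" by simp
    qed
    finally show "(\<integral>\<^sup>+s\<in>{0<..<t}. heat_semigroup \<theta> (t - s) (\<lambda>y. ennreal ((2 * w y s) powr p)) x \<partial>lborel) \<le> ennreal (w x t)" .
  qed
qed

section \<open>Existence for uniformly local data\<close>

text \<open>
  The kernel at the origin is a multiple of \<open>t\<^bsup>-N/\<theta>\<^esup>\<close>, which is at least \<open>1\<close> for \<open>t < 1\<close> and so also
  absorbs the contribution of the far part.
\<close>

lemma heat_semigroup_le_ul_norm_power:
  assumes \<theta>: "0 < \<theta>" "\<theta> \<le> 2" and \<rho>: "0 < \<rho>"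
  obtains C where "0 < C"
    "\<And>(g :: 'a::euclidean_space \<Rightarrow> real) t x. g \<in> borel_measurable lebesgue \<Longrightarrow> 0 < t \<Longrightarrow> t < 1 \<Longrightarrow>
      heat_semigroup \<theta> t (\<lambda>y. ennreal \<bar>g y\<bar>) x \<le> ennreal (C * t powr (- (DIM('a) / \<theta>))) * ul_norm \<rho> g"
proof -
  let ?K = "\<lambda>t. fundamental_solution \<theta> (0::'a) t"
  define V where "V = measure lborel (ball (0::'a) (\<rho> / 2))"
  have V: "emeasure lborel (ball (0::'a) (\<rho> / 2)) = ennreal V"
    unfolding V_def using emeasure_lborel_ball_finite[of "0::'a" "\<rho> / 2"]
    by (intro emeasure_eq_ennreal_measure) auto
  have V0: "0 < V" using content_ball_pos[of "\<rho> / 2" "0::'a"] \<rho> by (simp add: V_def)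
  define C where "C = inverse V + ?K 1"
  have K1: "0 \<le> ?K 1" using fundamental_solution_nonneg[OF \<theta>, of 1 "0::'a"] by simp
  have "0 < C" using V0 K1 by (simp add: C_def add_pos_nonneg)
  moreover have "heat_semigroup \<theta> t (\<lambda>y. ennreal \<bar>g y\<bar>) x \<le> ennreal (C * t powr (- (DIM('a) / \<theta>))) * ul_norm \<rho> g"
    if g: "g \<in> borel_measurable lebesgue" and t: "0 < t" "t < 1" for g :: "'a \<Rightarrow> real" and t x
  proof -
    have "t powr (- (DIM('a) / \<theta>)) \<ge> 1"
      using t \<theta> powr_mono'[of "- (DIM('a) / \<theta>)" 0 t] by simp
    then have 1: "inverse V \<le> inverse V * t powr (- (DIM('a) / \<theta>))"
      using V0 by simp
    have 2: "?K t = ?K 1 * t powr (- (DIM('a) / \<theta>))"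
      using fundamental_solution_scaling[OF \<theta>(1) t(1), of "0::'a"] t
      by (simp add: powr_powr mult.commute flip: powr_realpow)
    have "inverse (emeasure lborel (ball (0::'a) (\<rho> / 2))) + ennreal (?K t) = ennreal (inverse V + ?K t)"
      unfolding V using V0 t \<theta> by (simp add: inverse_ennreal fundamental_solution_nonneg)
    also have "\<dots> \<le> ennreal (C * t powr (- (DIM('a) / \<theta>)))"
      using 1 unfolding 2 C_def by (intro ennreal_leI) (simp add: distrib_right)
    finally show ?thesis
      using heat_semigroup_le_ul_norm[OF \<theta> t(1) \<rho> g, of x] by (meson mult_right_mono order_trans zero_le)
  qed
  ultimately show ?thesis by (rule that)
qed

text \<open>
  Solutions, heat semigroup and uniformly local norm depend on the datum only up to null sets, while
  the joint measurability arguments for the iteration are carried out for Borel functions.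
\<close>

lemma borel_representative:
  fixes \<phi> :: "'a::euclidean_space \<Rightarrow> real"
  assumes "nonneg_measurable \<phi>"
  obtains \<phi>' where "\<phi>' \<in> borel_measurable borel" "\<And>x. 0 \<le> \<phi>' x" "AE x in lborel. \<phi> x = \<phi>' x"
proof -
  from assms have "\<phi> \<in> borel_measurable lebesgue" and nn: "\<And>x. 0 \<le> \<phi> x"
    by (auto simp: nonneg_measurable_def)
  from completion_ex_borel_measurable_real[OF this(1)] obtain \<phi>' where
    [measurable]: "\<phi>' \<in> borel_measurable borel" and ae: "AE x in lborel. \<phi> x = \<phi>' x" by auto
  show ?thesis
  proof (rule that)
    show "(\<lambda>x. max 0 (\<phi>' x)) \<in> borel_measurable borel" by measurable
    show "AE x in lborel. \<phi> x = max 0 (\<phi>' x)"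
      using ae by eventually_elim (metis nn max.absorb2)
  qed simp
qed

text \<open>
  The subcritical criterion with \<open>\<beta> = (p - 1) r\<close> and \<open>\<gamma> = N / \<theta>\<close>: \<open>\<beta> \<ge> 1\<close> means \<open>r \<ge> 1 / (p - 1)\<close>, and
  \<open>\<gamma> (p - 1) < \<beta>\<close> means \<open>r > N / \<theta>\<close>.
\<close>

theorem has_local_solution_L1_ul:
  fixes \<phi> :: "'a::euclidean_space \<Rightarrow> real"
  assumes \<theta>: "0 < \<theta>" "\<theta> \<le> 2" and p: "1 < p" and \<rho>: "0 < \<rho>"
    and r: "DIM('a) / \<theta> < r" "1 / (p - 1) \<le> r"
    and \<phi>: "nonneg_measurable \<phi>" and ul: "(\<lambda>x. \<phi> x powr ((p - 1) * r)) \<in> L1_ul \<rho>"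
  shows "has_local_solution \<theta> p \<phi>"
proof -
  let ?q = "(p - 1) * r"
  obtain \<phi>' where \<phi>': "\<phi>' \<in> borel_measurable borel" "\<And>x. 0 \<le> \<phi>' x" and ae: "AE x in lborel. \<phi> x = \<phi>' x"
    using borel_representative[OF \<phi>] by blast
  obtain C where C: "0 < C"
    "\<And>(g :: 'a \<Rightarrow> real) t x. g \<in> borel_measurable lebesgue \<Longrightarrow> 0 < t \<Longrightarrow> t < 1 \<Longrightarrow>
      heat_semigroup \<theta> t (\<lambda>y. ennreal \<bar>g y\<bar>) x \<le> ennreal (C * t powr (- (DIM('a) / \<theta>))) * ul_norm \<rho> g"
    using heat_semigroup_le_ul_norm_power[OF \<theta> \<rho>] by metis
  define U where "U = enn2real (ul_norm \<rho> (\<lambda>x. \<phi> x powr ?q))"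
  have U: "ul_norm \<rho> (\<lambda>x. \<phi> x powr ?q) = ennreal U" "0 \<le> U"
    using ul by (auto simp: U_def L1_ul_def)
  have "has_local_solution \<theta> p \<phi>'"
  proof (rule has_local_solution_subcritical[OF \<theta> p _ zero_less_one \<phi>'])
    show "1 \<le> ?q" using r p by (simp add: field_simps)
    show "0 \<le> C * U" using C U by simp
    show "DIM('a) / \<theta> * (p - 1) < ?q"
      using mult_strict_right_mono[OF r(1), of "p - 1"] p by (simp add: mult.commute)
    fix s :: real and x :: 'a assume s: "0 < s" "s < 1"
    have "heat_semigroup \<theta> s (\<lambda>y. ennreal (\<phi>' y powr ?q)) x = heat_semigroup \<theta> s (\<lambda>y. ennreal \<bar>\<phi> y powr ?q\<bar>) x"
      by (rule heat_semigroup_cong_AE) (use ae in eventually_elim, simp)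
    also have "\<dots> \<le> ennreal (C * s powr (- (DIM('a) / \<theta>))) * ennreal U"
      unfolding U(1)[symmetric] using \<phi> s by (intro C(2)) (auto simp: nonneg_measurable_def)
    also have "\<dots> = ennreal (C * U * s powr (- (DIM('a) / \<theta>)))"
      using C U by (simp add: ennreal_mult[symmetric] mult_ac)
    finally show "heat_semigroup \<theta> s (\<lambda>y. ennreal (\<phi>' y powr ?q)) x \<le> ennreal (C * U * s powr (- (DIM('a) / \<theta>)))" .
  qed
  then show ?thesis using has_local_solution_cong_AE[OF ae] by simp
qed

text \<open>
  Split \<open>g\<close> into a part of small uniformly local norm, to which the smoothing estimate applies, and a
  bounded part. The semigroup keeps the latter bounded, and a constant is small compared with
  \<open>s\<^bsup>-N/\<theta>\<^esup>\<close> for small \<open>s\<close>.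
\<close>

lemma heat_semigroup_small_L1_ul_BUC:
  fixes g :: "'a::euclidean_space \<Rightarrow> real"
  assumes \<theta>: "0 < \<theta>" "\<theta> \<le> 2" and \<rho>: "0 < \<rho>" and \<eta>: "0 < \<eta>"
    and g: "g \<in> L1_ul_BUC \<rho>" and g_borel [measurable]: "g' \<in> borel_measurable borel" and ae: "AE x in lborel. g x = g' x"
  obtains T where "0 < T"
    "\<And>s x. 0 < s \<Longrightarrow> s < T \<Longrightarrow> heat_semigroup \<theta> s (\<lambda>y. ennreal (g' y)) x \<le> ennreal (\<eta> * s powr (- (DIM('a) / \<theta>)))"
proof -
  define \<gamma> where "\<gamma> = DIM('a) / \<theta>"
  have \<gamma>: "0 < \<gamma>" using \<theta> by (simp add: \<gamma>_def)
  obtain C where C: "0 < C"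
    "\<And>(g :: 'a \<Rightarrow> real) t x. g \<in> borel_measurable lebesgue \<Longrightarrow> 0 < t \<Longrightarrow> t < 1 \<Longrightarrow>
      heat_semigroup \<theta> t (\<lambda>y. ennreal \<bar>g y\<bar>) x \<le> ennreal (C * t powr (- \<gamma>)) * ul_norm \<rho> g"
    unfolding \<gamma>_def using heat_semigroup_le_ul_norm_power[OF \<theta> \<rho>] by metis
  define \<delta> where "\<delta> = \<eta> / (2 * C)"
  have \<delta>: "0 < \<delta>" using \<eta> C by (simp add: \<delta>_def)
  then obtain v where v: "v \<in> BUC" "ul_norm \<rho> (\<lambda>x. g x - v x) < ennreal \<delta>"
    using g by (auto simp: L1_ul_BUC_def)
  from v(1) obtain B where B: "\<And>x. \<bar>v x\<bar> \<le> B" by (auto simp: BUC_def bounded_iff)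
  have B0: "0 \<le> B" using B[of 0] by linarith
  have [measurable]: "v \<in> borel_measurable borel"
    using v(1) by (intro borel_measurable_continuous_onI uniformly_continuous_imp_continuous) (simp add: BUC_def)
  have meas: "(\<lambda>x. g' x - v x) \<in> borel_measurable lebesgue"
    by (rule measurable_completion) measurable
  define T where "T = min 1 ((\<eta> / (2 * (B + 1))) powr (1 / \<gamma>))"
  have "0 < T" using \<eta> B0 by (simp add: T_def)
  moreover have "heat_semigroup \<theta> s (\<lambda>y. ennreal (g' y)) x \<le> ennreal (\<eta> * s powr (- (DIM('a) / \<theta>)))"
    if s: "0 < s" "s < T" for s x
  proof -
    have s1: "s < 1" using s by (simp add: T_def)
    have "s powr \<gamma> \<le> ((\<eta> / (2 * (B + 1))) powr (1 / \<gamma>)) powr \<gamma>"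
      using s \<gamma> by (intro powr_mono2) (auto simp: T_def)
    then have "s powr \<gamma> \<le> \<eta> / (2 * (B + 1))"
      using \<gamma> \<eta> B0 by (simp add: powr_powr)
    then have "(B + 1) * s powr \<gamma> \<le> \<eta> / 2" using B0 by (simp add: field_simps)
    then have "(B + 1) * s powr \<gamma> * s powr (- \<gamma>) \<le> \<eta> / 2 * s powr (- \<gamma>)" by (rule mult_right_mono) simp
    then have B_le: "B \<le> \<eta> / 2 * s powr (- \<gamma>)"
      using s by (simp add: mult.assoc powr_add[symmetric])
    have "ul_norm \<rho> (\<lambda>x. g' x - v x) = ul_norm \<rho> (\<lambda>x. g x - v x)"
      unfolding ul_norm_def nn_integral_completion
      by (intro SUP_cong refl nn_integral_cong_AE) (use ae in eventually_elim, simp)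
    then have ul: "ul_norm \<rho> (\<lambda>x. g' x - v x) \<le> ennreal \<delta>" using v(2) by simp
    have "ennreal (g' y) \<le> ennreal \<bar>g' y - v y\<bar> + ennreal B" for y
      using B[of y] B0 by (simp add: ennreal_plus[symmetric] ennreal_leI del: ennreal_plus)
    then have "heat_semigroup \<theta> s (\<lambda>y. ennreal (g' y)) x \<le> heat_semigroup \<theta> s (\<lambda>y. ennreal \<bar>g' y - v y\<bar> + ennreal B) x"
      by (rule heat_semigroup_mono)
    also have "\<dots> = heat_semigroup \<theta> s (\<lambda>y. ennreal \<bar>g' y - v y\<bar>) x + ennreal B"
      by (subst heat_semigroup_add) (auto simp: heat_semigroup_const[OF \<theta> s(1)])
    also have "\<dots> \<le> ennreal (C * s powr (- \<gamma>)) * ennreal \<delta> + ennreal (\<eta> / 2 * s powr (- \<gamma>))"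
      by (intro add_mono ennreal_leI B_le order_trans[OF C(2)[OF meas s(1) s1]] mult_left_mono ul) auto
    also have "\<dots> = ennreal (C * s powr (- \<gamma>) * \<delta> + \<eta> / 2 * s powr (- \<gamma>))"
      using C \<delta> \<eta> by (simp add: ennreal_mult[symmetric] ennreal_plus[symmetric] del: ennreal_plus)
    also have "C * s powr (- \<gamma>) * \<delta> + \<eta> / 2 * s powr (- \<gamma>) = \<eta> * s powr (- \<gamma>)"
      using C by (simp add: \<delta>_def field_simps)
    finally show ?thesis by (simp add: \<gamma>_def)
  qed
  ultimately show ?thesis by (rule that)
qed

text \<open>
  Let \<open>q = (p - 1) N / \<theta> > 1\<close>. The critical criterion needs an exponent \<open>\<beta> \<in> (1, p]\<close>, and \<open>\<beta> \<le> q\<close> makes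
  Jensen's inequality applicable, which turns the smallness of \<open>s\<^bsup>N/\<theta>\<^esup> S(s)[\<phi>\<^sup>q]\<close> into that of
  \<open>s\<^bsup>1/(p-1)\<^esup> (S(s)[\<phi>\<^sup>\<beta>])\<^bsup>1/\<beta>\<^esup>\<close>. Hence \<open>\<beta> = min p q\<close>.
\<close>

theorem has_local_solution_L1_ul_BUC:
  fixes \<phi> :: "'a::euclidean_space \<Rightarrow> real"
  assumes \<theta>: "0 < \<theta>" "\<theta> \<le> 2" and p: "1 < p" and \<rho>: "0 < \<rho>"
    and p': "1 + \<theta> / DIM('a) < p"
    and \<phi>: "nonneg_measurable \<phi>" and ul: "(\<lambda>x. \<phi> x powr ((p - 1) * (DIM('a) / \<theta>))) \<in> L1_ul_BUC \<rho>"
  shows "has_local_solution \<theta> p \<phi>"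
proof -
  define \<gamma> where "\<gamma> = DIM('a) / \<theta>"
  have \<gamma>: "0 < \<gamma>" using \<theta> by (simp add: \<gamma>_def)
  define q where "q = (p - 1) * \<gamma>"
  have q: "1 < q" using p' \<theta> by (simp add: q_def \<gamma>_def field_simps)
  define \<beta> where "\<beta> = min p q"
  have \<beta>: "1 < \<beta>" "\<beta> \<le> p" "\<beta> \<le> q" using p q by (auto simp: \<beta>_def)
  \<comment> \<open>The largest \<open>\<epsilon>\<close> admitted by the critical criterion.\<close>
  define \<epsilon> where "\<epsilon> = ((\<beta> - 1) / (2 powr p * (p - 1))) powr (1 / (p - 1))"
  have \<epsilon>: "0 < \<epsilon>" using \<beta> p by (simp add: \<epsilon>_def)
  obtain \<phi>' where \<phi>': "\<phi>' \<in> borel_measurable borel" "\<And>x. 0 \<le> \<phi>' x" and ae: "AE x in lborel. \<phi> x = \<phi>' x"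
    using borel_representative[OF \<phi>] by blast
  note [measurable] = \<phi>'(1)
  have \<eta>: "0 < \<epsilon> powr q" using \<epsilon> by simp
  have meas: "(\<lambda>x. \<phi>' x powr q) \<in> borel_measurable borel" by measurable
  have ae_q: "AE x in lborel. \<phi> x powr q = \<phi>' x powr q" using ae by eventually_elim simp
  have ul_q: "(\<lambda>x. \<phi> x powr q) \<in> L1_ul_BUC \<rho>" using ul by (simp add: q_def \<gamma>_def)
  obtain T where T: "0 < T"
    "\<And>s x. 0 < s \<Longrightarrow> s < T \<Longrightarrow> heat_semigroup \<theta> s (\<lambda>y. ennreal (\<phi>' y powr q)) x \<le> ennreal (\<epsilon> powr q * s powr (- \<gamma>))"
    using heat_semigroup_small_L1_ul_BUC[OF \<theta> \<rho> \<eta> ul_q meas ae_q] unfolding \<gamma>_def by blast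
  have "has_local_solution \<theta> p \<phi>'"
  proof (rule has_local_solution_critical[OF \<theta> p \<beta>(1,2) T(1) \<phi>'])
    show "0 \<le> \<epsilon>" using \<epsilon> by simp
    have "\<epsilon> powr (p - 1) = (\<beta> - 1) / (2 powr p * (p - 1))"
      using \<beta> p by (simp add: \<epsilon>_def powr_powr)
    then show "2 powr p * \<epsilon> powr (p - 1) * ((p - 1) / (\<beta> - 1)) \<le> 1"
      using \<beta> p by simp
    fix s :: real and x :: 'a assume s: "0 < s" "s < T"
    have "heat_semigroup \<theta> s (\<lambda>y. ennreal (\<phi>' y powr \<beta>)) x \<le> ennreal ((\<epsilon> powr q * s powr (- \<gamma>)) powr (1 / (q / \<beta>)))"
      using T(2)[OF s, of x] \<beta> by (intro heat_semigroup_le_powr_inverse[OF \<theta> s(1)]) (auto simp: powr_powr)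
    also have "(\<epsilon> powr q * s powr (- \<gamma>)) powr (1 / (q / \<beta>)) = (\<epsilon> * s powr (- 1 / (p - 1))) powr \<beta>"
      using \<epsilon> q \<gamma> p by (simp add: powr_mult powr_powr q_def)
    finally show "heat_semigroup \<theta> s (\<lambda>y. ennreal (\<phi>' y powr \<beta>)) x \<le> ennreal ((\<epsilon> * s powr (- 1 / (p - 1))) powr \<beta>)" .
  qed
  then show ?thesis using has_local_solution_cong_AE[OF ae] by simp
qed

section \<open>A necessary condition for solvability\<close>

text \<open>
  With \<open>E = growth p\<close> and \<open>D = threshold p\<close>, the lower bounds for a solution proved below have the
  form \<open>D E\<^sup>k (z t\<^bsup>1/(p-1)\<^esup> / D) powr (p ^ k) t\<^bsup>-1/(p-1)\<^esup>\<close> for all \<open>k\<close>. The equations \<open>E\<^bsup>p-1\<^esup> = p\<close> and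
  \<open>D\<^bsup>p-1\<^esup> (p - 1) = p E\<close> are what makes the induction on \<open>k\<close> close.
\<close>

definition growth :: "real \<Rightarrow> real" where
  "growth p = p powr (1 / (p - 1))"

definition threshold :: "real \<Rightarrow> real" where
  "threshold p = (p * growth p / (p - 1)) powr (1 / (p - 1))"

lemma growth_gt_1: "1 < p \<Longrightarrow> 1 < growth p"
  by (simp add: growth_def gr_one_powr)

lemma threshold_pos: "1 < p \<Longrightarrow> 0 < threshold p"
  by (simp add: growth_def threshold_def)

text \<open>
  A datum below \<open>\<phi>\<close> that is bounded, so that all its heat averages \<open>z\<close> are finite real numbers.
\<close>

locale bounded_subdatum =
  fixes \<theta> p T B :: real and \<phi> \<psi> :: "'a::euclidean_space \<Rightarrow> real" and u :: "'a \<Rightarrow> real \<Rightarrow> real"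
  assumes \<theta>: "0 < \<theta>" "\<theta> \<le> 2" and p: "1 < p"
    and u: "integral_solution \<theta> p \<phi> T u"
    and \<psi> [measurable]: "\<psi> \<in> borel_measurable borel" and \<psi>_bnd: "\<And>y. 0 \<le> \<psi> y \<and> \<psi> y \<le> B"
    and \<psi>_le: "AE y in lborel. \<psi> y \<le> \<phi> y"
begin

definition z :: "'a \<Rightarrow> real \<Rightarrow> real" where
  "z x t = enn2real (heat_semigroup \<theta> t (\<lambda>y. ennreal (\<psi> y)) x)"

text \<open>
  Collecting the factors of the lower bound: \<open>ampl k\<close> is its constant and \<open>expo k\<close> the exponent of \<open>t\<close>.
\<close>

definition ampl :: "nat \<Rightarrow> real" where
  "ampl k = threshold p * growth p ^ k / threshold p powr (p ^ k)"

definition expo :: "nat \<Rightarrow> real" where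
  "expo k = (p ^ k - 1) / (p - 1)"

lemma z_measurable [measurable]: "(\<lambda>x. z x t) \<in> borel_measurable borel"
  unfolding z_def by measurable

lemma z_nonneg: "0 \<le> z x t"
  by (simp add: z_def)

lemma z_eq: "0 < t \<Longrightarrow> ennreal (z x t) = heat_semigroup \<theta> t (\<lambda>y. ennreal (\<psi> y)) x"
proof -
  assume t: "0 < t"
  have "heat_semigroup \<theta> t (\<lambda>y. ennreal (\<psi> y)) x \<le> heat_semigroup \<theta> t (\<lambda>y. ennreal B) x"
    using \<psi>_bnd by (intro heat_semigroup_mono ennreal_leI) auto
  also have "\<dots> = ennreal B" by (rule heat_semigroup_const[OF \<theta> t])
  also have "\<dots> < \<infinity>" by simp
  finally show ?thesis by (simp add: z_def)
qed

lemmas growth_gt_1 = growth_gt_1[OF p] and threshold_pos = threshold_pos[OF p]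

lemma expo_nonneg: "0 \<le> expo k" and expo_Suc: "expo (Suc k) = p * expo k + 1"
  using p by (auto simp: expo_def field_simps one_le_power)

lemma ampl_0: "ampl 0 = 1"
  using threshold_pos by (simp add: ampl_def)

lemma ampl_pos: "0 < ampl k"
  using threshold_pos growth_gt_1 by (simp add: ampl_def)

lemma ampl_Suc: "ampl (Suc k) \<le> ampl k powr p / expo (Suc k)"
proof -
  note pos = threshold_pos growth_gt_1
  have D: "threshold p powr (p - 1) * (p - 1) = p * growth p"
    using p growth_gt_1 by (simp add: threshold_def powr_powr)
  have E: "growth p powr (p - 1) = p" using p by (simp add: growth_def powr_powr)
  have Dp: "threshold p powr p = threshold p * threshold p powr (p - 1)"
    using pos by (simp add: powr_diff)
  have Ep: "(growth p ^ k) powr p = growth p ^ k * p ^ k"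
  proof -
    have "(growth p ^ k) powr p = growth p ^ k * (growth p ^ k) powr (p - 1)"
      using pos by (simp add: powr_diff)
    also have "(growth p ^ k) powr (p - 1) = (growth p powr (p - 1)) ^ k"
      using pos by (simp add: powr_powr mult.commute flip: powr_realpow)
    finally show ?thesis by (simp add: E)
  qed
  have "expo (Suc k) \<le> p ^ Suc k / (p - 1)"
    using p unfolding expo_def by (intro divide_right_mono) auto
  moreover have "0 < expo (Suc k)" using expo_nonneg[of k] p by (simp add: expo_Suc add_nonneg_pos)
  ultimately have "ampl (Suc k) * expo (Suc k) \<le> ampl (Suc k) * (p ^ Suc k / (p - 1))"
    using ampl_pos by (intro mult_left_mono) (auto intro: less_imp_le)
  also have "\<dots> = threshold p * (p * growth p) * (growth p ^ k * p ^ k) / (p - 1) / threshold p powr (p ^ Suc k)"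
    by (simp add: ampl_def mult_ac)
  also have "\<dots> = threshold p powr p * (growth p ^ k) powr p / threshold p powr (p ^ Suc k)"
    using p unfolding D[symmetric] Dp Ep by simp
  also have "\<dots> = ampl k powr p"
    using pos by (simp add: ampl_def powr_mult powr_divide powr_powr mult.commute)
  finally show ?thesis using \<open>0 < expo (Suc k)\<close> by (simp add: field_simps)
qed

text \<open>
  The bound for \<open>k = 0\<close> is \<open>u(t) \<ge> S(t)\<psi> = z(t)\<close>. If it holds for \<open>k\<close>, then by Jensen's inequality and the
  semigroup property \<open>S(t - s)[u(s)\<^sup>p]\<close> is at least a multiple of a power of \<open>s\<close> times \<open>z(t)\<close> to the power
  \<open>p ^ (k + 1)\<close>, and integrating over \<open>s\<close> raises the exponent of \<open>t\<close> to \<open>expo (k + 1)\<close>.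
\<close>

lemma solution_lower_bound:
  assumes t: "0 < t" "t < T"
  shows "AE x in lborel. ampl k * t powr expo k * z x t powr (p ^ k) \<le> u x t"
  using t
proof (induction k arbitrary: t)
  case 0
  have "AE x in lborel. ennreal (u x t) = duhamel \<theta> p \<phi> u x t"
    using u 0 by (auto simp: integral_solution_iff_duhamel)
  then show ?case
  proof eventually_elim
    case (elim x)
    have "ennreal (z x t) \<le> heat_semigroup \<theta> t (\<lambda>y. ennreal (\<phi> y)) x"
      unfolding z_eq[OF 0(1)]
      by (rule heat_semigroup_mono_AE) (use \<psi>_le in eventually_elim, simp add: ennreal_leI)
    also have "\<dots> \<le> ennreal (u x t)" unfolding elim duhamel_def by (simp add: add_increasing2)
    finally have "z x t \<le> u x t"
      using u 0 by (subst (asm) ennreal_le_iff) (auto simp: integral_solution_iff_duhamel)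
    then show ?case using 0 z_nonneg[of x t] by (simp add: ampl_0 expo_def)
  qed
next
  case (Suc k)
  have "AE x in lborel. ennreal (u x t) = duhamel \<theta> p \<phi> u x t"
    using u Suc by (auto simp: integral_solution_iff_duhamel)
  then show ?case
  proof eventually_elim
    case (elim x)
    let ?q = "p ^ Suc k"
    define c where "c = ampl k powr p * z x t powr ?q"
    have c: "0 \<le> c" by (simp add: c_def)
    have e: "0 \<le> expo k * p" using expo_nonneg[of k] p by simp
    have heat: "ennreal (c * s powr (expo k * p)) \<le> heat_semigroup \<theta> (t - s) (\<lambda>y. ennreal (u y s powr p)) x"
      if s: "0 < s" "s < t" for s
    proof -
      let ?H = "heat_semigroup \<theta> (t - s)"
      have "ennreal (z x t) \<le> ?H (\<lambda>y. ennreal (z y s)) x"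
        using s heat_semigroup_compose[OF \<theta>, of "t - s" s "\<lambda>y. ennreal (\<psi> y)" x] by (simp add: z_eq)
      then have J: "ennreal (z x t powr ?q) \<le> ?H (\<lambda>y. ennreal (z y s powr ?q)) x"
        using s p z_nonneg by (intro heat_semigroup_Jensen[OF \<theta>]) (auto intro!: one_le_power simp del: power_Suc)
      let ?c = "(ampl k * s powr expo k) powr p"
      have "ennreal (c * s powr (expo k * p)) = ennreal ?c * ennreal (z x t powr ?q)"
        using ampl_pos[of k] by (simp add: c_def powr_mult powr_powr ennreal_mult[symmetric] mult_ac del: power_Suc)
      also have "\<dots> \<le> ennreal ?c * ?H (\<lambda>y. ennreal (z y s powr ?q)) x"
        by (intro mult_left_mono J) auto
      also have "\<dots> = ?H (\<lambda>y. ennreal ?c * ennreal (z y s powr ?q)) x"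
        by (rule heat_semigroup_cmult[symmetric]) measurable
      also have "\<dots> \<le> ?H (\<lambda>y. ennreal (u y s powr p)) x"
      proof (rule heat_semigroup_mono_AE)
        have "AE y in lborel. ampl k * s powr expo k * z y s powr (p ^ k) \<le> u y s"
          using s Suc by auto
        then show "AE y in lborel. ennreal ?c * ennreal (z y s powr ?q) \<le> ennreal (u y s powr p)"
        proof eventually_elim
          case (elim y)
          then have "(ampl k * s powr expo k * z y s powr (p ^ k)) powr p \<le> u y s powr p"
            using p ampl_pos[of k] by (intro powr_mono2) auto
          also have "(ampl k * s powr expo k * z y s powr (p ^ k)) powr p = ?c * z y s powr ?q"
            using ampl_pos[of k] by (simp add: powr_mult powr_powr mult_ac)
          finally show ?case by (simp add: ennreal_mult[symmetric] ennreal_leI del: power_Suc)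
        qed
      qed
      finally show ?thesis .
    qed
    have "ennreal (c * (t powr expo (Suc k) / expo (Suc k))) = (\<integral>\<^sup>+s\<in>{0<..<t}. ennreal (c * s powr (expo k * p)) \<partial>lborel)"
      using Suc.prems c e by (subst nn_integral_const_powr_from_0) (auto simp: expo_Suc mult.commute)
    also have "\<dots> \<le> (\<integral>\<^sup>+s\<in>{0<..<t}. heat_semigroup \<theta> (t - s) (\<lambda>y. ennreal (u y s powr p)) x \<partial>lborel)"
      using heat by (intro nn_integral_mono) (auto simp: indicator_def)
    also have "\<dots> \<le> ennreal (u x t)" unfolding elim duhamel_def by (simp add: add_increasing)
    finally have le: "c * (t powr expo (Suc k) / expo (Suc k)) \<le> u x t"
      using u Suc.prems by (subst (asm) ennreal_le_iff) (auto simp: integral_solution_iff_duhamel)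
    have "ampl (Suc k) * (t powr expo (Suc k) * z x t powr ?q) \<le> (ampl k powr p / expo (Suc k)) * (t powr expo (Suc k) * z x t powr ?q)"
      by (intro mult_right_mono ampl_Suc) auto
    also have "\<dots> = c * (t powr expo (Suc k) / expo (Suc k))"
      by (simp add: c_def)
    also note le
    finally show ?case by (simp add: mult.assoc)
  qed
qed

text \<open>
  Where the inequality fails, the lower bounds of the solution are at least a fixed positive multiple of
  \<open>growth p ^ k\<close> for every \<open>k\<close>, which contradicts the finiteness of \<open>u\<close>.
\<close>

lemma heat_semigroup_lt_threshold:
  assumes t: "0 < t" "t < T"
  shows "AE x in lborel. z x t * t powr (1 / (p - 1)) < threshold p"
proof -
  have "AE x in lborel. \<forall>k. ampl k * t powr expo k * z x t powr (p ^ k) \<le> u x t"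
    unfolding AE_all_countable using solution_lower_bound[OF t] by blast
  then show ?thesis
  proof eventually_elim
    case (elim x)
    show ?case
    proof (rule ccontr)
      assume "\<not> ?case"
      then have y: "1 \<le> z x t * t powr (1 / (p - 1)) / threshold p"
        using threshold_pos by simp
      define m where "m = threshold p * t powr (- (1 / (p - 1)))"
      have m: "0 < m" using threshold_pos t by (simp add: m_def)
      have "m * growth p ^ k \<le> u x t" for k
      proof -
        have "m * growth p ^ k * 1 \<le> m * growth p ^ k * (z x t * t powr (1 / (p - 1)) / threshold p) powr (p ^ k)"
          using m growth_gt_1 y p by (intro mult_left_mono ge_one_powr_ge_zero) auto
        also have "\<dots> = ampl k * (t powr (- (1 / (p - 1))) * t powr (p ^ k / (p - 1))) * z x t powr (p ^ k)"
          using z_nonneg threshold_pos by (simp add: m_def ampl_def powr_mult powr_divide powr_powr)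
        also have "t powr (- (1 / (p - 1))) * t powr (p ^ k / (p - 1)) = t powr expo k"
          by (simp add: powr_add[symmetric] expo_def diff_divide_distrib)
        also have "ampl k * t powr expo k * z x t powr (p ^ k) \<le> u x t" using elim by blast
        finally show ?thesis by simp
      qed
      then have "growth p ^ k \<le> u x t / m" for k using m by (simp add: field_simps)
      moreover obtain k where "u x t / m < growth p ^ k"
        using real_arch_pow[OF growth_gt_1] by blast
      ultimately show False using not_le by blast
    qed
  qed
qed

end

section \<open>Nonexistence for a power singularity\<close>

lemma nn_integral_norm_powr_unit_ball:
  fixes b :: real
  assumes b: "0 < b" "b < DIM('a::euclidean_space)"
  shows "(\<integral>\<^sup>+(x::'a). ennreal (norm x powr (- b)) * indicator (ball 0 1) x \<partial>lborel) < \<infinity>"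
proof (rule nn_integral_finite_if_ball_sum)
  fix x :: 'a assume x: "x \<noteq> 0"
  let ?F = "\<lambda>n. ennreal ((2 powr b) ^ n) * indicator (ball 0 (2 * (1 / 2) ^ n)) x"
  show "ennreal (norm x powr (- b)) * indicator (ball 0 1) x \<le> (\<Sum>n. ?F n)"
  proof (cases "norm x < 1")
    case True
    obtain m0 where "(1 / 2 :: real) ^ m0 < norm x"
      using real_arch_pow_inv[of "norm x" "1 / 2"] x by auto
    then have ex: "(1 / 2 :: real) ^ m0 \<le> norm x" by simp
    \<comment> \<open>The dyadic shell containing \<open>x\<close>: \<open>2\<^bsup>-m\<^esup> \<le> |x| < 2\<^bsup>1-m\<^esup>\<close>.\<close>
    define m where "m = (LEAST m. (1 / 2 :: real) ^ m \<le> norm x)"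
    have m: "(1 / 2) ^ m \<le> norm x" unfolding m_def by (rule LeastI[of _ m0]) (rule ex)
    have "m \<noteq> 0"
    proof
      assume "m = 0"
      with m True show False by simp
    qed
    then obtain j where j: "m = Suc j" by (cases m) auto
    have "\<not> (1 / 2) ^ j \<le> norm x" using not_less_Least[of j "\<lambda>m. (1 / 2 :: real) ^ m \<le> norm x"] j
      by (simp add: m_def)
    then have "norm x < 2 * (1 / 2) ^ m" by (simp add: j)
    moreover have "norm x powr (- b) \<le> ((1 / 2) ^ m) powr (- b)"
      using m b by (intro powr_mono2') auto
    moreover have "((1 / 2 :: real) ^ m) powr (- b) = (2 powr b) ^ m"
      by (simp add: powr_powr powr_minus power_divide powr_divide divide_simps mult.commute flip: powr_realpow)
    ultimately have "ennreal (norm x powr (- b)) * indicator (ball 0 1) x \<le> ?F m"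
      using True by (simp add: ennreal_leI)
    also have "\<dots> \<le> (\<Sum>n. ?F n)" by (rule le_suminf_ennreal)
    finally show ?thesis .
  qed simp
next
  have "(2 powr b) ^ n * (2 * (1 / 2) ^ n) ^ DIM('a) = 2 ^ DIM('a) * (2 powr (b - DIM('a))) ^ n" for n
    by (simp add: power_mult_distrib powr_diff power_divide powr_realpow divide_simps flip: power_mult)
  moreover have "summable (\<lambda>n. 2 ^ DIM('a) * (2 powr (b - DIM('a))) ^ n)"
    using b powr_less_mono[of "b - DIM('a)" 0 2] by (intro summable_mult summable_geometric) auto
  ultimately show "summable (\<lambda>n. (2 powr b) ^ n * (2 * (1 / 2) ^ n) ^ DIM('a))" by (simp only:)
qed auto

text \<open>
  Outside the unit ball the function is at most \<open>1\<close>, so its integral over any set is at most the integral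
  over the unit ball plus the volume of the set.
\<close>

lemma norm_powr_in_L1_ul:
  fixes b :: real
  assumes b: "0 < b" "b < DIM('a::euclidean_space)" and \<rho>: "0 < \<rho>"
  shows "(\<lambda>x::'a. norm x powr (- b)) \<in> L1_ul \<rho>"
proof -
  define S where "S = (\<integral>\<^sup>+(x::'a). ennreal (norm x powr (- b)) * indicator (ball 0 1) x \<partial>lborel)"
  have S: "S < \<infinity>" unfolding S_def by (rule nn_integral_norm_powr_unit_ball[OF b])
  have le: "(\<integral>\<^sup>+x\<in>A. ennreal (norm x powr (- b)) \<partial>lborel) \<le> S + emeasure lborel A"
    if [measurable]: "A \<in> sets borel" for A :: "'a set"
  proof -
    have "ennreal (norm x powr (- b)) * indicator A x \<le>
        ennreal (norm x powr (- b)) * indicator (ball 0 1) x + indicator A x" for x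
      using b powr_mono2'[of "- b" 1 "norm x"] by (auto simp: indicator_def ennreal_leI)
    then have "(\<integral>\<^sup>+x\<in>A. ennreal (norm x powr (- b)) \<partial>lborel) \<le>
        (\<integral>\<^sup>+x. ennreal (norm x powr (- b)) * indicator (ball 0 1) x + indicator A x \<partial>lborel)"
      by (rule nn_integral_mono)
    also have "\<dots> = S + emeasure lborel A"
      unfolding S_def by (subst nn_integral_add) (auto intro!: borel_measurable_times_ennreal borel_measurable_indicator)
    finally show ?thesis .
  qed
  have "(\<lambda>x::'a. norm x powr (- b)) \<in> L1_loc"
    unfolding L1_loc_def
  proof (intro CollectI allI impI)
    fix K :: "'a set" assume K: "compact K"
    then have [measurable]: "K \<in> sets borel" by (simp add: borel_compact)
    have "(\<integral>\<^sup>+x\<in>K. ennreal (norm x powr (- b)) \<partial>lborel) < \<infinity>"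
      using S emeasure_bounded_finite[OF compact_imp_bounded[OF K]] by (intro le_less_trans[OF le]) auto
    also have "(\<integral>\<^sup>+x\<in>K. ennreal (norm x powr (- b)) \<partial>lborel) =
        (\<integral>\<^sup>+x. ennreal (norm (indicator K x *\<^sub>R (norm x powr (- b)))) \<partial>lborel)"
      by (intro nn_integral_cong) (simp add: indicator_def)
    finally have "integrable lborel (\<lambda>x. indicator K x *\<^sub>R (norm x powr (- b)))"
      by (intro integrableI_bounded) auto
    then show "(\<lambda>x::'a. norm x powr (- b)) absolutely_integrable_on K"
      unfolding set_integrable_def by (rule integrable_completion[THEN iffD2, rotated]) measurable
  qed
  moreover have "ul_norm \<rho> (\<lambda>x::'a. norm x powr (- b)) \<le> S + emeasure lborel (ball (0::'a) \<rho>)"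
    unfolding ul_norm_def nn_integral_completion
  proof (rule SUP_least)
    fix y :: 'a
    have "(\<integral>\<^sup>+x\<in>ball y \<rho>. ennreal \<bar>norm x powr (- b)\<bar> \<partial>lborel) \<le> S + emeasure lborel (ball y \<rho>)"
      using le[of "ball y \<rho>"] by simp
    also have "emeasure lborel (ball y \<rho>) = emeasure lborel (ball (0::'a) \<rho>)"
      using emeasure_ball_eq_unit_ball[OF \<rho>, of y] emeasure_ball_eq_unit_ball[OF \<rho>, of "0::'a"] by simp
    finally show "(\<integral>\<^sup>+x\<in>ball y \<rho>. ennreal \<bar>norm x powr (- b)\<bar> \<partial>lborel) \<le> S + emeasure lborel (ball (0::'a) \<rho>)" .
  qed
  moreover have "S + emeasure lborel (ball (0::'a) \<rho>) < \<infinity>"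
    using S emeasure_lborel_ball_finite[of "0::'a" \<rho>] by simp
  ultimately show ?thesis by (simp add: L1_ul_def le_less_trans)
qed

text \<open>
  The kernel has mass \<open>1\<close>, so at time \<open>1\<close> some ball carries half of it; scaling transfers this to time \<open>t\<close>
  with the radius multiplied by \<open>t\<^bsup>1/\<theta>\<^esup>\<close>.
\<close>

lemma fundamental_solution_mass:
  assumes \<theta>: "0 < \<theta>" "\<theta> \<le> 2"
  obtains R where "0 < R"
    "\<And>t. 0 < t \<Longrightarrow> ennreal (1 / 2) \<le>
      (\<integral>\<^sup>+(x::'a::euclidean_space). ennreal (fundamental_solution \<theta> x t) * indicator (ball 0 (R * t powr (1 / \<theta>))) x \<partial>lborel)"
proof -
  let ?I = "\<lambda>t r. \<integral>\<^sup>+(x::'a). ennreal (fundamental_solution \<theta> x t) * indicator (ball 0 r) x \<partial>lborel"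
  have half: "ennreal (1 / 2) < 1"
    unfolding ennreal_1[symmetric] by (subst ennreal_less_iff) auto
  have "(SUP n. ?I 1 (real (Suc n))) = (\<integral>\<^sup>+(x::'a). (SUP n. ennreal (fundamental_solution \<theta> x 1) * indicator (ball 0 (real (Suc n))) x) \<partial>lborel)"
  proof (rule nn_integral_monotone_convergence_SUP[symmetric])
    show "incseq (\<lambda>n (x::'a). ennreal (fundamental_solution \<theta> x 1) * indicator (ball 0 (real (Suc n))) x)"
      by (intro incseq_SucI le_funI mult_left_mono) (auto simp: indicator_def)
  qed (auto intro!: borel_measurable_times_ennreal borel_measurable_indicator)
  also have "\<dots> = (\<integral>\<^sup>+(x::'a). ennreal (fundamental_solution \<theta> x 1) \<partial>lborel)"
  proof (rule nn_integral_cong)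
    fix x :: 'a
    obtain n where "norm x < real n" using reals_Archimedean2 by blast
    then have n: "norm x < real (Suc n)" by simp
    show "(SUP n. ennreal (fundamental_solution \<theta> x 1) * indicator (ball 0 (real (Suc n))) x) = ennreal (fundamental_solution \<theta> x 1)"
    proof (rule antisym)
      show "ennreal (fundamental_solution \<theta> x 1) \<le> (SUP n. ennreal (fundamental_solution \<theta> x 1) * indicator (ball 0 (real (Suc n))) x)"
        using n by (intro SUP_upper2[of n]) auto
    qed (auto intro!: SUP_least simp: indicator_def)
  qed
  also have "\<dots> = 1" by (rule nn_integral_fundamental_solution[OF \<theta>]) simp
  finally have "ennreal (1 / 2) < (SUP n. ?I 1 (real (Suc n)))" using half by (simp only:)
  then obtain n where n: "ennreal (1 / 2) < ?I 1 (real (Suc n))" unfolding less_SUP_iff by blast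
  show ?thesis
  proof (rule that)
    show "0 < real (Suc n)" by simp
    fix t :: real assume t: "0 < t"
    let ?c = "t powr (1 / \<theta>)"
    have c: "0 < ?c" using t by simp
    have inv: "t powr (- 1 / \<theta>) * ?c = 1" using t by (simp add: powr_add[symmetric])
    have "?I t (real (Suc n) * ?c) = ennreal (?c ^ DIM('a)) *
       (\<integral>\<^sup>+(x::'a). ennreal (fundamental_solution \<theta> (?c *\<^sub>R x) t) * indicator (ball 0 (real (Suc n) * ?c)) (?c *\<^sub>R x) \<partial>lborel)"
      using c by (subst nn_integral_lborel_affine[where c="?c" and a=0])
        (auto intro!: borel_measurable_times_ennreal borel_measurable_indicator)
    also have "\<dots> = (\<integral>\<^sup>+(x::'a). ennreal (?c ^ DIM('a)) *
       (ennreal (fundamental_solution \<theta> (?c *\<^sub>R x) t) * indicator (ball 0 (real (Suc n))) x) \<partial>lborel)"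
    proof (subst nn_integral_cmult[symmetric])
      show "(\<lambda>x::'a. ennreal (fundamental_solution \<theta> (?c *\<^sub>R x) t) * indicator (ball 0 (real (Suc n) * ?c)) (?c *\<^sub>R x)) \<in> borel_measurable lborel"
        unfolding indicator_def mem_ball by measurable
      have "indicator (ball 0 (real (Suc n) * ?c)) (?c *\<^sub>R x) = (indicator (ball 0 (real (Suc n))) x :: ennreal)" for x :: 'a
        using c by (auto simp: indicator_def mult.commute simp del: of_nat_Suc)
      then show "(\<integral>\<^sup>+(x::'a). ennreal (?c ^ DIM('a)) * (ennreal (fundamental_solution \<theta> (?c *\<^sub>R x) t) * indicator (ball 0 (real (Suc n) * ?c)) (?c *\<^sub>R x)) \<partial>lborel) =
         (\<integral>\<^sup>+(x::'a). ennreal (?c ^ DIM('a)) * (ennreal (fundamental_solution \<theta> (?c *\<^sub>R x) t) * indicator (ball 0 (real (Suc n))) x) \<partial>lborel)"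
        by (simp only:)
    qed
    also have "\<dots> = ?I 1 (real (Suc n))"
    proof (rule nn_integral_cong)
      fix x :: 'a
      have "?c ^ DIM('a) * fundamental_solution \<theta> (?c *\<^sub>R x) t = (t powr (- 1 / \<theta>) * ?c) ^ DIM('a) * fundamental_solution \<theta> ((t powr (- 1 / \<theta>) * ?c) *\<^sub>R x) 1"
        by (subst fundamental_solution_scaling[OF \<theta>(1) t]) (simp add: power_mult_distrib mult_ac)
      then have "?c ^ DIM('a) * fundamental_solution \<theta> (?c *\<^sub>R x) t = fundamental_solution \<theta> x 1" unfolding inv by simp
      then show "ennreal (?c ^ DIM('a)) * (ennreal (fundamental_solution \<theta> (?c *\<^sub>R x) t) * indicator (ball 0 (real (Suc n))) x) =
         ennreal (fundamental_solution \<theta> x 1) * indicator (ball 0 (real (Suc n))) x"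
        using t by (simp add: mult.assoc[symmetric] ennreal_mult[symmetric] fundamental_solution_nonneg[OF \<theta>])
    qed
    finally show "ennreal (1 / 2) \<le> ?I t (real (Suc n) * ?c)" using n by simp
  qed
qed

text \<open>
  On the ball of radius \<open>2 d\<close> with \<open>d = R t\<^bsup>1/\<theta>\<^esup>\<close> the datum is at least \<open>(2 d)\<^bsup>-a\<^esup>\<close>, and half of the
  mass of the kernel around any \<open>x \<in> ball 0 d\<close> stays in that ball. So \<open>S(t)\<phi>\<close> is at least a multiple of
  \<open>t\<^bsup>-a/\<theta>\<^esup>\<close> near the origin, which for small \<open>t\<close> exceeds the rate \<open>t\<^bsup>-1/(p-1)\<^esup>\<close> allowed for a solvable
  datum, because \<open>a / \<theta> > 1 / (p - 1)\<close>.
\<close>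

lemma no_local_solution_norm_powr:
  assumes \<theta>: "0 < \<theta>" "\<theta> \<le> 2" and p: "1 < p" and a: "\<theta> / (p - 1) < a"
  shows "\<not> has_local_solution \<theta> p (\<lambda>x::'a::euclidean_space. norm x powr (- a))"
proof
  assume "has_local_solution \<theta> p (\<lambda>x::'a. norm x powr (- a))"
  then obtain T u where T: "0 < T" and u: "integral_solution \<theta> p (\<lambda>x::'a. norm x powr (- a)) T u"
    by (auto simp: has_local_solution_def)
  have a0: "0 < a" using a \<theta> p by (meson divide_pos_pos diff_gt_0_iff_gt less_trans)
  obtain R where R: "0 < R"
    "\<And>t. 0 < t \<Longrightarrow> ennreal (1 / 2) \<le>
      (\<integral>\<^sup>+(x::'a). ennreal (fundamental_solution \<theta> x t) * indicator (ball 0 (R * t powr (1 / \<theta>))) x \<partial>lborel)"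
    using fundamental_solution_mass[OF \<theta>] by metis
  define \<kappa> where "\<kappa> = a / \<theta> - 1 / (p - 1)"
  have \<kappa>: "0 < \<kappa>" using a \<theta> p by (simp add: \<kappa>_def field_simps)
  define X where "X = 2 * (2 * R) powr a * threshold p"
  have X: "0 < X" using R threshold_pos[OF p] by (simp add: X_def)
  \<comment> \<open>A time so small that \<open>t\<^bsup>-\<kappa>\<^esup>\<close> beats all constants.\<close>
  define t where "t = min (T / 2) (X powr (- 1 / \<kappa>))"
  have t: "0 < t" "t < T" using T X by (auto simp: t_def)
  have X_le: "X \<le> t powr (- \<kappa>)"
  proof -
    have "(X powr (- 1 / \<kappa>)) powr (- \<kappa>) \<le> t powr (- \<kappa>)"
      using t \<kappa> by (intro powr_mono2') (auto simp: t_def)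
    then show ?thesis using \<kappa> X by (simp add: powr_powr)
  qed
  define d where "d = R * t powr (1 / \<theta>)"
  have d: "0 < d" using R t by (simp add: d_def)
  define h where "h = (2 * d) powr (- a)"
  define \<psi> where "\<psi> y = h * indicator (ball (0::'a) (2 * d)) y" for y
  have h: "0 < h" using d by (simp add: h_def)
  interpret bounded_subdatum \<theta> p T h "\<lambda>x. norm x powr (- a)" \<psi> u
  proof (unfold_locales)
    show "\<psi> \<in> borel_measurable borel"
      unfolding \<psi>_def[abs_def] by (intro borel_measurable_times borel_measurable_const borel_measurable_indicator) simp
    show "0 \<le> \<psi> y \<and> \<psi> y \<le> h" for y using h by (auto simp: \<psi>_def indicator_def)
    show "integral_solution \<theta> p (\<lambda>x::'a. norm x powr (- a)) T u" by (rule u)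
    show "AE y in lborel. \<psi> y \<le> norm y powr (- a)"
      using AE_lborel_nonzero
    proof eventually_elim
      case (elim y)
      have "(2 * d) powr (- a) \<le> norm y powr (- a)" if "norm y < 2 * d"
        using that elim a0 by (intro powr_mono2') auto
      then show ?case by (auto simp: \<psi>_def h_def indicator_def)
    qed
  qed (use \<theta> p in auto)
  have AE: "AE x in lborel. z x t * t powr (1 / (p - 1)) < threshold p"
    by (rule heat_semigroup_lt_threshold[OF t])
  have lower: "threshold p \<le> z x t * t powr (1 / (p - 1))" if x: "x \<in> ball 0 d" for x
  proof -
    have "ennreal (1 / 2) \<le> (\<integral>\<^sup>+(y::'a). ennreal (fundamental_solution \<theta> y t) * indicator (ball 0 d) y \<partial>lborel)"
      unfolding d_def by (rule R(2)[OF t(1)])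
    also have "(\<integral>\<^sup>+(y::'a). ennreal (fundamental_solution \<theta> y t) * indicator (ball 0 d) y \<partial>lborel) =
        (\<integral>\<^sup>+y. ennreal (fundamental_solution \<theta> (x - y) t) * indicator (ball 0 d) (x - y) \<partial>lborel)"
      by (subst nn_integral_lborel_affine[where c="-1" and a=x])
        (auto intro!: borel_measurable_times_ennreal borel_measurable_indicator)
    also have "\<dots> \<le> (\<integral>\<^sup>+y. ennreal (fundamental_solution \<theta> (x - y) t) * indicator (ball 0 (2 * d)) y \<partial>lborel)"
    proof (intro nn_integral_mono mult_left_mono)
      fix y
      have "norm y \<le> norm x + norm (x - y)" using norm_triangle_ineq4[of x "x - y"] by simp
      then show "indicator (ball 0 d) (x - y) \<le> (indicator (ball 0 (2 * d)) y :: ennreal)"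
        using x by (auto simp: indicator_def)
    qed simp
    finally have mass: "ennreal (1 / 2) \<le> (\<integral>\<^sup>+y. ennreal (fundamental_solution \<theta> (x - y) t) * indicator (ball 0 (2 * d)) y \<partial>lborel)" .
    have "ennreal (h / 2) = ennreal h * ennreal (1 / 2)"
      using h by (subst ennreal_mult[symmetric]) auto
    also have "\<dots> \<le> ennreal h * (\<integral>\<^sup>+y. ennreal (fundamental_solution \<theta> (x - y) t) * indicator (ball 0 (2 * d)) y \<partial>lborel)"
      using mass by (rule mult_left_mono) simp
    also have "\<dots> = heat_semigroup \<theta> t (\<lambda>y. ennreal h * indicator (ball 0 (2 * d)) y) x"
      by (subst heat_semigroup_cmult) (auto simp: heat_semigroup_lborel intro!: borel_measurable_indicator)
    also have "\<dots> = heat_semigroup \<theta> t (\<lambda>y. ennreal (\<psi> y)) x"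
      using h by (simp add: \<psi>_def ennreal_mult ennreal_indicator)
    also have "\<dots> = ennreal (z x t)"
      using t by (simp add: z_eq)
    finally have "h / 2 \<le> z x t" by (simp add: z_def)
    then have "h / 2 * t powr (1 / (p - 1)) \<le> z x t * t powr (1 / (p - 1))"
      by (intro mult_right_mono) auto
    moreover have "threshold p \<le> h / 2 * t powr (1 / (p - 1))"
    proof -
      have "h = ((2 * R) * t powr (1 / \<theta>)) powr (- a)" by (simp add: h_def d_def mult.assoc)
      also have "\<dots> = (2 * R) powr (- a) * (t powr (1 / \<theta>)) powr (- a)"
        by (rule powr_mult)
      also have "(t powr (1 / \<theta>)) powr (- a) = t powr (- (a / \<theta>))" by (simp add: powr_powr)
      finally have "h = (2 * R) powr (- a) * t powr (- (a / \<theta>))" .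
      then have "h / 2 * t powr (1 / (p - 1)) = (2 * R) powr (- a) / 2 * (t powr (- (a / \<theta>)) * t powr (1 / (p - 1)))"
        by (simp only: mult.assoc times_divide_eq_left)
      also have "t powr (- (a / \<theta>)) * t powr (1 / (p - 1)) = t powr (- \<kappa>)"
        by (simp only: powr_add[symmetric] \<kappa>_def minus_diff_eq uminus_add_conv_diff)
      finally have "h / 2 * t powr (1 / (p - 1)) = (2 * R) powr (- a) / 2 * t powr (- \<kappa>)" .
      moreover have "(2 * R) powr (- a) / 2 * X \<le> (2 * R) powr (- a) / 2 * t powr (- \<kappa>)"
        using X_le by (intro mult_left_mono) auto
      moreover have "(2 * R) powr (- a) / 2 * X = threshold p"
      proof -
        have "(2 * R) powr (- a) * (2 * R) powr a = 1" using R by (simp only: powr_add[symmetric]) simp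
        then have "(2 * R) powr (- a) * (2 * R) powr a * threshold p = threshold p" by (simp only: mult_1)
        then show ?thesis by (simp only: X_def mult_ac)
      qed
      ultimately show ?thesis by (simp only:)
    qed
    ultimately show ?thesis by (rule order_trans[rotated])
  qed
  from AE have "AE x in lborel. x \<notin> ball (0::'a) d"
  proof eventually_elim
    case (elim x)
    with lower[of x] show ?case by (meson not_le)
  qed
  then have "ball (0::'a) d \<in> null_sets lborel"
    by (subst AE_iff_null_sets) auto
  then have "emeasure lborel (ball (0::'a) d) = 0" by (rule null_setsD1)
  then show False
    using content_ball_pos[OF d, of "0::'a"] by (simp add: measure_def)
qed

section \<open>Solvability in uniformly local spaces\<close>

theorem theorem5p1:
  fixes \<theta> p \<rho> :: real
  assumes "0 < \<theta>" and "\<theta> \<le> 2" and "1 < p" and "0 < \<rho>"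
  shows
    "(\<forall>r. r > real DIM('a::euclidean_space) / \<theta> \<and> r \<ge> 1 / (p - 1) \<longrightarrow>
        (\<forall>\<phi> :: 'a \<Rightarrow> real. nonneg_measurable \<phi> \<and> (\<lambda>x. \<phi> x powr ((p - 1) * r)) \<in> L1_ul \<rho> \<longrightarrow>
           has_local_solution \<theta> p \<phi>)) \<and>
     (\<forall>r. r = real DIM('a) / \<theta> \<and> p > 1 + \<theta> / real DIM('a) \<longrightarrow>
        (\<forall>\<phi> :: 'a \<Rightarrow> real. nonneg_measurable \<phi> \<and> (\<lambda>x. \<phi> x powr ((p - 1) * r)) \<in> L1_ul_BUC \<rho> \<longrightarrow>
           has_local_solution \<theta> p \<phi>)) \<and>
     (\<forall>r. 0 < r \<and> r < real DIM('a) / \<theta> \<longrightarrow>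
        (\<exists>\<phi> :: 'a \<Rightarrow> real. nonneg_measurable \<phi> \<and> (\<lambda>x. \<phi> x powr ((p - 1) * r)) \<in> L1_ul \<rho> \<and>
           \<not> has_local_solution \<theta> p \<phi>))"
proof (intro conjI allI impI, goal_cases)
  case (1 r \<phi>)
  then show ?case using assms by (intro has_local_solution_L1_ul[where \<rho>=\<rho> and r=r]) auto
next
  case (2 r \<phi>)
  then show ?case using assms by (intro has_local_solution_L1_ul_BUC[where \<rho>=\<rho>]) auto
next
  case (3 r)
  let ?N = "real DIM('a)"
  have "\<theta> / (p - 1) < ?N / ((p - 1) * r)"
  proof -
    have "\<theta> * r < ?N" using 3 assms by (simp add: pos_less_divide_eq mult.commute)
    then have "\<theta> * r / ((p - 1) * r) < ?N / ((p - 1) * r)"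
      using 3 assms by (intro divide_strict_right_mono) auto
    then show ?thesis using 3 by simp
  qed
  \<comment> \<open>The lower bound on \<open>a\<close> excludes solutions, the upper bound makes \<open>|x|\<^bsup>-a(p-1)r\<^esup>\<close> locally integrable.\<close>
  then obtain a where a: "\<theta> / (p - 1) < a" "a < ?N / ((p - 1) * r)"
    using dense by blast
  have a0: "0 < a" using a(1) assms by (meson divide_pos_pos diff_gt_0_iff_gt less_trans)
  show ?case
  proof (intro exI conjI)
    show "nonneg_measurable (\<lambda>x::'a. norm x powr (- a))"
      unfolding nonneg_measurable_def by (auto intro!: measurable_completion)
    have "(\<lambda>x::'a. norm x powr (- (a * ((p - 1) * r)))) \<in> L1_ul \<rho>"
      using a a0 3 assms by (intro norm_powr_in_L1_ul) (auto simp: field_simps)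
    then show "(\<lambda>x::'a. (norm x powr (- a)) powr ((p - 1) * r)) \<in> L1_ul \<rho>"
      by (simp add: powr_powr)
    show "\<not> has_local_solution \<theta> p (\<lambda>x::'a. norm x powr (- a))"
      using a(1) assms by (intro no_local_solution_norm_powr) auto
  qed
qed

end
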